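(* Let $\varrho$ be a primitive, bijective constant-length substitution of length $L$ that is aperiodic and whose inflation displacement algebra $\mathcal B$ is Abelian. Then, all Lyapunov exponents of the outward iteration $$v(L^nk)=L^{n/2}\,B^{-1}(L^{n-1}k)\cdots B^{-1}(Lk)\,B^{-1}(k)\,v(k)$$ of $\varrho$ are strictly positive, and the geometric realisation of the inflation tiling has singular diffraction. Moreover, all spectral measures of the dynamical spectrum are singular.
   Context: Let $\mathcal A=\{a_1,\dots,a_{n_a}\}$ be a finite alphabet. A substitution $\varrho$ has constant length $L$ if every word $\varrho(a_i)$ has length $L$ (with $L\geqslant2$). It is primitive if the matrix $M_{ij}=\#\{a_i\text{ in }\varrho(a_j)\}$ is primitive; the Perron–Frobenius eigenvalue is then $L$. For $0\leqslant r\leqslant L-1$, the $r$-th column of $\varrho$ is the map sending $a_i$ to the letter at position $r$ (counting from $0$) of $\varrho(a_i)$; $\varrho$ is bijective if every column is a permutation of $\mathcal A$. Geometric realisation: all prototiles are unit intervals, distinguished by type; a tile of type $a_i$ is expanded by $L$ and replaced by the unit tiles listed in $\varrho(a_i)$. The hull $\mathbb Y$ is the closure, in the local topology, of the translation orbit of a tiling of $\mathbb R$ fixed by $\varrho$ or a power of it; $\varrho$ is aperiodic if the elements of $\mathbb Y$ have no non-trivial periods. Each tiling is identified with $\Lambda=\bigcup_i\Lambda_i$, where $\Lambda_i$ is the set of left endpoints of tiles of type $a_i$. The system $(\mathbb Y,\mathbb R)$ is strictly ergodic, with unique invariant probability measure $\mu$. Fourier matrix: $B_{ij}(k)=\sum_{t\in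 T_{ij}}\mathrm e^{2\pi\mathrm i tk}$, where $T_{ij}$ is the set of positions $r\in\{0,\dots,L-1\}$ at which $a_i$ occurs in $\varrho(a_j)$. The inflation displacement algebra (IDA) $\mathcal B$ is the complex subalgebra of $\operatorname{Mat}(n_a,\mathbb C)$ generated by $\{B(k)\mid k\in\mathbb R\}$; Abelian means commutative. Lyapunov exponents of the outward iteration are the values of $\limsup_{n\to\infty}\frac1n\log\bigl\|L^{n/2}B^{-1}(L^{n-1}k)\cdots B^{-1}(k)\,v\bigr\|$ for $0\neq v\in\mathbb C^{n_a}$; they are considered for Lebesgue-a.e. $k\in\mathbb R$. Singular diffraction: with $\nu_{ij}(z)=\operatorname{dens}(\Lambda_i\cap(\Lambda_j-z))/\operatorname{dens}(\Lambda)$ and $\Upsilon_{ij}=\sum_z\nu_{ij}(z)\delta_z$ (independent of $\Lambda\in\mathbb Y$), the autocorrelation of $\sum_iu_i\delta_{\Lambda_i}$, $u\in\mathbb C^{n_a}$, is $\gamma_u=\operatorname{dens}(\Lambda)\sum_{i,j}\overline{u_i}\Upsilon_{ij}u_j$, and the diffraction measure $\widehat{\gamma_u}$ has vanishing absolutely continuous part for every $u$. The dynamical spectrum is that of the unitary translation representation on $L^2(\mathbb Y,\mu)$; a spectral measure is the measure $\sigma_f$ on the dual group determined by $f\in L^2(\mathbb Y,\mu)$, and singular means having no absolutely continuous part with respect to Lebesgue measure. (For constant-length substitutions, the paper regards this and the symbolic system under the shift as equivalent viewpoints.) *)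

theory Defs
  imports
    "HOL-Analysis.Analysis"
    "HOL-Probability.Probability"
    "HOL-Library.Sublist"
    "HOL-Library.Liminf_Limsup"
    "HOL-Library.Extended_Real"
begin

section \<open>Substitutions of constant length\<close>

type_synonym 'a substitution = "'a \<Rightarrow> 'a list"

definition constant_length :: "nat \<Rightarrow> 'a substitution \<Rightarrow> bool" where
  "constant_length L \<rho> \<longleftrightarrow> L \<ge> 2 \<and> (\<forall>a. length (\<rho> a) = L)"

definition substitution_matrix :: "'a::finite substitution \<Rightarrow> real^'a^'a" where
  "substitution_matrix \<rho> = (\<chi> i j. real (count_list (\<rho> j) i))"

definition primitive_matrix :: "real^'a^'a::finite \<Rightarrow> bool" where
  "primitive_matrix M \<longleftrightarrow>
     (\<forall>i j. M $ i $ j \<ge> 0) \<and> (\<exists>n\<ge>1. \<forall>i j. (((**) M ^^ n) (mat 1)) $ i $ j > 0)"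

definition primitive_substitution :: "'a::finite substitution \<Rightarrow> bool" where
  "primitive_substitution \<rho> \<longleftrightarrow> primitive_matrix (substitution_matrix \<rho>)"

definition column :: "'a substitution \<Rightarrow> nat \<Rightarrow> 'a \<Rightarrow> 'a" where
  "column \<rho> r a = \<rho> a ! r"

definition bijective_substitution :: "nat \<Rightarrow> 'a substitution \<Rightarrow> bool" where
  "bijective_substitution L \<rho> \<longleftrightarrow> (\<forall>r<L. bij (column \<rho> r))"

definition substitute_word :: "'a substitution \<Rightarrow> 'a list \<Rightarrow> 'a list" where
  "substitute_word \<rho> w = concat (map \<rho> w)"

definition legal_word :: "'a substitution \<Rightarrow> 'a list \<Rightarrow> bool" where
  "legal_word \<rho> w \<longleftrightarrow> (\<exists>n a. sublist w ((substitute_word \<rho> ^^ n) [a]))"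


section \<open>Tilings of the line and the hull\<close>

text \<open>
  A tiling by unit intervals is encoded by the family of the sets of left endpoints of its tiles,
  indexed by the tile type.
\<close>

type_synonym 'a tiling = "'a \<Rightarrow> real set"

definition tiling_of :: "real \<Rightarrow> (int \<Rightarrow> 'a) \<Rightarrow> 'a tiling" where
  "tiling_of x w = (\<lambda>i. {x + of_int n |n. w n = i})"

definition translate :: "real \<Rightarrow> 'a tiling \<Rightarrow> 'a tiling" where
  "translate t \<Lambda> = (\<lambda>i. (\<lambda>x. x + t) ` \<Lambda> i)"

definition inflate :: "nat \<Rightarrow> 'a substitution \<Rightarrow> 'a tiling \<Rightarrow> 'a tiling" where
  "inflate L \<rho> \<Lambda> = (\<lambda>i. {real L * x + real r |x r j. x \<in> \<Lambda> j \<and> r < L \<and> \<rho> j ! r = i})"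

text \<open>
  Only legal fixed points are admitted: a fixed point that is grown from a seed which occurs in no
  iterated image of a letter does not have a minimal orbit closure.
\<close>

definition inflation_fixed_point :: "nat \<Rightarrow> 'a substitution \<Rightarrow> 'a tiling \<Rightarrow> bool" where
  "inflation_fixed_point L \<rho> \<Lambda> \<longleftrightarrow>
     (\<exists>x w. \<Lambda> = tiling_of x w \<and> (\<forall>m n. legal_word \<rho> (map w [m..n]))) \<and>
     (\<exists>p\<ge>1. (inflate L \<rho> ^^ p) \<Lambda> = \<Lambda>)"

text \<open>
  Tilings are \<open>\<epsilon>\<close>-close in the local topology if, after a translation by less than \<open>\<epsilon>\<close>,
  they agree on the interval \<open>(-1/\<epsilon>, 1/\<epsilon>)\<close>.
\<close>

definition local_ball :: "real \<Rightarrow> 'a tiling \<Rightarrow> 'a tiling set" where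
  "local_ball \<epsilon> \<Lambda> =
     {\<Lambda>'. \<exists>s. \<bar>s\<bar> < \<epsilon> \<and> (\<forall>i. \<Lambda>' i \<inter> ball 0 (1/\<epsilon>) = translate s \<Lambda> i \<inter> ball 0 (1/\<epsilon>))}"

definition local_topology :: "'a tiling topology" where
  "local_topology = topology (\<lambda>U. \<forall>\<Lambda>\<in>U. \<exists>\<epsilon>>0. local_ball \<epsilon> \<Lambda> \<subseteq> U)"

lemma local_ball_mono:
  assumes "0 < \<delta>" "\<delta> \<le> \<epsilon>"
  shows "local_ball \<delta> \<Lambda> \<subseteq> local_ball \<epsilon> \<Lambda>"
proof
  fix \<Lambda>' assume "\<Lambda>' \<in> local_ball \<delta> \<Lambda>"
  then obtain s where s: "\<bar>s\<bar> < \<delta>"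
    "\<And>i. \<Lambda>' i \<inter> ball 0 (1/\<delta>) = translate s \<Lambda> i \<inter> ball 0 (1/\<delta>)"
    by (auto simp: local_ball_def)
  have "ball 0 (1/\<epsilon>) \<subseteq> (ball 0 (1/\<delta>) :: real set)"
    using assms by (intro subset_ball) (simp add: frac_le)
  then have "\<Lambda>' i \<inter> ball 0 (1/\<epsilon>) = translate s \<Lambda> i \<inter> ball 0 (1/\<epsilon>)" for i
    using s(2)[of i] by blast
  with s(1) assms show "\<Lambda>' \<in> local_ball \<epsilon> \<Lambda>"
    unfolding local_ball_def by (intro CollectI exI[of _ s]) auto
qed

lemma openin_local_topology:
  "openin local_topology U \<longleftrightarrow> (\<forall>\<Lambda>\<in>U. \<exists>\<epsilon>>0. local_ball \<epsilon> \<Lambda> \<subseteq> U)"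
proof -
  have "istopology (\<lambda>U :: 'a tiling set. \<forall>\<Lambda>\<in>U. \<exists>\<epsilon>>0. local_ball \<epsilon> \<Lambda> \<subseteq> U)"
    unfolding istopology_def
  proof (intro conjI allI impI ballI)
    fix S T :: "'a tiling set" and \<Lambda>
    assume S: "\<forall>\<Lambda>\<in>S. \<exists>\<epsilon>>0. local_ball \<epsilon> \<Lambda> \<subseteq> S" and T: "\<forall>\<Lambda>\<in>T. \<exists>\<epsilon>>0. local_ball \<epsilon> \<Lambda> \<subseteq> T"
      and "\<Lambda> \<in> S \<inter> T"
    then obtain \<epsilon> \<delta> where *: "\<epsilon> > 0" "local_ball \<epsilon> \<Lambda> \<subseteq> S" "\<delta> > 0" "local_ball \<delta> \<Lambda> \<subseteq> T"
      by (meson IntD1 IntD2)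
    have "local_ball (min \<epsilon> \<delta>) \<Lambda> \<subseteq> local_ball \<epsilon> \<Lambda>" "local_ball (min \<epsilon> \<delta>) \<Lambda> \<subseteq> local_ball \<delta> \<Lambda>"
      by (rule local_ball_mono; use * in simp)+
    with * show "\<exists>\<epsilon>>0. local_ball \<epsilon> \<Lambda> \<subseteq> S \<inter> T"
      by (intro exI[of _ "min \<epsilon> \<delta>"]) auto
  next
    fix K :: "'a tiling set set" and \<Lambda>
    assume "\<forall>S\<in>K. \<forall>\<Lambda>\<in>S. \<exists>\<epsilon>>0. local_ball \<epsilon> \<Lambda> \<subseteq> S" and "\<Lambda> \<in> \<Union>K"
    then show "\<exists>\<epsilon>>0. local_ball \<epsilon> \<Lambda> \<subseteq> \<Union>K" by (meson Sup_upper UnionE order_trans)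
  qed
  then show ?thesis by (simp add: local_topology_def)
qed

definition hull_of_tiling :: "'a tiling \<Rightarrow> 'a tiling set" where
  "hull_of_tiling \<Lambda> = local_topology closure_of (range (\<lambda>t. translate t \<Lambda>))"

definition is_hull :: "nat \<Rightarrow> 'a substitution \<Rightarrow> 'a tiling set \<Rightarrow> bool" where
  "is_hull L \<rho> Y \<longleftrightarrow> (\<exists>\<Lambda>. inflation_fixed_point L \<rho> \<Lambda> \<and> Y = hull_of_tiling \<Lambda>)"

definition aperiodic_hull :: "'a tiling set \<Rightarrow> bool" where
  "aperiodic_hull Y \<longleftrightarrow> (\<forall>\<Lambda>\<in>Y. \<forall>t. translate t \<Lambda> = \<Lambda> \<longrightarrow> t = 0)"

definition hull_borel :: "'a tiling set \<Rightarrow> 'a tiling measure" where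
  "hull_borel Y = sigma Y {U. openin (subtopology local_topology Y) U}"

definition invariant_probability :: "'a tiling set \<Rightarrow> 'a tiling measure \<Rightarrow> bool" where
  "invariant_probability Y \<mu> \<longleftrightarrow>
     sets \<mu> = sets (hull_borel Y) \<and> prob_space \<mu> \<and>
     (\<forall>t. translate t \<in> measurable \<mu> \<mu> \<and> distr \<mu> \<mu> (translate t) = \<mu>)"


section \<open>Fourier matrix, inflation displacement algebra and Lyapunov exponents\<close>

definition displacement_set :: "'a substitution \<Rightarrow> 'a \<Rightarrow> 'a \<Rightarrow> nat set" where
  "displacement_set \<rho> i j = {r. r < length (\<rho> j) \<and> \<rho> j ! r = i}"

definition fourier_matrix :: "'a::finite substitution \<Rightarrow> real \<Rightarrow> complex^'a^'a" where
  "fourier_matrix \<rho> k =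
     (\<chi> i j. \<Sum>t\<in>displacement_set \<rho> i j. exp (2 * pi * \<i> * of_nat t * of_real k))"

definition complex_subalgebra :: "(complex^'a^'a::finite) set \<Rightarrow> bool" where
  "complex_subalgebra S \<longleftrightarrow>
     0 \<in> S \<and> (\<forall>A\<in>S. \<forall>B\<in>S. A + B \<in> S) \<and> (\<forall>c. \<forall>A\<in>S. (\<chi> i j. c * A $ i $ j) \<in> S) \<and>
     (\<forall>A\<in>S. \<forall>B\<in>S. A ** B \<in> S)"

definition IDA :: "'a::finite substitution \<Rightarrow> (complex^'a^'a) set" where
  "IDA \<rho> = complex_subalgebra hull (range (fourier_matrix \<rho>))"

definition abelian_algebra :: "(complex^'a^'a::finite) set \<Rightarrow> bool" where
  "abelian_algebra S \<longleftrightarrow> (\<forall>A\<in>S. \<forall>B\<in>S. A ** B = B ** A)"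

primrec inverse_cocycle :: "nat \<Rightarrow> 'a::finite substitution \<Rightarrow> nat \<Rightarrow> real \<Rightarrow> complex^'a^'a" where
  "inverse_cocycle L \<rho> 0 k = mat 1"
| "inverse_cocycle L \<rho> (Suc n) k =
     matrix_inv (fourier_matrix \<rho> (real L ^ n * k)) ** inverse_cocycle L \<rho> n k"

text \<open>
  For all but countably many \<open>k\<close>, every matrix inverted in \<open>inverse_cocycle\<close> is invertible and the
  logarithm below has a positive argument.
\<close>

definition lyapunov_exponent ::
    "nat \<Rightarrow> 'a::finite substitution \<Rightarrow> real \<Rightarrow> complex^'a \<Rightarrow> ereal" where
  "lyapunov_exponent L \<rho> k v =
     limsup (\<lambda>n. ereal (ln (norm ((real L powr (real n / 2)) *\<^sub>R (inverse_cocycle L \<rho> n k *v v)))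
                        / real n))"

definition lyapunov_exponents :: "nat \<Rightarrow> 'a::finite substitution \<Rightarrow> real \<Rightarrow> ereal set" where
  "lyapunov_exponents L \<rho> k = {lyapunov_exponent L \<rho> k v |v. v \<noteq> 0}"


section \<open>Singular measures\<close>

definition lebesgue_decomposition ::
    "real measure \<Rightarrow> real measure \<Rightarrow> real measure \<Rightarrow> bool" where
  "lebesgue_decomposition \<sigma> \<alpha> \<beta> \<longleftrightarrow>
     sets \<sigma> = sets borel \<and> sets \<alpha> = sets borel \<and> sets \<beta> = sets borel \<and>
     absolutely_continuous lborel \<alpha> \<and>
     (\<exists>N\<in>null_sets lborel. emeasure \<beta> (- N) = 0) \<and>
     (\<forall>A\<in>sets borel. emeasure \<sigma> A = emeasure \<alpha> A + emeasure \<beta> A)"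

definition singular_measure :: "real measure \<Rightarrow> bool" where
  "singular_measure \<sigma> \<longleftrightarrow> (\<exists>\<beta>. lebesgue_decomposition \<sigma> (null_measure lborel) \<beta>)"

lemma singular_measure_iff:
  "singular_measure \<sigma> \<longleftrightarrow>
     sets \<sigma> = sets borel \<and> (\<exists>N\<in>null_sets lborel. emeasure \<sigma> (- N) = 0)"
proof
  assume "singular_measure \<sigma>"
  then obtain \<beta> N where *: "sets \<sigma> = sets borel" "N \<in> null_sets lborel" "emeasure \<beta> (- N) = 0"
    "\<forall>A\<in>sets borel. emeasure \<sigma> A = emeasure \<beta> A"
    by (auto simp: singular_measure_def lebesgue_decomposition_def)
  have "- N \<in> sets borel"
    using null_setsD2[OF *(2)] by auto
  then have "emeasure \<sigma> (- N) = 0"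
    using *(3,4) by auto
  with *(1,2) show "sets \<sigma> = sets borel \<and> (\<exists>N\<in>null_sets lborel. emeasure \<sigma> (- N) = 0)" by blast
next
  assume "sets \<sigma> = sets borel \<and> (\<exists>N\<in>null_sets lborel. emeasure \<sigma> (- N) = 0)"
  then have "lebesgue_decomposition \<sigma> (null_measure lborel) \<sigma>"
    by (auto simp: lebesgue_decomposition_def absolutely_continuous_def null_sets_def)
  then show "singular_measure \<sigma>" unfolding singular_measure_def by blast
qed

lemma singular_measure_ac_part:
  assumes "singular_measure \<sigma>" "lebesgue_decomposition \<sigma> \<alpha> \<beta>" "A \<in> sets borel"
  shows "emeasure \<alpha> A = 0"
proof -
  obtain N where N: "N \<in> null_sets lborel" "emeasure \<sigma> (- N) = 0"
    using assms(1) by (auto simp: singular_measure_iff)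
  have [simp]: "sets \<alpha> = sets borel" and ac: "absolutely_continuous lborel \<alpha>"
    and dec: "\<And>A. A \<in> sets borel \<Longrightarrow> emeasure \<sigma> A = emeasure \<alpha> A + emeasure \<beta> A"
    using assms(2) by (auto simp: lebesgue_decomposition_def)
  have [simp]: "N \<in> sets borel" "- N \<in> sets borel"
    using null_setsD2[OF N(1)] by auto
  have "- N \<in> null_sets \<alpha>"
    using dec[of "- N"] N(2) by (auto simp: null_sets_def)
  moreover have "N \<in> null_sets \<alpha>"
    using ac N(1) by (auto simp: absolutely_continuous_def)
  ultimately have "N \<union> - N \<in> null_sets \<alpha>" by blast
  then show ?thesis
    using assms(3) by (metis \<open>sets \<alpha> = sets borel\<close> Compl_partition emeasure_mono le_zero_eq
        null_setsD1 null_setsD2 subset_UNIV)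
qed


section \<open>Diffraction\<close>

definition dens :: "real set \<Rightarrow> real" where
  "dens S = Lim at_top (\<lambda>R. real (card (S \<inter> {-R..R})) / (2 * R))"

definition pair_correlation :: "'a tiling \<Rightarrow> 'a \<Rightarrow> 'a \<Rightarrow> real \<Rightarrow> real" where
  "pair_correlation \<Lambda> i j z = dens (\<Lambda> i \<inter> (\<lambda>x. x - z) ` \<Lambda> j) / dens (\<Union>l. \<Lambda> l)"

text \<open>
  \<open>autocorrelation \<Lambda> u z\<close> is the mass at \<open>z\<close> of the pure point measure \<open>\<gamma>\<^sub>u\<close>.
\<close>

definition autocorrelation :: "'a::finite tiling \<Rightarrow> complex^'a \<Rightarrow> real \<Rightarrow> complex" where
  "autocorrelation \<Lambda> u z =
     of_real (dens (\<Union>l. \<Lambda> l)) *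
     (\<Sum>i\<in>UNIV. \<Sum>j\<in>UNIV. cnj (u $ i) * of_real (pair_correlation \<Lambda> i j z) * (u $ j))"

definition schwartz_function :: "(real \<Rightarrow> complex) \<Rightarrow> bool" where
  "schwartz_function \<phi> \<longleftrightarrow>
     (\<exists>D :: nat \<Rightarrow> real \<Rightarrow> complex. D 0 = \<phi> \<and>
        (\<forall>n x. (D n has_vector_derivative D (Suc n) x) (at x)) \<and>
        (\<forall>n m. bounded (range (\<lambda>x. (x ^ m) *\<^sub>R D n x))))"

definition fourier_transform :: "(real \<Rightarrow> complex) \<Rightarrow> real \<Rightarrow> complex" where
  "fourier_transform \<phi> y = (LINT x|lborel. exp (- 2 * pi * \<i> * of_real (x * y)) * \<phi> x)"

text \<open>
  The Fourier transform of the pure point measure with point masses \<open>\<gamma>\<close>, in the sense of tempered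
  distributions: \<open>\<langle>\<sigma>, \<phi>\<rangle> = \<langle>\<gamma>, fourier_transform \<phi>\<rangle>\<close>
  for all Schwartz functions \<open>\<phi>\<close>.  A positive measure \<open>\<sigma>\<close> is uniquely determined by this.
\<close>

definition is_fourier_transform_of :: "real measure \<Rightarrow> (real \<Rightarrow> complex) \<Rightarrow> bool" where
  "is_fourier_transform_of \<sigma> \<gamma> \<longleftrightarrow>
     sets \<sigma> = sets borel \<and>
     (\<forall>\<phi>. schwartz_function \<phi> \<longrightarrow> integrable \<sigma> \<phi> \<and>
          ((\<lambda>z. \<gamma> z * fourier_transform \<phi> z) has_sum (LINT k|\<sigma>. \<phi> k)) UNIV)"

definition is_diffraction_measure ::
    "'a::finite tiling \<Rightarrow> complex^'a \<Rightarrow> real measure \<Rightarrow> bool" where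
  "is_diffraction_measure \<Lambda> u \<sigma> \<longleftrightarrow> is_fourier_transform_of \<sigma> (autocorrelation \<Lambda> u)"


section \<open>Dynamical spectrum\<close>

definition square_integrable :: "'b measure \<Rightarrow> ('b \<Rightarrow> complex) \<Rightarrow> bool" where
  "square_integrable M f \<longleftrightarrow> f \<in> borel_measurable M \<and> integrable M (\<lambda>x. (cmod (f x))\<^sup>2)"

definition koopman :: "real \<Rightarrow> ('a tiling \<Rightarrow> complex) \<Rightarrow> 'a tiling \<Rightarrow> complex" where
  "koopman t f = (\<lambda>\<Lambda>. f (translate (- t) \<Lambda>))"

text \<open>
  The dual group of the real line is identified with the real line by
  \<open>k \<mapsto> (t \<mapsto> exp (2 \<pi> \<i> k t))\<close>.  A finite measure \<open>\<sigma>\<close> is uniquely determined by the condition.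
\<close>

definition is_spectral_measure ::
    "'a tiling measure \<Rightarrow> ('a tiling \<Rightarrow> complex) \<Rightarrow> real measure \<Rightarrow> bool" where
  "is_spectral_measure \<mu> f \<sigma> \<longleftrightarrow>
     sets \<sigma> = sets borel \<and> finite_measure \<sigma> \<and>
     (\<forall>t. (LINT \<Lambda>|\<mu>. cnj (f \<Lambda>) * koopman t f \<Lambda>)
          = (LINT k|\<sigma>. exp (2 * pi * \<i> * of_real (k * t))))"

end

theory Submission
  imports Defs
begin

text \<open>
  Write \<open>e(k) = exp(2 \<pi> i k)\<close>.  Fourier inversion turns commutativity of the displacement algebra into
  commutativity of the columns, as permutations of the alphabet
  (\<open>IDA_abelian_imp_columns_commute\<close>).  Commuting permutations of a finite set are simultaneously
  diagonalisable with unimodular eigenvalues, so every function on the alphabet is a combination of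
  functions \<open>\<phi>\<close> that satisfy \<open>\<phi>(\<rho>(a)\<^sub>r) = \<lambda>\<^sub>r \<phi>(a)\<close> for all letters \<open>a\<close> and all
  positions \<open>r\<close> (\<open>joint_eigenbasis\<close>).
  Such a \<open>\<phi>\<close> is a left eigenvector of every \<open>B(k)\<close>, with eigenvalue \<open>P(k) = \<Sum>\<^sub>r \<lambda>\<^sub>r e(r k)\<close>.
  Everything is then governed by the products \<open>Q\<^sub>n(k) = \<Prod> P(L\<^sup>j k)\<close> over \<open>j < n\<close>, which are
  trigonometric polynomials with \<open>L\<^sup>n\<close> unimodular coefficients.

  \<^emph>\<open>Decay.\<close>  The function \<open>y = |P|\<^sup>2 / L\<close> has mean one, but it is not constant, because its outermost
  Fourier coefficient has modulus \<open>1 / L\<close>.  Since \<open>ln y \<le> (y - 1) - (y - 1)\<^sup>2 / (2 L)\<close> and the right hand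
  side is a trigonometric polynomial of negative mean, its averages along \<open>k, L k, L\<^sup>2 k, \<dots>\<close>
  show that \<open>|Q\<^sub>n(k)|\<^sup>2\<close> is smaller than \<open>L\<^sup>n\<close> by an exponential factor, for almost every \<open>k\<close>
  (\<open>AE_Q_exponential_decay\<close>).  It suffices to let \<open>n\<close> run through the squares; the averages then converge
  by a variance estimate and summability alone.  The inverse cocycle stretches the component along
  \<open>\<phi>\<close> by \<open>1 / |Q\<^sub>n|\<close>, which gives positive exponents (\<open>lyapunov_exponents_positive\<close>).

  \<^emph>\<open>Damping.\<close>  Let \<open>g = (1 - t)\<^sup>J\<close>, where \<open>t\<close> is the average over the \<open>\<phi>\<close> of \<open>|Q\<^sub>n|\<^sup>2 / L\<^sup>2\<^sup>n\<close> and where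
  \<open>J\<close> is large compared with \<open>L\<^sup>n\<close>, but small compared with \<open>L\<^sup>n\<close> times an exponential in \<open>n\<close>.  As \<open>n\<close> grows,
  \<open>g \<rightarrow> 1\<close> almost everywhere, although \<open>g |Q\<^sub>n|\<^sup>2\<close> is everywhere small in comparison with
  \<open>L\<^sup>n\<close>.  A function of the letters of a long legal word is a combination of the \<open>\<phi>\<close>, and grouping the
  letters into supertiles of level \<open>n\<close> extracts the factor \<open>Q\<^sub>n\<close> from its Fourier sum; hence the
  multiplier \<open>g\<close> removes almost all of its energy (\<open>energy_legal_word_le\<close>).  A measure that gives small
  integrals to functions which tend to one almost everywhere is singular
  (\<open>singular_measure_criterion\<close>), by Fatou's lemma.

  \<^emph>\<open>Spectra.\<close>  For the diffraction measure, the integral of \<open>g\<close> against a Gaussian is bounded in terms of limits of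
  energies per unit length of the weights along the tiling.  These limits exist because pairs of letters have uniform frequencies, which is where
  primitivity enters.  For a spectral measure, \<open>f\<close> is approximated by a function that depends on the tiling
  in a bounded window only.  When the orbit is sampled with step \<open>L\<^sup>N\<close>, such a function sees only the
  type of the supertile of level \<open>N\<close>, except for a proportion \<open>O(L\<^sup>-\<^sup>N)\<close> of the sampling offsets at which
  the window meets a boundary (\<open>energy_block_code_le\<close>).
\<close>

section \<open>Trigonometric polynomials\<close>

definition ee :: "real \<Rightarrow> complex" where
  "ee x = cis (2 * pi * x)"

lemma ee_0 [simp]: "ee 0 = 1"
  by (simp add: ee_def)

lemma ee_add: "ee (x + y) = ee x * ee y"
  by (simp add: ee_def cis_mult distrib_left)

lemma ee_diff: "ee (x - y) = ee x * cnj (ee y)"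
  by (simp add: ee_def cis_mult cis_cnj right_diff_distrib)

lemma cnj_ee: "cnj (ee x) = ee (- x)"
  by (simp add: ee_def cis_cnj)

lemma norm_ee [simp]: "norm (ee x) = 1"
  by (simp add: ee_def)

lemma ee_mult_cnj [simp]: "ee x * cnj (ee x) = 1"
  by (metis ee_diff cancel_comm_monoid_add_class.diff_cancel ee_0)

lemma ee_of_int [simp]: "ee (of_int m) = 1"
  unfolding ee_def by (rule cis_multiple_2pi) simp

lemma ee_of_nat_mult: "ee (real n * x) = ee x ^ n"
proof -
  have "ee (real n * x) = cis (real n * (2 * pi * x))"
    by (simp add: ee_def mult_ac)
  also have "\<dots> = ee x ^ n"
    unfolding ee_def by (rule Complex.DeMoivre[symmetric])
  finally show ?thesis .
qed

lemma ee_eq_exp: "ee x = exp (2 * pi * \<i> * of_real x)"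
  by (simp add: ee_def cis_conv_exp mult_ac)

lemma continuous_ee [continuous_intros]:
  "continuous_on S f \<Longrightarrow> continuous_on S (\<lambda>x. ee (f x))"
  unfolding ee_def by (intro continuous_intros)

lemma measurable_ee [measurable]: "ee \<in> borel_measurable borel"
  by (intro borel_measurable_continuous_onI continuous_intros)

text \<open>
  Almost everywhere statements on the line follow from those on all unit intervals; on each of these
  the characters are orthonormal.
\<close>

definition unit_measure :: "real \<Rightarrow> real measure" where
  "unit_measure c = density lborel (\<lambda>k. ennreal (indicator {c..c + 1} k))"

lemma sets_unit_measure [measurable_cong, simp]: "sets (unit_measure c) = sets borel"
  by (simp add: unit_measure_def)

lemma space_unit_measure [simp]: "space (unit_measure c) = UNIV"
  by (simp add: unit_measure_def)

lemma prob_space_unit_measure: "prob_space (unit_measure c)"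
  by (rule prob_spaceI) (simp add: unit_measure_def emeasure_density ennreal_indicator)

interpretation unit_measure: prob_space "unit_measure c" for c
  by (rule prob_space_unit_measure)

lemma AE_unit_measure:
  "(AE k in unit_measure c. P k) \<longleftrightarrow> (AE k in lborel. k \<in> {c..c + 1} \<longrightarrow> P k)"
  unfolding unit_measure_def by (subst AE_density) (auto simp: indicator_def)

lemma AE_lborel_if_AE_unit_measure:
  assumes "\<And>c. AE k in unit_measure c. P k"
  shows "AE k in lborel. P k"
proof -
  have "AE k in lborel. \<forall>c::int. k \<in> {of_int c..of_int c + 1} \<longrightarrow> P k"
    using assms by (subst AE_all_countable) (auto simp: AE_unit_measure)
  then show ?thesis
  proof eventually_elim
    case (elim k)
    have "k \<in> {of_int \<lfloor>k\<rfloor>..of_int \<lfloor>k\<rfloor> + 1}"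
      by (simp add: less_imp_le)
    with elim show ?case by blast
  qed
qed

lemma integral_unit_measure_ee:
  "(LINT k|unit_measure c. ee (of_int m * k)) = (if m = 0 then 1 else 0)"
proof (cases "m = 0")
  case False
  define F where "F = (\<lambda>k. ee (of_int m * k) / (2 * pi * \<i> * of_int m))"
  have "(LINT k|unit_measure c. ee (of_int m * k))
      = (LINT k|lborel. indicator {c..c + 1} k *\<^sub>R ee (of_int m * k))"
    unfolding unit_measure_def
    by (subst integral_density) (auto simp: indicator_def)
  also have "\<dots> = F (c + 1) - F c"
  proof (rule integral_FTC_Icc)
    fix x :: real
    assume "c \<le> x" "x \<le> c + 1"
    show "(F has_vector_derivative ee (of_int m * x)) (at x within {c..c + 1})"
    proof -
      define a where "a = 2 * pi * \<i> * of_int m"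
      have "a \<noteq> 0" using False by (simp add: a_def)
      then have "((\<lambda>z. exp (a * z) / a) has_field_derivative exp (a * of_real x)) (at (of_real x))"
        by (auto intro!: derivative_eq_intros)
      from has_vector_derivative_real_field[OF this]
      show ?thesis by (simp add: F_def ee_eq_exp a_def mult_ac)
    qed
  qed (auto intro!: continuous_intros)
  also have "F (c + 1) = F c"
    unfolding F_def by (simp add: distrib_left ee_add)
  finally show ?thesis using False by simp
qed (use unit_measure.prob_space[of c] in simp)

text \<open>
  The closure of the characters of the circle under linear combinations; as most properties
  below are linear, this inductive form lets them be checked on characters only.
\<close>

inductive trig_poly :: "(real \<Rightarrow> complex) \<Rightarrow> bool" where
  trig_poly_ee: "trig_poly (\<lambda>k. ee (of_int m * k))"
| trig_poly_add: "trig_poly f \<Longrightarrow> trig_poly g \<Longrightarrow> trig_poly (\<lambda>k. f k + g k)"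
| trig_poly_scale: "trig_poly f \<Longrightarrow> trig_poly (\<lambda>k. c * f k)"

lemma trig_poly_ee_nat: "trig_poly (\<lambda>k. ee (of_nat m * k))"
  using trig_poly_ee[of "int m"] by simp

lemma trig_poly_const: "trig_poly (\<lambda>_. c)"
  using trig_poly_scale[OF trig_poly_ee[of 0], of c] by simp

lemma trig_poly_sum:
  "(\<And>i. i \<in> A \<Longrightarrow> trig_poly (f i)) \<Longrightarrow> trig_poly (\<lambda>k. \<Sum>i\<in>A. f i k)"
  by (induction A rule: infinite_finite_induct) (auto intro: trig_poly_const trig_poly_add)

lemma trig_poly_diff: "trig_poly f \<Longrightarrow> trig_poly g \<Longrightarrow> trig_poly (\<lambda>k. f k - g k)"
  using trig_poly_add[of f "\<lambda>k. - 1 * g k"] trig_poly_scale[of g "-1"] by simp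

lemma trig_poly_mult:
  assumes "trig_poly f" "trig_poly g"
  shows "trig_poly (\<lambda>k. f k * g k)"
  using assms(1)
proof induction
  case (trig_poly_ee m)
  show ?case using assms(2)
  proof induction
    case (trig_poly_ee n)
    have "(\<lambda>k. ee (of_int m * k) * ee (of_int n * k)) = (\<lambda>k. ee (of_int (m + n) * k))"
      by (simp add: ee_add distrib_right)
    then show ?case by (simp only: trig_poly.trig_poly_ee)
  next
    case (trig_poly_add f g)
    then show ?case using trig_poly.trig_poly_add by (simp add: distrib_left)
  next
    case (trig_poly_scale f c)
    then show ?case using trig_poly.trig_poly_scale[of _ c] by (simp add: mult_ac)
  qed
next
  case (trig_poly_add f g)
  then show ?case using trig_poly.trig_poly_add by (simp add: distrib_right)
next
  case (trig_poly_scale f c)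
  then show ?case using trig_poly.trig_poly_scale[of _ c] by (simp add: mult_ac)
qed

lemma trig_poly_power: "trig_poly f \<Longrightarrow> trig_poly (\<lambda>k. f k ^ n)"
  by (induction n) (auto intro: trig_poly_const trig_poly_mult)

lemma trig_poly_cnj: "trig_poly f \<Longrightarrow> trig_poly (\<lambda>k. cnj (f k))"
proof (induction rule: trig_poly.induct)
  case (trig_poly_ee m)
  have "(\<lambda>k. cnj (ee (of_int m * k))) = (\<lambda>k. ee (of_int (- m) * k))"
    by (simp add: cnj_ee)
  then show ?case by (simp only: trig_poly.trig_poly_ee)
qed (auto intro: trig_poly.intros)

lemma trig_poly_cmod_square: "trig_poly f \<Longrightarrow> trig_poly (\<lambda>k. complex_of_real ((cmod (f k))\<^sup>2))"
  unfolding complex_norm_square by (intro trig_poly_mult trig_poly_cnj)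

lemma trig_poly_comp_scale: "trig_poly f \<Longrightarrow> trig_poly (\<lambda>k. f (of_nat M * k))"
proof (induction rule: trig_poly.induct)
  case (trig_poly_ee m)
  have "(\<lambda>k. ee (of_int m * (of_nat M * k))) = (\<lambda>k. ee (of_int (m * int M) * k))"
    by (simp add: mult_ac)
  then show ?case by (simp only: trig_poly.trig_poly_ee)
qed (auto intro: trig_poly.intros)

lemma continuous_trig_poly: "trig_poly f \<Longrightarrow> continuous_on S f"
  by (induction rule: trig_poly.induct) (intro continuous_intros | assumption)+

lemma measurable_trig_poly [measurable_dest]: "trig_poly f \<Longrightarrow> f \<in> borel_measurable borel"
  by (rule borel_measurable_continuous_onI) (rule continuous_trig_poly)

lemma bounded_trig_poly:
  assumes "trig_poly f"
  obtains C where "\<And>k. norm (f k) \<le> C"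
proof -
  from assms have "\<exists>C. \<forall>k. norm (f k) \<le> C"
  proof (induction rule: trig_poly.induct)
    case (trig_poly_ee m)
    show ?case by auto
  next
    case (trig_poly_add f g)
    then obtain C D where "norm (f k) \<le> C" "norm (g k) \<le> D" for k by auto
    then have "norm (f k + g k) \<le> C + D" for k
      by (meson add_mono norm_triangle_ineq order_trans)
    then show ?case by auto
  next
    case (trig_poly_scale f c)
    then obtain C where "norm (f k) \<le> C" for k by auto
    then have "norm (c * f k) \<le> norm c * C" for k
      by (simp add: norm_mult mult_left_mono)
    then show ?case by auto
  qed
  with that show thesis by auto
qed

lemma integrable_trig_poly:
  assumes "trig_poly f" "finite_measure M" "sets M = sets borel"
  shows "integrable M f"
proof -
  obtain C where "\<And>k. norm (f k) \<le> C" using bounded_trig_poly[OF assms(1)] by auto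
  moreover have "f \<in> borel_measurable M"
    using measurable_trig_poly[OF assms(1)] assms(3) by (simp cong: measurable_cong_sets)
  ultimately show ?thesis
    by (intro finite_measure.integrable_const_bound[OF assms(2), of _ C]) auto
qed

lemma integrable_unit_measure_trig_poly: "trig_poly f \<Longrightarrow> integrable (unit_measure c) f"
  by (rule integrable_trig_poly) (auto intro: unit_measure.finite_measure_axioms)

lemma integral_ee_times_trig_sum:
  assumes "finite A"
  shows "(LINT k|unit_measure c. ee (of_int m * k) * (\<Sum>q\<in>A. x q * ee (real q * k)) *
             cnj (\<Sum>q\<in>A. x q * ee (real q * k)))
       = (\<Sum>q\<in>A. \<Sum>q'\<in>A. if m + int q = int q' then x q * cnj (x q') else 0)"
proof -
  have summand: "ee (of_int m * k) * (x q * ee (real q * k)) * cnj (x q' * ee (real q' * k))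
      = x q * cnj (x q') * ee (of_int (m + int q - int q') * k)" for q q' k
  proof -
    have "of_int (m + int q - int q') * k = of_int m * k + real q * k - real q' * k"
      by (simp add: algebra_simps)
    then show ?thesis by (simp only: ee_diff ee_add complex_cnj_mult mult_ac)
  qed
  have "(LINT k|unit_measure c. ee (of_int m * k) * (\<Sum>q\<in>A. x q * ee (real q * k)) *
             cnj (\<Sum>q\<in>A. x q * ee (real q * k)))
     = (LINT k|unit_measure c. (\<Sum>q\<in>A. (\<Sum>q'\<in>A.
           x q * cnj (x q') * ee (of_int (m + int q - int q') * k))))"
  proof (intro Bochner_Integration.integral_cong refl)
    fix k
    have "ee (of_int m * k) * (\<Sum>q\<in>A. x q * ee (real q * k)) * cnj (\<Sum>q\<in>A. x q * ee (real q * k))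
      = (\<Sum>q\<in>A. ee (of_int m * k) * (x q * ee (real q * k))) * (\<Sum>q\<in>A. cnj (x q * ee (real q * k)))"
      by (simp only: sum_distrib_left cnj_sum)
    also have "\<dots> = (\<Sum>q\<in>A. (\<Sum>q'\<in>A. x q * cnj (x q') * ee (of_int (m + int q - int q') * k)))"
      by (simp only: sum_product summand)
    finally show "ee (of_int m * k) * (\<Sum>q\<in>A. x q * ee (real q * k)) * cnj (\<Sum>q\<in>A. x q * ee (real q * k))
      = (\<Sum>q\<in>A. (\<Sum>q'\<in>A. x q * cnj (x q') * ee (of_int (m + int q - int q') * k)))" .
  qed
  also have "\<dots> = (\<Sum>q\<in>A. LINT k|unit_measure c. (\<Sum>q'\<in>A.
           x q * cnj (x q') * ee (of_int (m + int q - int q') * k)))"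
    by (rule Bochner_Integration.integral_sum)
       (intro integrable_unit_measure_trig_poly trig_poly_sum trig_poly_scale trig_poly_ee)
  also have "\<dots> = (\<Sum>q\<in>A. \<Sum>q'\<in>A. LINT k|unit_measure c.
           x q * cnj (x q') * ee (of_int (m + int q - int q') * k))"
    by (intro sum.cong refl Bochner_Integration.integral_sum)
       (intro integrable_unit_measure_trig_poly trig_poly_sum trig_poly_scale trig_poly_ee)
  also have "\<dots> = (\<Sum>q\<in>A. \<Sum>q'\<in>A. if m + int q = int q' then x q * cnj (x q') else 0)"
    by (intro sum.cong refl) (simp only: integral_mult_right_zero integral_unit_measure_ee, auto)
  finally show ?thesis .
qed

lemma trig_poly_nat_sum: "trig_poly (\<lambda>k. \<Sum>q\<in>A. x q * ee (real q * k))"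
  by (intro trig_poly_sum trig_poly_scale trig_poly_ee_nat)

text \<open>
  The size of the polynomial with coefficients \<open>x\<close> after damping by a multiplier \<open>G\<close>; its square
  root is a seminorm in \<open>x\<close>.
\<close>

definition energy :: "(real \<Rightarrow> real) \<Rightarrow> (nat \<Rightarrow> complex) \<Rightarrow> nat set \<Rightarrow> real" where
  "energy G x A = (LINT k|unit_measure 0. G k * (cmod (\<Sum>q\<in>A. x q * ee (real q * k)))\<^sup>2)"

text \<open>
  Trigonometric polynomials suffice as multipliers, because the integral of one against a spectral or
  diffraction measure only involves correlations at integer distances.
\<close>

definition multiplier :: "(real \<Rightarrow> real) \<Rightarrow> bool" where
  "multiplier G \<longleftrightarrow> trig_poly (\<lambda>k. of_real (G k)) \<and> (\<forall>k. 0 \<le> G k \<and> G k \<le> 1)"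

lemma multiplierD:
  assumes "multiplier G"
  shows "trig_poly (\<lambda>k. of_real (G k))" "0 \<le> G k" "G k \<le> 1"
  using assms by (auto simp: multiplier_def)

lemma integrable_Re_trig_poly:
  assumes "trig_poly (\<lambda>k. complex_of_real (f k))"
  shows "integrable (unit_measure c) f"
  using integrable_Re[OF integrable_unit_measure_trig_poly[OF assms]] by simp

lemma integrable_multiplier:
  assumes "multiplier G" "trig_poly f"
  shows "integrable (unit_measure c) (\<lambda>k. G k * (cmod (f k))\<^sup>2)"
  by (rule integrable_Re_trig_poly)
     (use trig_poly_mult[OF multiplierD(1)[OF assms(1)] trig_poly_cmod_square[OF assms(2)]] in simp)

lemma energy_nonneg: "multiplier G \<Longrightarrow> 0 \<le> energy G x A"
  unfolding energy_def
  by (intro Bochner_Integration.integral_nonneg mult_nonneg_nonneg) (auto dest: multiplierD(2))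

lemma parseval:
  assumes "finite A"
  shows "(LINT k|unit_measure c. (cmod (\<Sum>q\<in>A. x q * ee (real q * k)))\<^sup>2) = (\<Sum>q\<in>A. (cmod (x q))\<^sup>2)"
proof -
  have "complex_of_real (LINT k|unit_measure c. (cmod (\<Sum>q\<in>A. x q * ee (real q * k)))\<^sup>2)
      = (LINT k|unit_measure c. ee (of_int 0 * k) * (\<Sum>q\<in>A. x q * ee (real q * k)) *
             cnj (\<Sum>q\<in>A. x q * ee (real q * k)))"
    unfolding integral_complex_of_real[symmetric] complex_norm_square by simp
  also have "\<dots> = (\<Sum>q\<in>A. \<Sum>q'\<in>A. if 0 + int q = int q' then x q * cnj (x q') else 0)"
    by (rule integral_ee_times_trig_sum[OF assms])
  also have "\<dots> = (\<Sum>q\<in>A. x q * cnj (x q))"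
    using assms by (simp add: sum.delta)
  also have "\<dots> = complex_of_real (\<Sum>q\<in>A. (cmod (x q))\<^sup>2)"
    by (simp only: of_real_sum complex_norm_square)
  finally show ?thesis by (simp only: of_real_eq_iff)
qed

lemma energy_le_sum_squares:
  assumes "multiplier G" "finite A"
  shows "energy G x A \<le> (\<Sum>q\<in>A. (cmod (x q))\<^sup>2)"
proof -
  have "energy G x A \<le> (LINT k|unit_measure 0. (cmod (\<Sum>q\<in>A. x q * ee (real q * k)))\<^sup>2)"
    unfolding energy_def
    using multiplierD(2,3)[OF assms(1)]
    by (intro integral_mono integrable_multiplier assms(1) trig_poly_nat_sum integrable_Re_trig_poly
          trig_poly_cmod_square) (auto intro: mult_left_le_one_le)
  then show ?thesis by (simp add: parseval[OF assms(2)])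
qed

lemma energy_le_card:
  assumes "multiplier G" "finite A" "\<And>q. q \<in> A \<Longrightarrow> cmod (x q) \<le> K"
  shows "energy G x A \<le> real (card A) * K\<^sup>2"
proof -
  have "energy G x A \<le> (\<Sum>q\<in>A. (cmod (x q))\<^sup>2)" by (rule energy_le_sum_squares[OF assms(1,2)])
  also have "\<dots> \<le> (\<Sum>q\<in>A. K\<^sup>2)" by (intro sum_mono power_mono assms) auto
  finally show ?thesis by simp
qed

lemma cmod_add_square_le: "(cmod (a + b))\<^sup>2 \<le> 2 * (cmod a)\<^sup>2 + 2 * (cmod b)\<^sup>2"
proof -
  have "(cmod (a + b))\<^sup>2 \<le> (cmod a + cmod b)\<^sup>2" by (intro power_mono norm_triangle_ineq) auto
  also have "\<dots> \<le> 2 * (cmod a)\<^sup>2 + 2 * (cmod b)\<^sup>2"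
    using sum_squares_bound[of "cmod a" "cmod b"] by (simp add: power2_sum)
  finally show ?thesis .
qed

lemma energy_add_le:
  assumes "multiplier G"
  shows "energy G (\<lambda>q. x q + y q) A \<le> 2 * energy G x A + 2 * energy G y A"
proof -
  have "energy G (\<lambda>q. x q + y q) A \<le>
     (LINT k|unit_measure 0. 2 * (G k * (cmod (\<Sum>q\<in>A. x q * ee (real q * k)))\<^sup>2) +
                             2 * (G k * (cmod (\<Sum>q\<in>A. y q * ee (real q * k)))\<^sup>2))"
    unfolding energy_def
  proof (intro integral_mono integrable_multiplier assms(1) trig_poly_nat_sum
      Bochner_Integration.integrable_add integrable_mult_right)
    fix k
    have "G k * (cmod ((\<Sum>q\<in>A. x q * ee (real q * k)) + (\<Sum>q\<in>A. y q * ee (real q * k))))\<^sup>2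
      \<le> G k * (2 * (cmod (\<Sum>q\<in>A. x q * ee (real q * k)))\<^sup>2 + 2 * (cmod (\<Sum>q\<in>A. y q * ee (real q * k)))\<^sup>2)"
      by (intro mult_left_mono cmod_add_square_le multiplierD(2)[OF assms(1)])
    then show "G k * (cmod (\<Sum>q\<in>A. (x q + y q) * ee (real q * k)))\<^sup>2
      \<le> 2 * (G k * (cmod (\<Sum>q\<in>A. x q * ee (real q * k)))\<^sup>2) + 2 * (G k * (cmod (\<Sum>q\<in>A. y q * ee (real q * k)))\<^sup>2)"
      by (simp add: distrib_left distrib_right sum.distrib mult_ac)
  qed
  also have "\<dots> = 2 * energy G x A + 2 * energy G y A"
    unfolding energy_def
    by (subst Bochner_Integration.integral_add)
       (auto intro!: integrable_mult_right integrable_multiplier assms trig_poly_nat_sum)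
  finally show ?thesis .
qed

lemma energy_linear_combination_le:
  assumes "multiplier G" "finite I"
  shows "energy G (\<lambda>q. \<Sum>i\<in>I. c i * x i q) A
       \<le> real (card I) * (\<Sum>i\<in>I. (cmod (c i))\<^sup>2 * energy G (x i) A)"
proof -
  let ?h = "\<lambda>i k. \<Sum>q\<in>A. x i q * ee (real q * k)"
  have "energy G (\<lambda>q. \<Sum>i\<in>I. c i * x i q) A \<le>
     (LINT k|unit_measure 0. real (card I) * (\<Sum>i\<in>I. (cmod (c i))\<^sup>2 * (G k * (cmod (?h i k))\<^sup>2)))"
    unfolding energy_def
  proof (intro integral_mono integrable_multiplier assms(1) trig_poly_nat_sum
      Bochner_Integration.integrable_sum integrable_mult_right)
    fix k
    have "(\<Sum>q\<in>A. (\<Sum>i\<in>I. c i * x i q) * ee (real q * k)) = (\<Sum>i\<in>I. c i * ?h i k)"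
      by (simp add: sum_distrib_left sum_distrib_right mult_ac sum.swap[of _ A I])
    then have "(cmod (\<Sum>q\<in>A. (\<Sum>i\<in>I. c i * x i q) * ee (real q * k)))\<^sup>2
        \<le> (\<Sum>i\<in>I. 1 * cmod (c i * ?h i k))\<^sup>2"
      by (auto intro!: power_mono norm_sum)
    also have "\<dots> \<le> (\<Sum>i\<in>I. 1\<^sup>2) * (\<Sum>i\<in>I. (cmod (c i * ?h i k))\<^sup>2)"
      by (rule Cauchy_Schwarz_ineq_sum)
    finally have "G k * (cmod (\<Sum>q\<in>A. (\<Sum>i\<in>I. c i * x i q) * ee (real q * k)))\<^sup>2
        \<le> G k * (real (card I) * (\<Sum>i\<in>I. (cmod (c i))\<^sup>2 * (cmod (?h i k))\<^sup>2))"
      by (intro mult_left_mono multiplierD(2)[OF assms(1)]) (simp add: norm_mult power_mult_distrib)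
    then show "G k * (cmod (\<Sum>q\<in>A. (\<Sum>i\<in>I. c i * x i q) * ee (real q * k)))\<^sup>2
        \<le> real (card I) * (\<Sum>i\<in>I. (cmod (c i))\<^sup>2 * (G k * (cmod (?h i k))\<^sup>2))"
      by (simp add: sum_distrib_left mult_ac)
  qed
  also have "\<dots> = real (card I) * (\<Sum>i\<in>I. (cmod (c i))\<^sup>2 * energy G (x i) A)"
    unfolding energy_def
    by (simp add: Bochner_Integration.integral_sum integrable_multiplier assms trig_poly_nat_sum)
  finally show ?thesis .
qed

text \<open>
  A translation of the coefficients changes the polynomial by a factor of modulus one.
\<close>

lemma energy_shift:
  "energy G (\<lambda>q. x (q + s)) {..<R} = energy G x {s..<s + R}"
proof -
  have "(\<Sum>q\<in>{s..<s+R}. x q * ee (real q * k)) = ee (real s * k) * (\<Sum>q<R. x (q + s) * ee (real q * k))" for k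
    using sum.shift_bounds_nat_ivl[of "\<lambda>q. x q * ee (real q * k)" 0 s R]
    by (simp add: sum_distrib_left ee_add ring_distribs mult_ac add_ac atLeast0LessThan)
  then show ?thesis unfolding energy_def by (simp add: norm_mult)
qed

section \<open>Averages along a lacunary orbit\<close>

lemma square_cesaro_ee_tendsto_zero:
  assumes "L \<ge> 2" "m \<noteq> 0"
  shows "AE k in unit_measure c. (\<lambda>N. (\<Sum>j<N\<^sup>2. ee (of_int m * (real L ^ j * k))) / of_nat (N\<^sup>2)) \<longlonglongrightarrow> 0"
proof -
  define A where "A n k = (\<Sum>j<n. ee (of_int m * (real L ^ j * k)))" for n k
  have tp: "trig_poly (A n)" for n
    unfolding A_def
  proof (intro trig_poly_sum)
    fix j
    show "trig_poly (\<lambda>k. ee (of_int m * (real L ^ j * k)))"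
      using trig_poly_ee[of "m * int L ^ j"] by (simp add: mult_ac)
  qed
  have [measurable]: "A n \<in> borel_measurable borel" for n
    by (rule measurable_trig_poly[OF tp])
  have L2: "(LINT k|unit_measure c. (cmod (A n k))\<^sup>2) = real n" for n
  proof -
    have summand: "ee (of_int m * (real L ^ i * k)) * cnj (ee (of_int m * (real L ^ j * k)))
        = ee (of_int (m * (int L ^ i - int L ^ j)) * k)" for i j k
      unfolding ee_diff[symmetric] by (simp add: algebra_simps)
    have "complex_of_real (LINT k|unit_measure c. (cmod (A n k))\<^sup>2)
        = (LINT k|unit_measure c. (\<Sum>i<n. \<Sum>j<n. ee (of_int (m * (int L ^ i - int L ^ j)) * k)))"
      unfolding integral_complex_of_real[symmetric] complex_norm_square A_def
      by (simp only: cnj_sum sum_product summand)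
    also have "\<dots> = (\<Sum>i<n. \<Sum>j<n. (LINT k|unit_measure c. ee (of_int (m * (int L ^ i - int L ^ j)) * k)))"
      by (subst Bochner_Integration.integral_sum,
          (intro integrable_unit_measure_trig_poly trig_poly_sum trig_poly_ee)?)+ simp
    also have "\<dots> = (\<Sum>i<n. \<Sum>j<n. if i = j then 1 else 0)"
      unfolding integral_unit_measure_ee using assms
      by (intro sum.cong refl) (simp add: power_inject_exp' flip: of_nat_power)
    also have "\<dots> = of_nat n" by simp
    finally show ?thesis by (metis of_real_eq_iff of_real_of_nat_eq)
  qed
  have "AE k in unit_measure c. summable (\<lambda>N. (cmod (A (N\<^sup>2) k / of_nat (N\<^sup>2)))\<^sup>2)"
  proof -
    have int: "integrable (unit_measure c) (\<lambda>k. (cmod (A (N\<^sup>2) k / of_nat (N\<^sup>2)))\<^sup>2)" for N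
      using integrable_Re_trig_poly[OF trig_poly_cmod_square[OF tp[of "N\<^sup>2"]], of c]
      by (simp add: norm_divide power_divide)
    have "(\<integral>\<^sup>+k. ennreal ((cmod (A (N\<^sup>2) k / of_nat (N\<^sup>2)))\<^sup>2) \<partial>unit_measure c) = ennreal (1 / (real N)\<^sup>2)" for N
    proof -
      have "(LINT k|unit_measure c. (cmod (A (N\<^sup>2) k / of_nat (N\<^sup>2)))\<^sup>2) = real (N\<^sup>2) / (real (N\<^sup>2))\<^sup>2"
        by (simp only: norm_divide power_divide norm_of_nat integral_divide_zero L2)
      also have "\<dots> = 1 / (real N)\<^sup>2"
        by (simp add: power2_eq_square)
      finally show ?thesis
        by (subst nn_integral_eq_integral[OF int]) auto
    qed
    then have "(\<integral>\<^sup>+k. (\<Sum>N. ennreal ((cmod (A (N\<^sup>2) k / of_nat (N\<^sup>2)))\<^sup>2)) \<partial>unit_measure c)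
        = (\<Sum>N. ennreal (1 / (real N)\<^sup>2))"
      by (subst nn_integral_suminf) (use tp in measurable)
    also have "\<dots> < \<infinity>"
      using inverse_power_summable[of 2, where 'a = real]
      by (subst suminf_ennreal2) (auto simp: inverse_eq_divide)
    finally have "AE k in unit_measure c. (\<Sum>N. ennreal ((cmod (A (N\<^sup>2) k / of_nat (N\<^sup>2)))\<^sup>2)) \<noteq> \<infinity>"
      by (intro nn_integral_noteq_infinite) auto
    then show ?thesis
      by eventually_elim (auto intro: summable_suminf_not_top)
  qed
  then show ?thesis
  proof eventually_elim
    case (elim k)
    from summable_LIMSEQ_zero[OF elim]
    have "(\<lambda>N. A (N\<^sup>2) k / of_nat (N\<^sup>2)) \<longlonglongrightarrow> 0"
      by (simp add: tendsto_norm_zero_iff)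
    then show ?case by (simp add: A_def)
  qed
qed

text \<open>
  By linearity only a character \<open>e(m k)\<close> with \<open>m \<noteq> 0\<close> is of interest.  Its values along the
  orbit are orthonormal, so the average over \<open>n\<close> points has square mean \<open>1 / n\<close>, and this is summable
  along the squares.
\<close>

theorem AE_square_cesaro_trig_poly:
  assumes "L \<ge> 2" "trig_poly h"
  shows "AE k in unit_measure c.
    (\<lambda>N. (\<Sum>j<N\<^sup>2. h (real L ^ j * k)) / of_nat (N\<^sup>2)) \<longlonglongrightarrow> (LINT k|unit_measure 0. h k)"
  using assms(2)
proof induction
  case (trig_poly_ee m)
  show ?case
  proof (cases "m = 0")
    case True
    have "\<forall>\<^sub>F N in sequentially. (1::complex) = (\<Sum>j<N\<^sup>2. 1) / of_nat (N\<^sup>2)"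
      using eventually_gt_at_top[of "0::nat"] by eventually_elim simp
    then have "(\<lambda>N. (\<Sum>j<N\<^sup>2. 1) / of_nat (N\<^sup>2)) \<longlonglongrightarrow> (1::complex)"
      by (rule Lim_transform_eventually[OF tendsto_const])
    then show ?thesis using True integral_unit_measure_ee[of 0 0] by simp
  next
    case False
    then show ?thesis
      using square_cesaro_ee_tendsto_zero[OF assms(1) False, of c] integral_unit_measure_ee[of 0 m]
      by simp
  qed
next
  case (trig_poly_add f g)
  from trig_poly_add.IH show ?case
  proof eventually_elim
    case (elim k)
    from tendsto_add[OF elim] show ?case
      using trig_poly_add.hyps
      by (simp add: sum.distrib add_divide_distrib integrable_unit_measure_trig_poly)
  qed
next
  case (trig_poly_scale f a)
  from trig_poly_scale.IH show ?case
  proof eventually_elim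
    case (elim k)
    from tendsto_mult_left[OF elim, of a] show ?case
      by (simp add: sum_distrib_left[symmetric])
  qed
qed

section \<open>A criterion for singularity\<close>

text \<open>
  Let \<open>A\<close> be the set where all the chosen sequences tend to one.  Its complement is a Lebesgue null set,
  whereas Fatou's lemma bounds \<open>\<integral>\<^sub>A \<psi> d\<sigma>\<close> by every \<open>\<delta>\<close>, so that \<open>\<sigma>\<close> lives on the complement.  The weight \<open>\<psi>\<close>
  admits infinite measures.
\<close>

theorem singular_measure_criterion:
  fixes \<psi> :: "real \<Rightarrow> real"
  assumes sets [measurable_cong]: "sets \<sigma> = sets borel"
    and \<psi> [measurable]: "\<psi> \<in> borel_measurable borel" and \<psi>_pos: "\<And>k. 0 < \<psi> k"
    and damping: "\<And>\<delta>. \<delta> > 0 \<Longrightarrow> \<exists>g :: nat \<Rightarrow> real \<Rightarrow> real. (\<forall>i. g i \<in> borel_measurable borel) \<and> (\<forall>i k. 0 \<le> g i k)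
       \<and> (AE k in lborel. (\<lambda>i. g i k) \<longlonglongrightarrow> 1)
       \<and> (\<forall>i. (\<integral>\<^sup>+k. ennreal (g i k * \<psi> k) \<partial>\<sigma>) \<le> ennreal \<delta>)"
  shows "singular_measure \<sigma>"
proof -
  have "\<exists>g :: nat \<Rightarrow> nat \<Rightarrow> real \<Rightarrow> real. \<forall>n. (\<forall>i. g n i \<in> borel_measurable borel) \<and> (\<forall>i k. 0 \<le> g n i k)
       \<and> (AE k in lborel. (\<lambda>i. g n i k) \<longlonglongrightarrow> 1)
       \<and> (\<forall>i. (\<integral>\<^sup>+k. ennreal (g n i k * \<psi> k) \<partial>\<sigma>) \<le> ennreal (1 / real (Suc n)))"
    by (intro choice allI damping) simp
  then obtain g :: "nat \<Rightarrow> nat \<Rightarrow> real \<Rightarrow> real"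
    where [measurable]: "\<And>n i. g n i \<in> borel_measurable borel" and g0: "\<And>n i k. 0 \<le> g n i k"
      and g1: "\<And>n. AE k in lborel. (\<lambda>i. g n i k) \<longlonglongrightarrow> 1"
      and gint: "\<And>n i. (\<integral>\<^sup>+k. ennreal (g n i k * \<psi> k) \<partial>\<sigma>) \<le> ennreal (1 / real (Suc n))"
    by blast
  define A where "A = {k. \<forall>n. (\<lambda>i. g n i k) \<longlonglongrightarrow> 1}"
  have A [measurable]: "A \<in> sets borel" unfolding A_def by measurable
  have "AE k in lborel. k \<in> A"
    using g1 by (simp add: A_def AE_all_countable)
  then have null: "- A \<in> null_sets lborel"
    using A by (subst AE_iff_null_sets) auto
  have bound: "(\<integral>\<^sup>+k. indicator A k * ennreal (\<psi> k) \<partial>\<sigma>) \<le> ennreal (1 / real (Suc n))" for n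
  proof -
    have "indicator A k * ennreal (\<psi> k) \<le> liminf (\<lambda>i. ennreal (g n i k * \<psi> k))" for k
    proof (cases "k \<in> A")
      case True
      then have "(\<lambda>i. g n i k * \<psi> k) \<longlonglongrightarrow> 1 * \<psi> k"
        unfolding A_def by (intro tendsto_intros) auto
      then have "(\<lambda>i. ennreal (g n i k * \<psi> k)) \<longlonglongrightarrow> ennreal (\<psi> k)" by (simp add: tendsto_ennrealI)
      then have "liminf (\<lambda>i. ennreal (g n i k * \<psi> k)) = ennreal (\<psi> k)"
        by (intro lim_imp_Liminf) auto
      then show ?thesis using True by simp
    qed simp
    then have "(\<integral>\<^sup>+k. indicator A k * ennreal (\<psi> k) \<partial>\<sigma>)
        \<le> (\<integral>\<^sup>+k. liminf (\<lambda>i. ennreal (g n i k * \<psi> k)) \<partial>\<sigma>)" by (intro nn_integral_mono)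
    also have "\<dots> \<le> liminf (\<lambda>i. \<integral>\<^sup>+k. ennreal (g n i k * \<psi> k) \<partial>\<sigma>)"
      by (intro nn_integral_liminf) measurable
    also have "\<dots> \<le> ennreal (1 / real (Suc n))"
      by (intro Liminf_le always_eventually allI gint) simp
    finally show ?thesis .
  qed
  have "(\<lambda>n. ennreal (1 / real (Suc n))) \<longlonglongrightarrow> ennreal 0"
    by (intro tendsto_ennrealI) (use LIMSEQ_inverse_real_of_nat in \<open>simp add: inverse_eq_divide\<close>)
  then have "(\<integral>\<^sup>+k. indicator A k * ennreal (\<psi> k) \<partial>\<sigma>) \<le> ennreal 0"
    by (rule Lim_bounded2) (use bound in auto)
  then have "AE k in \<sigma>. indicator A k * ennreal (\<psi> k) = 0"
    by (subst (asm) ennreal_0, subst nn_integral_0_iff_AE[symmetric]) auto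
  then have "AE k in \<sigma>. k \<notin> A"
    by eventually_elim
       (use \<psi>_pos in \<open>auto simp: indicator_def ennreal_eq_0_iff not_le[symmetric] split: if_splits\<close>)
  then have "emeasure \<sigma> A = 0"
    using A sets_eq_imp_space_eq[OF sets] by (subst (asm) AE_iff_null_sets[of A \<sigma>, symmetric]) (auto simp: sets)
  with null show ?thesis
    unfolding singular_measure_iff using sets by (intro conjI bexI[of _ "- A"]) auto
qed

section \<open>Iterated substitutions and joint eigenfunctions of the columns\<close>

lemma substitute_word_iterate_conv_letters:
  "(substitute_word \<rho> ^^ n) w = concat (map (\<lambda>a. (substitute_word \<rho> ^^ n) [a]) w)"
proof (induction n arbitrary: w)
  case (Suc n)
  have "(substitute_word \<rho> ^^ Suc n) w = concat (map (\<lambda>a. (substitute_word \<rho> ^^ n) [a]) (substitute_word \<rho> w))"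
    unfolding funpow_Suc_right o_apply by (rule Suc.IH)
  also have "\<dots> = concat (map (\<lambda>a. concat (map (\<lambda>a. (substitute_word \<rho> ^^ n) [a]) (\<rho> a))) w)"
    by (induction w) (auto simp: substitute_word_def)
  also have "\<dots> = concat (map (\<lambda>a. (substitute_word \<rho> ^^ Suc n) [a]) w)"
  proof -
    have "concat (map (\<lambda>a. (substitute_word \<rho> ^^ n) [a]) (\<rho> a)) = (substitute_word \<rho> ^^ Suc n) [a]" for a
    proof -
      have "(substitute_word \<rho> ^^ Suc n) [a] = (substitute_word \<rho> ^^ n) (\<rho> a)"
        unfolding funpow_Suc_right by (simp add: substitute_word_def)
      then show ?thesis using Suc.IH[of "\<rho> a"] by simp
    qed
    then show ?thesis by simp
  qed
  finally show ?case .
qed (induction w, auto)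

lemma nth_concat_equal_lengths:
  assumes "\<And>u. u \<in> set us \<Longrightarrow> length u = M" "i < M * length us"
  shows "concat us ! i = us ! (i div M) ! (i mod M)"
  using assms
proof (induction us arbitrary: i)
  case (Cons u us)
  then have M: "M > 0" and [simp]: "length u = M" by (auto intro: Nat.gr0I)
  show ?case
  proof (cases "i < M")
    case False
    then have "i div M = Suc ((i - M) div M)" "i mod M = (i - M) mod M"
      using M by (auto simp: le_div_geq le_mod_geq)
    then show ?thesis using False Cons.IH[of "i - M"] Cons.prems by (auto simp: nth_append)
  qed (simp add: nth_append)
qed simp

lemma length_substitute_word_iterate:
  assumes "\<And>a. length (\<rho> a) = L"
  shows "length ((substitute_word \<rho> ^^ n) w) = L ^ n * length w"
proof (induction n)
  case (Suc n)
  have "length (substitute_word \<rho> u) = L * length u" for u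
    by (induction u) (auto simp: substitute_word_def assms)
  then show ?case using Suc by simp
qed simp

lemma nth_substitute_word_iterate:
  assumes "\<And>a. length (\<rho> a) = L" "i < L ^ n * length w"
  shows "(substitute_word \<rho> ^^ n) w ! i = (substitute_word \<rho> ^^ n) [w ! (i div L ^ n)] ! (i mod L ^ n)"
proof -
  have "i div L ^ n < length w"
    using assms(2) by (simp add: less_mult_imp_div_less mult.commute)
  then show ?thesis
    using assms
    by (subst substitute_word_iterate_conv_letters, subst nth_concat_equal_lengths[where M = "L ^ n"])
       (auto simp: length_substitute_word_iterate)
qed

lemma bij_finite_order:
  fixes c :: "'a::finite \<Rightarrow> 'a"
  assumes "bij c"
  obtains N where "N > 0" "c ^^ N = id"
proof -
  have "\<not> inj (\<lambda>n. c ^^ n)"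
    using finite_imageD[of "\<lambda>n. c ^^ n" "UNIV :: nat set"] by (meson finite infinite_UNIV_nat)
  then obtain a b where "c ^^ a = c ^^ b" "a < b"
    unfolding inj_def by (metis linorder_neqE_nat)
  then have "c ^^ a \<circ> c ^^ (b - a) = c ^^ a"
    by (metis funpow_add le_add_diff_inverse less_imp_le)
  moreover have "inj (c ^^ a)"
    using assms by (simp add: bij_is_inj inj_fn)
  ultimately have "c ^^ (b - a) = id"
    by (metis comp_id fun.inj_map_strong inj_def fun_eq_iff comp_apply id_apply)
  with \<open>a < b\<close> that[of "b - a"] show thesis by simp
qed

definition joint_eigenfunction :: "(nat \<Rightarrow> 'a \<Rightarrow> 'a) \<Rightarrow> nat \<Rightarrow> ('a \<Rightarrow> complex) \<Rightarrow> bool" where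
  "joint_eigenfunction c m v \<longleftrightarrow> (\<forall>r<m. \<exists>z. cmod z = 1 \<and> (\<forall>a. v (c r a) = z * v a))"

text \<open>
  If \<open>c\<^sup>N = id\<close>, then \<open>v\<close> is the sum over the \<open>N\<close>-th roots of unity \<open>\<zeta>\<close> of the averages of
  \<open>\<zeta>\<^sup>-\<^sup>j v \<circ> c\<^sup>j\<close>, each an eigenfunction of \<open>c\<close> with eigenvalue \<open>\<zeta>\<close>.  Because the permutations commute, these averages
  remain eigenfunctions of the permutations treated before.
\<close>

lemma joint_eigenfunction_decomposition:
  fixes c :: "nat \<Rightarrow> 'a::finite \<Rightarrow> 'a"
  assumes "\<And>r. r < m \<Longrightarrow> bij (c r)"
    and "\<And>r s a. r < m \<Longrightarrow> s < m \<Longrightarrow> c r (c s a) = c s (c r a)"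
  shows "\<exists>vs. (\<forall>v\<in>set vs. joint_eigenfunction c m v) \<and> (\<forall>a. u a = (\<Sum>v\<leftarrow>vs. v a))"
  using assms
proof (induction m)
  case 0
  then show ?case by (intro exI[of _ "[u]"]) (auto simp: joint_eigenfunction_def)
next
  case (Suc m)
  then obtain vs where vs: "\<And>v. v \<in> set vs \<Longrightarrow> joint_eigenfunction c m v" "\<And>a. u a = (\<Sum>v\<leftarrow>vs. v a)"
    by fastforce
  obtain N where N: "N > 0" "c m ^^ N = id"
    using bij_finite_order Suc.prems(1)[of m] by blast
  define proj where "proj l v a = (\<Sum>j<N. ee (- (real l * real j / real N)) * v ((c m ^^ j) a)) / of_nat N"
    for l and v :: "'a \<Rightarrow> complex" and a
  have comm: "(c m ^^ j) (c r a) = c r ((c m ^^ j) a)" if "r < m" for r j a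
    using Suc.prems(2)[of m r] that by (induction j) auto
  have sum_proj: "(\<Sum>l<N. proj l v a) = v a" for v a
  proof -
    have orth: "(\<Sum>l<N. ee (- (real l * real j / real N))) = (if j = 0 then of_nat N else 0)" if "j < N" for j
    proof (cases "j = 0")
      case False
      let ?z = "ee (- (real j / real N))"
      have "?z \<noteq> 1"
      proof
        assume "?z = 1"
        then have "cos (2 * pi * (- (real j / real N))) = 1"
          by (metis ee_def cis.sel(1) one_complex.sel(1))
        then obtain x :: int where "2 * pi * (- (real j / real N)) = of_int x * 2 * pi"
          using cos_one_2pi_int by blast
        then have "pi * (- real j) = pi * (of_int x * real N)" using N by (simp add: field_simps)
        then have "- real j = of_int x * real N" by (metis mult_cancel_left pi_neq_zero)
        then have "- int j = x * int N"
          by (metis of_int_eq_iff of_int_minus of_int_mult of_int_of_nat_eq)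
        then have "int N dvd int j" by (metis dvd_minus_iff dvd_triv_right)
        then show False using that False by (auto dest: dvd_imp_le)
      qed
      have "(\<Sum>l<N. ee (- (real l * real j / real N))) = (\<Sum>l<N. ?z ^ l)"
        by (simp flip: ee_of_nat_mult)
      also have "\<dots> = (1 - ?z ^ N) / (1 - ?z)"
        using \<open>?z \<noteq> 1\<close> by (simp add: sum_gp_strict)
      also have "?z ^ N = ee (of_int (- int j))"
        unfolding ee_of_nat_mult[symmetric] using N by simp
      finally show ?thesis using False by (simp only: ee_of_int) simp
    qed simp
    have "(\<Sum>l<N. proj l v a) = (\<Sum>j<N. (\<Sum>l<N. ee (- (real l * real j / real N))) * v ((c m ^^ j) a)) / of_nat N"
      unfolding proj_def sum_divide_distrib[symmetric]
      by (subst sum.swap) (simp add: sum_distrib_right)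
    also have "\<dots> = (\<Sum>j<N. (if j = 0 then of_nat N else 0) * v ((c m ^^ j) a)) / of_nat N"
      by (simp add: orth)
    also have "\<dots> = v a"
      using N by (simp add: if_distrib[of "\<lambda>x. x * _"] cong: if_cong)
    finally show ?thesis .
  qed
  have eig: "joint_eigenfunction c (Suc m) (proj l v)" if v: "joint_eigenfunction c m v" for l v
    unfolding joint_eigenfunction_def
  proof (intro allI impI)
    fix r assume "r < Suc m"
    show "\<exists>z. cmod z = 1 \<and> (\<forall>a. proj l v (c r a) = z * proj l v a)"
    proof (cases "r < m")
      case True
      then obtain z where z: "cmod z = 1" "\<And>a. v (c r a) = z * v a"
        using v by (auto simp: joint_eigenfunction_def)
      then have "proj l v (c r a) = z * proj l v a" for a
        by (simp add: proj_def comm[OF True] sum_distrib_left mult_ac)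
      with z(1) show ?thesis by blast
    next
      case False
      with \<open>r < Suc m\<close> have [simp]: "r = m" by simp
      define t where "t j a = ee (- (real l * real j / real N)) * v ((c m ^^ j) a)" for j a
      have t: "t j (c m a) = ee (real l / real N) * t (Suc j) a" for j a
      proof -
        have "ee (real l / real N) * ee (- (real l * real (Suc j) / real N)) = ee (- (real l * real j / real N))"
          unfolding ee_add[symmetric] by (simp add: field_simps add_divide_distrib)
        then show ?thesis by (simp add: t_def funpow_swap1 flip: mult.assoc)
      qed
      have "t N a = t 0 a" for a
      proof -
        have "- (real l * real N / real N) = of_int (- int l)" using N by simp
        then have "ee (- (real l * real N / real N)) = 1" by (simp only: ee_of_int)
        then show ?thesis by (simp add: t_def N)
      qed
      then have "(\<Sum>j<N. t (Suc j) a) = (\<Sum>j<N. t j a)" for a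
        using sum.lessThan_Suc_shift[of "\<lambda>j. t j a" N] by simp
      then have "proj l v (c r a) = ee (real l / real N) * proj l v a" for a
        unfolding proj_def t_def[symmetric] by (simp add: t sum_distrib_left[symmetric])
      then show ?thesis by (intro exI[of _ "ee (real l / real N)"]) simp
    qed
  qed
  define ws where "ws = concat (map (\<lambda>v. map (\<lambda>l. proj l v) [0..<N]) vs)"
  have "(\<Sum>v\<leftarrow>ws. v a) = (\<Sum>v\<leftarrow>vs. v a)" for a
    unfolding ws_def
  proof (induction vs)
    case (Cons v vs)
    have "(\<Sum>l\<leftarrow>[0..<N]. proj l v a) = v a"
      using sum_proj[of v a] by (simp add: sum_list_distinct_conv_sum_set atLeast0LessThan)
    then show ?case using Cons by (simp add: comp_def)
  qed simp
  moreover have "\<forall>v\<in>set ws. joint_eigenfunction c (Suc m) v"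
    using vs(1) eig by (auto simp: ws_def)
  ultimately show ?case using vs(2) by (intro exI[of _ ws]) simp
qed

text \<open>
  Decomposing the indicator functions of the letters makes the coefficients of \<open>u\<close> values of \<open>u\<close>, which are
  bounded by any bound of \<open>u\<close>.
\<close>

lemma joint_eigenbasis:
  fixes c :: "nat \<Rightarrow> 'a::finite \<Rightarrow> 'a"
  assumes "\<And>r. r < m \<Longrightarrow> bij (c r)"
    and "\<And>r s a. r < m \<Longrightarrow> s < m \<Longrightarrow> c r (c s a) = c s (c r a)"
  obtains d :: nat and \<phi> :: "nat \<Rightarrow> 'a \<Rightarrow> complex" and \<kappa> :: "nat \<Rightarrow> 'a"
  where "\<And>i. i < d \<Longrightarrow> joint_eigenfunction c m (\<phi> i)" "\<And>u b. u b = (\<Sum>i<d. u (\<kappa> i) * \<phi> i b)"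
proof -
  have "\<exists>vs. \<forall>a. (\<forall>v\<in>set (vs a). joint_eigenfunction c m v) \<and>
      (\<forall>b. (if b = a then 1 else 0) = (\<Sum>v\<leftarrow>vs a. v b))"
    by (intro choice allI joint_eigenfunction_decomposition assms)
  then obtain vs where vs: "\<And>a v. v \<in> set (vs a) \<Longrightarrow> joint_eigenfunction c m v"
      "\<And>a b. (\<Sum>v\<leftarrow>vs a. v b) = (if b = a then 1 else (0::complex))"
    by fastforce
  obtain as :: "'a list" where as: "set as = UNIV" "distinct as"
    using finite_distinct_list[OF finite] by blast
  define ps where "ps = concat (map (\<lambda>a. map (Pair a) (vs a)) as)"
  have "(\<Sum>i<length ps. u (fst (ps ! i)) * snd (ps ! i) b) = u b" for u b
  proof -
    have "(\<Sum>i<length ps. u (fst (ps ! i)) * snd (ps ! i) b) = (\<Sum>p\<leftarrow>ps. u (fst p) * snd p b)"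
      by (simp add: sum_list_sum_nth atLeast0LessThan)
    also have "\<dots> = (\<Sum>a\<leftarrow>as. u a * (\<Sum>v\<leftarrow>vs a. v b))"
      unfolding ps_def
    proof (induction as)
      case (Cons a as)
      have "(\<Sum>v\<leftarrow>vs a. u a * v b) = u a * (\<Sum>v\<leftarrow>vs a. v b)"
        by (simp add: sum_list_const_mult)
      then show ?case using Cons by (simp add: comp_def)
    qed simp
    also have "\<dots> = (\<Sum>a\<in>UNIV. u a * (if b = a then 1 else 0))"
      using as by (simp add: vs(2) sum_list_distinct_conv_sum_set)
    also have "\<dots> = u b" by (simp add: if_distrib[of "\<lambda>x. _ * x"] cong: if_cong)
    finally show ?thesis .
  qed
  moreover have "joint_eigenfunction c m (snd (ps ! i))" if "i < length ps" for i
    using nth_mem[OF that] vs(1) by (auto simp: ps_def)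
  ultimately show thesis
    using that[of "length ps" "\<lambda>i. snd (ps ! i)" "\<lambda>i. fst (ps ! i)"] by metis
qed

section \<open>Decay of the Riesz products\<close>

lemma sum_lessThan_mult_div_mod:
  fixes f :: "nat \<Rightarrow> nat \<Rightarrow> 'b::comm_monoid_add"
  assumes "M > 0"
  shows "(\<Sum>p<M * R. f (p mod M) (p div M)) = (\<Sum>r<R. \<Sum>q<M. f q r)"
proof -
  have "(\<Sum>p<R * M. f (p mod M) (p div M)) = (\<Sum>r<R. \<Sum>p=r * M..<r * M + M. f (p mod M) (p div M))"
    by (rule sum.nat_group[symmetric])
  also have "\<dots> = (\<Sum>r<R. \<Sum>q<M. f q r)"
  proof (rule sum.cong[OF refl])
    fix r
    have "(\<Sum>p=r * M..<r * M + M. f (p mod M) (p div M)) = (\<Sum>q=0..<M. f ((q + r * M) mod M) ((q + r * M) div M))"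
      using sum.shift_bounds_nat_ivl[of "\<lambda>p. f (p mod M) (p div M)" 0 "r * M" M] by (simp add: add.commute)
    then show "(\<Sum>p=r * M..<r * M + M. f (p mod M) (p div M)) = (\<Sum>q<M. f q r)"
      using assms by (simp add: atLeast0LessThan)
  qed
  finally show ?thesis by (simp add: mult.commute)
qed

text \<open>
  The difference of the exponent and \<open>ln y\<close> vanishes at \<open>y = 1\<close> and has derivative
  \<open>(y - 1) (1 / y - 1 / C)\<close>, which has the sign of \<open>y - 1\<close> up to \<open>y = C\<close>.  The exponential form covers \<open>y = 0\<close>.
\<close>

lemma le_exp_quadratic:
  fixes y :: real
  assumes "0 \<le> y" "y \<le> C" "1 \<le> C"
  shows "y \<le> exp ((y - 1) - (y - 1)\<^sup>2 / (2 * C))"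
proof (cases "y = 0")
  case False
  define f where "f x = (x - 1) - (x - 1)\<^sup>2 / (2 * C) - ln x" for x :: real
  have deriv: "(f has_real_derivative (x - 1) * (1 / x - 1 / C)) (at x)" if "x > 0" for x
    unfolding f_def using that assms
    by (auto intro!: derivative_eq_intros simp: field_simps)
  have "f y \<ge> f 1"
  proof (cases "y \<ge> 1")
    case True
    have "\<exists>z. (f has_real_derivative z) (at x) \<and> z \<ge> 0" if "1 \<le> x" "x \<le> y" for x
      using deriv[of x] that assms
      by (intro exI[of _ "(x - 1) * (1 / x - 1 / C)"] conjI mult_nonneg_nonneg) (auto intro: frac_le)
    then show ?thesis using DERIV_nonneg_imp_nondecreasing[of 1 y f] True by blast
  next
    case y: False
    have "\<exists>z. (f has_real_derivative z) (at x) \<and> z \<le> 0" if "y \<le> x" "x \<le> 1" for x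
      using deriv[of x] that assms False
      by (intro exI[of _ "(x - 1) * (1 / x - 1 / C)"] conjI mult_nonpos_nonneg) (auto intro: frac_le)
    then show ?thesis using DERIV_nonpos_imp_nonincreasing[of y 1 f] y by (metis linear)
  qed
  then have "ln y \<le> (y - 1) - (y - 1)\<^sup>2 / (2 * C)" by (simp add: f_def)
  then have "exp (ln y) \<le> exp ((y - 1) - (y - 1)\<^sup>2 / (2 * C))" by simp
  then show ?thesis using False assms(1) by simp
qed simp

text \<open>
  The consequence of commuting columns on which all estimates rest: a spanning family of joint
  eigenfunctions \<open>\<phi>\<close> of the columns with unimodular eigenvalues \<open>ev\<close>.
\<close>

locale abelian_columns =
  fixes \<rho> :: "'a::finite substitution" and L d :: nat
    and \<phi> :: "nat \<Rightarrow> 'a \<Rightarrow> complex" and \<kappa> :: "nat \<Rightarrow> 'a" and ev :: "nat \<Rightarrow> nat \<Rightarrow> complex"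
  assumes L_ge_2: "L \<ge> 2"
    and length_rho: "\<And>a. length (\<rho> a) = L"
    and eigenfunction: "\<And>i r a. i < d \<Longrightarrow> r < L \<Longrightarrow> \<phi> i (\<rho> a ! r) = ev i r * \<phi> i a"
    and cmod_ev: "\<And>i r. i < d \<Longrightarrow> r < L \<Longrightarrow> cmod (ev i r) = 1"
    and expansion: "\<And>u b. u b = (\<Sum>i<d. u (\<kappa> i) * \<phi> i b)"
begin

lemma L_pos [simp]: "L > 0"
  using L_ge_2 by simp

lemma L_power_pos [simp]: "0 < L ^ n"
  using L_pos by simp

lemma d_pos: "d > 0"
proof (rule Nat.gr0I)
  assume "d = 0"
  with expansion[of "\<lambda>_. 1" undefined] show False by simp
qed

definition P :: "nat \<Rightarrow> real \<Rightarrow> complex" where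
  "P i k = (\<Sum>r<L. ev i r * ee (real r * k))"

definition Q :: "nat \<Rightarrow> nat \<Rightarrow> real \<Rightarrow> complex" where
  "Q n i k = (\<Prod>j<n. P i (real L ^ j * k))"

primrec ev_iterate :: "nat \<Rightarrow> nat \<Rightarrow> nat \<Rightarrow> complex" where
  "ev_iterate 0 i q = 1"
| "ev_iterate (Suc n) i q = ev_iterate n i (q mod L ^ n) * ev i (q div L ^ n)"

text \<open>
  Position \<open>q\<close> in a supertile of level \<open>n + 1\<close> is position \<open>q mod L\<^sup>n\<close> in its
  \<open>(q div L\<^sup>n)\<close>-th supertile of level \<open>n\<close>, and the eigenvalues multiply accordingly.
\<close>

lemma Q_eq_sum: "Q n i k = (\<Sum>q<L ^ n. ev_iterate n i q * ee (real q * k))"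
proof (induction n)
  case (Suc n)
  have "Q (Suc n) i k = (\<Sum>q<L ^ n. ev_iterate n i q * ee (real q * k)) * (\<Sum>r<L. ev i r * ee (real r * (real L ^ n * k)))"
    using Suc by (simp add: Q_def P_def)
  also have "\<dots> = (\<Sum>r<L. \<Sum>q<L ^ n. ev_iterate n i q * ev i r * ee (real (q + r * L ^ n) * k))"
    unfolding sum_product by (subst sum.swap) (simp add: ring_distribs ee_add mult_ac)
  also have "\<dots> = (\<Sum>p<L ^ n * L. ev_iterate n i (p mod L ^ n) * ev i (p div L ^ n) * ee (real (p mod L ^ n + p div L ^ n * L ^ n) * k))"
    by (rule sum_lessThan_mult_div_mod[symmetric, OF L_power_pos])
  also have "\<dots> = (\<Sum>q<L ^ Suc n. ev_iterate (Suc n) i q * ee (real q * k))"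
    by (simp only: mod_div_mult_eq ev_iterate.simps power_Suc2)
  finally show ?case .
qed (simp add: Q_def)

lemma cmod_ev_iterate: "i < d \<Longrightarrow> q < L ^ n \<Longrightarrow> cmod (ev_iterate n i q) = 1"
proof (induction n arbitrary: q)
  case (Suc n)
  then have "q div L ^ n < L" by (simp add: less_mult_imp_div_less)
  then show ?case using Suc by (simp add: norm_mult cmod_ev)
qed simp

lemma eigenfunction_iterate:
  "i < d \<Longrightarrow> q < L ^ n \<Longrightarrow> \<phi> i ((substitute_word \<rho> ^^ n) [a] ! q) = ev_iterate n i q * \<phi> i a"
proof (induction n arbitrary: q a)
  case (Suc n)
  then have "q div L ^ n < L" by (simp add: less_mult_imp_div_less)
  have "(substitute_word \<rho> ^^ Suc n) [a] = (substitute_word \<rho> ^^ n) (\<rho> a)"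
    unfolding funpow_Suc_right by (simp add: substitute_word_def)
  then have "(substitute_word \<rho> ^^ Suc n) [a] ! q = (substitute_word \<rho> ^^ n) [\<rho> a ! (q div L ^ n)] ! (q mod L ^ n)"
    using nth_substitute_word_iterate[of \<rho> L q n "\<rho> a"] Suc.prems length_rho by (simp add: mult.commute)
  then show ?case using Suc.IH Suc.prems(1) \<open>q div L ^ n < L\<close> by (simp add: eigenfunction)
qed simp

lemma trig_poly_P: "trig_poly (P i)"
  unfolding P_def by (rule trig_poly_nat_sum)

lemma trig_poly_Q: "trig_poly (Q n i)"
  unfolding Q_eq_sum by (rule trig_poly_nat_sum)

lemma cmod_Q_le: "i < d \<Longrightarrow> cmod (Q n i k) \<le> real L ^ n"
  unfolding Q_eq_sum
  by (rule order_trans[OF norm_sum]) (simp add: norm_mult cmod_ev_iterate)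

lemma cmod_P_le: "i < d \<Longrightarrow> cmod (P i k) \<le> real L"
  using cmod_Q_le[of i 1 k] by (simp add: Q_def)

definition intensity :: "nat \<Rightarrow> real \<Rightarrow> real" where
  "intensity i k = (cmod (P i k))\<^sup>2 / real L"

lemma trig_poly_intensity: "trig_poly (\<lambda>k. of_real (intensity i k))"
  using trig_poly_scale[OF trig_poly_cmod_square[OF trig_poly_P[of i]], of "1 / of_nat L"]
  by (simp add: intensity_def)

lemma intensity_le: "i < d \<Longrightarrow> intensity i k \<le> real L"
  using power_mono[OF cmod_P_le[of i k], of 2] L_pos
  by (simp add: intensity_def divide_le_eq power2_eq_square)

lemma integral_intensity_eq_1:
  assumes "i < d"
  shows "(LINT k|unit_measure c. intensity i k) = 1"
proof -
  have "(LINT k|unit_measure c. (cmod (P i k))\<^sup>2) = (\<Sum>r<L. (cmod (ev i r))\<^sup>2)"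
    unfolding P_def by (rule parseval) simp
  then show ?thesis using assms L_pos by (simp add: intensity_def cmod_ev)
qed

text \<open>
  The outermost Fourier coefficient of \<open>|P|\<^sup>2\<close> is a single product of unimodular numbers, so that
  \<open>|P|\<^sup>2\<close> is never constant.
\<close>

lemma variance_intensity_pos:
  assumes "i < d"
  shows "(LINT k|unit_measure c. (intensity i k - 1)\<^sup>2) > 0"
proof -
  define f where "f k = intensity i k - 1" for k
  have tp: "trig_poly (\<lambda>k. of_real (f k))"
    unfolding f_def using trig_poly_diff[OF trig_poly_intensity trig_poly_const[of 1]] by simp
  have tp2: "trig_poly (\<lambda>k. of_real ((f k)\<^sup>2))"
    using trig_poly_power[OF tp, of 2] by simp

  have "(LINT k|unit_measure c. ee (of_int (int L - 1) * k) * complex_of_real (f k))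
      = (LINT k|unit_measure c. (1 / of_nat L) * (ee (of_int (int L - 1) * k) *
            (\<Sum>q<L. ev i q * ee (real q * k)) * cnj (\<Sum>q<L. ev i q * ee (real q * k)))
          - ee (of_int (int L - 1) * k))"
    by (intro Bochner_Integration.integral_cong refl)
       (simp add: f_def intensity_def complex_norm_square P_def algebra_simps diff_divide_distrib del: of_real_power)
  also have "\<dots> = (1 / of_nat L) * (\<Sum>q<L. \<Sum>q'<L. if (int L - 1) + int q = int q' then ev i q * cnj (ev i q') else 0)"
  proof (subst Bochner_Integration.integral_diff)
    show "integrable (unit_measure c) (\<lambda>k. (1 / of_nat L) * (ee (of_int (int L - 1) * k) *
            (\<Sum>q<L. ev i q * ee (real q * k)) * cnj (\<Sum>q<L. ev i q * ee (real q * k))))"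
      by (intro integrable_unit_measure_trig_poly trig_poly_ee trig_poly_scale trig_poly_mult
            trig_poly_cnj trig_poly_nat_sum)
  qed (use L_ge_2 in \<open>simp_all only: integral_mult_right_zero integral_ee_times_trig_sum[OF finite_lessThan]
        integral_unit_measure_ee integrable_unit_measure_trig_poly trig_poly_ee, auto\<close>)
  also have "(\<Sum>q<L. \<Sum>q'<L. if (int L - 1) + int q = int q' then ev i q * cnj (ev i q') else 0)
     = (\<Sum>q<L. if q = 0 then ev i 0 * cnj (ev i (L - 1)) else 0)"
  proof (intro sum.cong refl)
    fix q assume "q \<in> {..<L}"
    have "(\<Sum>q'<L. if (int L - 1) + int q = int q' then ev i q * cnj (ev i q') else 0)
        = (\<Sum>q'<L. if q' = L - 1 then (if q = 0 then ev i 0 * cnj (ev i (L - 1)) else 0) else 0)"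
      by (intro sum.cong refl) (use L_pos in auto)
    then show "(\<Sum>q'<L. if (int L - 1) + int q = int q' then ev i q * cnj (ev i q') else 0)
        = (if q = 0 then ev i 0 * cnj (ev i (L - 1)) else 0)" using L_pos by simp
  qed
  also have "\<dots> = ev i 0 * cnj (ev i (L - 1))" using L_pos by simp
  finally have "cmod (LINT k|unit_measure c. ee (of_int (int L - 1) * k) * complex_of_real (f k)) = 1 / real L"
    using assms L_pos by (simp add: norm_mult norm_divide cmod_ev)
  moreover have "cmod (LINT k|unit_measure c. ee (of_int (int L - 1) * k) * complex_of_real (f k))
      \<le> (LINT k|unit_measure c. \<bar>f k\<bar>)"
    using integral_norm_bound[of "unit_measure c" "\<lambda>k. ee (of_int (int L - 1) * k) * complex_of_real (f k)"]
    by (simp add: norm_mult)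
  ultimately have m: "(LINT k|unit_measure c. \<bar>f k\<bar>) \<ge> 1 / real L" by simp
  \<comment> \<open>The variance dominates the square of the mean absolute deviation, which is at least \<open>1 / L\<close>.\<close>
  define m where "m = (LINT k|unit_measure c. \<bar>f k\<bar>)"
  have if1: "integrable (unit_measure c) (\<lambda>k. \<bar>f k\<bar>)"
    using integrable_Re_trig_poly[OF tp] by (rule integrable_abs)
  have if2: "integrable (unit_measure c) (\<lambda>k. (f k)\<^sup>2)"
    by (rule integrable_Re_trig_poly[OF tp2])
  have "0 \<le> (LINT k|unit_measure c. (\<bar>f k\<bar> - m)\<^sup>2)" by simp
  also have "\<dots> = (LINT k|unit_measure c. (f k)\<^sup>2 - 2 * m * \<bar>f k\<bar> + m\<^sup>2)"
    by (intro Bochner_Integration.integral_cong refl) (simp add: power2_diff)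
  also have "\<dots> = (LINT k|unit_measure c. (f k)\<^sup>2) - 2 * m * m + m\<^sup>2"
    using if1 if2 unit_measure.prob_space[of c] by (simp add: m_def)
  finally have "(LINT k|unit_measure c. (f k)\<^sup>2) \<ge> m\<^sup>2" by (simp add: power2_eq_square)
  moreover have "m > 0" using m L_pos by (auto simp: m_def intro: less_le_trans[of 0 "1 / real L"])
  ultimately show ?thesis unfolding f_def by (meson less_le_trans zero_less_power)
qed

text \<open>
  The logarithm of \<open>|P|\<^sup>2 / L\<close> lies below a trigonometric polynomial \<open>h\<close> whose mean is a negative multiple
  of a variance.  The averages of \<open>h\<close> along the orbit of \<open>k\<close> converge to this mean.
\<close>

theorem AE_Q_exponential_decay:
  assumes "i < d"
  obtains c where "c > 0"
    "AE k in lborel. eventually (\<lambda>N. (cmod (Q (N\<^sup>2) i k))\<^sup>2 \<le> real L ^ (N\<^sup>2) * exp (- c * real (N\<^sup>2))) sequentially"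
proof -
  define h where "h k = (intensity i k - 1) - (intensity i k - 1)\<^sup>2 / (2 * real L)" for k
  define c where "c = (LINT k|unit_measure 0. (intensity i k - 1)\<^sup>2) / (4 * real L)"
  have "c > 0" unfolding c_def using variance_intensity_pos[OF assms, of 0] L_pos by simp
  have tp1: "trig_poly (\<lambda>k. of_real (intensity i k - 1))"
    using trig_poly_diff[OF trig_poly_intensity trig_poly_const[of 1]] by simp
  have tp2: "trig_poly (\<lambda>k. of_real ((intensity i k - 1)\<^sup>2 / (2 * real L)))"
    using trig_poly_scale[OF trig_poly_power[OF tp1, of 2], of "1 / (2 * of_nat L)"] by simp
  have tp: "trig_poly (\<lambda>k. of_real (h k))"
    unfolding h_def using trig_poly_diff[OF tp1 tp2] by simp
  have "(LINT k|unit_measure 0. complex_of_real (h k)) = of_real (LINT k|unit_measure 0. h k)"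
    by (rule integral_complex_of_real)
  also have "(LINT k|unit_measure 0. h k)
      = (LINT k|unit_measure 0. intensity i k - 1) - (LINT k|unit_measure 0. (intensity i k - 1)\<^sup>2 / (2 * real L))"
    unfolding h_def by (intro Bochner_Integration.integral_diff integrable_Re_trig_poly tp1 tp2)
  also have "(LINT k|unit_measure 0. intensity i k - 1) = 0"
    using integral_intensity_eq_1[OF assms, of 0] unit_measure.prob_space[of 0] integrable_Re_trig_poly[OF trig_poly_intensity[of i], of 0]
    by simp
  finally have mean: "(LINT k|unit_measure 0. complex_of_real (h k)) = of_real (- (2 * c))"
    by (simp add: c_def)
  have prod_le: "(cmod (Q n i k))\<^sup>2 \<le> real L ^ n * exp (\<Sum>j<n. h (real L ^ j * k))" for n k
  proof -
    have "(cmod (Q n i k))\<^sup>2 = real L ^ n * (\<Prod>j<n. intensity i (real L ^ j * k))"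
      using L_pos
      by (simp add: Q_def intensity_def prod_norm[symmetric] prod_power_distrib[symmetric] prod_dividef)
    also have "(\<Prod>j<n. intensity i (real L ^ j * k)) \<le> (\<Prod>j<n. exp (h (real L ^ j * k)))"
      unfolding h_def using intensity_le[OF assms] L_ge_2
      by (intro prod_mono conjI le_exp_quadratic) (auto simp: intensity_def)
    finally show ?thesis by (simp add: exp_sum mult_left_mono)
  qed
  have "AE k in unit_measure a. (\<lambda>N. (\<Sum>j<N\<^sup>2. complex_of_real (h (real L ^ j * k))) / of_nat (N\<^sup>2)) \<longlonglongrightarrow> of_real (- (2 * c))" for a
    using AE_square_cesaro_trig_poly[OF L_ge_2 tp, of a] by (simp only: mean)
  then have "AE k in lborel. (\<lambda>N. (\<Sum>j<N\<^sup>2. complex_of_real (h (real L ^ j * k))) / of_nat (N\<^sup>2)) \<longlonglongrightarrow> of_real (- (2 * c))"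
    by (rule AE_lborel_if_AE_unit_measure)
  then have "AE k in lborel. eventually (\<lambda>N. (cmod (Q (N\<^sup>2) i k))\<^sup>2 \<le> real L ^ (N\<^sup>2) * exp (- c * real (N\<^sup>2))) sequentially"
  proof eventually_elim
    case (elim k)
    then have "(\<lambda>N. complex_of_real ((\<Sum>j<N\<^sup>2. h (real L ^ j * k)) / real (N\<^sup>2))) \<longlonglongrightarrow> of_real (- (2 * c))"
      by simp
    then have "(\<lambda>N. (\<Sum>j<N\<^sup>2. h (real L ^ j * k)) / real (N\<^sup>2)) \<longlonglongrightarrow> - (2 * c)"
      by (simp only: tendsto_of_real_iff)
    then have "eventually (\<lambda>N. (\<Sum>j<N\<^sup>2. h (real L ^ j * k)) / real (N\<^sup>2) < - c) sequentially"
      by (rule order_tendstoD) (use \<open>c > 0\<close> in simp)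
    then show ?case
      using eventually_gt_at_top[of 0]
    proof eventually_elim
      case (elim N)
      then have "real (N\<^sup>2) > 0" by simp
      then have "(\<Sum>j<N\<^sup>2. h (real L ^ j * k)) \<le> - c * real (N\<^sup>2)"
        using elim(1) by (simp only: divide_less_eq if_True)
      then show ?case
        by (intro order_trans[OF prod_le] mult_left_mono) auto
    qed
  qed
  with \<open>c > 0\<close> that show thesis by blast
qed

end

section \<open>Damped energy of legal words\<close>

lemma energy_restrict:
  assumes "finite A" "B \<subseteq> A"
  shows "energy G (\<lambda>q. if q \<in> B then x q else 0) A = energy G x B"
proof -
  have "(\<Sum>q\<in>A. (if q \<in> B then x q else 0) * ee (real q * k)) = (\<Sum>q\<in>B. x q * ee (real q * k))" for k
    using assms by (intro sum.mono_neutral_cong_right) auto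
  then show ?thesis unfolding energy_def by simp
qed

lemma parseval_multiples:
  assumes "finite A" "M > 0"
  shows "(LINT k|unit_measure c. (cmod (\<Sum>q\<in>A. x q * ee (real (q * M) * k)))\<^sup>2) = (\<Sum>q\<in>A. (cmod (x q))\<^sup>2)"
proof -
  have inj: "inj_on (\<lambda>q. q * M) A" using assms(2) by (auto simp: inj_on_def)
  have "(\<Sum>q\<in>A. x q * ee (real (q * M) * k)) = (\<Sum>p\<in>(\<lambda>q. q * M) ` A. x (p div M) * ee (real p * k))" for k
    using assms(2) by (subst sum.reindex[OF inj]) auto
  then show ?thesis
    using assms parseval[where A = "(\<lambda>q. q * M) ` A" and x = "\<lambda>p. x (p div M)" and c = c]
    by (simp add: sum.reindex[OF inj])
qed

text \<open>
  A window is covered by whole blocks of length \<open>M\<close>, at the price of at most two blocks.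
\<close>

lemma covering_blocks:
  fixes M s len W :: nat
  assumes "M > 0" "s + len \<le> M * W"
  obtains q0 q1 where "q1 \<le> W" "q0 \<le> q1" "q0 * M \<le> s" "s + len \<le> q1 * M" "q1 * M - q0 * M \<le> len + 2 * M"
proof -
  let ?q1 = "(s + len + (M - 1)) div M"
  have 1: "?q1 * M \<le> s + len + (M - 1)" by (rule div_times_less_eq_dividend)
  have 2: "s + len + (M - 1) < ?q1 * M + M"
    using assms(1) by (metis div_mult_mod_eq add_less_cancel_left mod_less_divisor)
  have 3: "s < s div M * M + M"
    using assms(1) by (metis div_mult_mod_eq add_less_cancel_left mod_less_divisor)
  have 4: "s + len \<le> ?q1 * M" using 2 assms(1) by linarith
  have 5: "s div M \<le> ?q1" by (intro div_le_mono) simp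
  have 6: "?q1 * M - s div M * M \<le> len + 2 * M" using 1 3 assms(1) by linarith
  have "M * W = W * M" "(W + 1) * M = W * M + M" by simp_all
  then have "?q1 * M < (W + 1) * M" using 1 assms by linarith
  then have "?q1 \<le> W" using mult_less_cancel2[of ?q1 M "W + 1"] by linarith
  then show thesis using 4 5 6 by (intro that[of ?q1 "s div M"]) auto
qed

text \<open>
  The numbers \<open>t (1 - t)\<^sup>j\<close> decrease in \<open>j\<close> and sum to at most one.
\<close>

lemma mult_one_minus_power_le:
  fixes t :: real
  assumes "0 \<le> t" "t \<le> 1"
  shows "t * (1 - t) ^ J \<le> 1 / real (Suc J)"
proof -
  have "real (Suc J) * (t * (1 - t) ^ J) = (\<Sum>j\<le>J. t * (1 - t) ^ J)" by simp
  also have "\<dots> \<le> (\<Sum>j\<le>J. t * (1 - t) ^ j)"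
    using assms by (intro sum_mono mult_left_mono power_decreasing) auto
  also have "\<dots> = 1 - (1 - t) ^ Suc J"
    by (induction J) (auto simp: algebra_simps)
  also have "\<dots> \<le> 1" using assms by simp
  finally show ?thesis by (simp add: field_simps)
qed

context abelian_columns
begin

text \<open>
  The base is close to one wherever \<open>|Q|\<close> is far below its maximum \<open>L\<^sup>n\<close> and vanishes where every
  \<open>|Q|\<close> attains it.
\<close>

definition damping :: "nat \<Rightarrow> nat \<Rightarrow> real \<Rightarrow> real" where
  "damping J n k = (1 - (\<Sum>i<d. (cmod (Q n i k))\<^sup>2) / (real d * real L ^ (2 * n))) ^ J"

lemma damping_base_bounds:
  "0 \<le> (\<Sum>i<d. (cmod (Q n i k))\<^sup>2) / (real d * real L ^ (2 * n))"
  "(\<Sum>i<d. (cmod (Q n i k))\<^sup>2) / (real d * real L ^ (2 * n)) \<le> 1"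
proof -
  have "(\<Sum>i<d. (cmod (Q n i k))\<^sup>2) \<le> (\<Sum>i<d. real L ^ (2 * n))"
  proof (intro sum_mono)
    fix i assume "i \<in> {..<d}"
    then have "(cmod (Q n i k))\<^sup>2 \<le> (real L ^ n)\<^sup>2" by (intro power_mono cmod_Q_le) auto
    then show "(cmod (Q n i k))\<^sup>2 \<le> real L ^ (2 * n)" by (simp add: power_mult mult.commute[of 2])
  qed
  then show "(\<Sum>i<d. (cmod (Q n i k))\<^sup>2) / (real d * real L ^ (2 * n)) \<le> 1"
    using d_pos L_pos by (simp add: divide_le_eq)
qed (simp add: sum_nonneg)

lemma multiplier_damping: "multiplier (damping J n)"
  unfolding multiplier_def
proof (intro conjI allI)
  have "trig_poly (\<lambda>k. (1 - (1 / of_real (real d * real L ^ (2 * n))) * (\<Sum>i<d. complex_of_real ((cmod (Q n i k))\<^sup>2))) ^ J)"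
    by (intro trig_poly_power trig_poly_diff trig_poly_const trig_poly_scale trig_poly_sum
          trig_poly_cmod_square trig_poly_Q)
  then show "trig_poly (\<lambda>k. complex_of_real (damping J n k))"
    by (simp add: damping_def)
  fix k
  show "0 \<le> damping J n k" "damping J n k \<le> 1"
    using damping_base_bounds[of n k] by (auto simp: damping_def intro!: power_le_one)
qed

text \<open>
  With \<open>t\<close> the average of the \<open>|Q|\<^sup>2 / L\<^sup>2\<^sup>n\<close>, a single \<open>|Q|\<^sup>2\<close> is at most \<open>d L\<^sup>2\<^sup>n t\<close>, and
  \<open>t (1 - t)\<^sup>J \<le> 1 / (J + 1)\<close>.
\<close>

lemma damping_times_Q_le:
  assumes "i < d"
  shows "damping J n k * (cmod (Q n i k))\<^sup>2 \<le> real d * real L ^ (2 * n) / real (Suc J)"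
proof -
  define t where "t = (\<Sum>i<d. (cmod (Q n i k))\<^sup>2) / (real d * real L ^ (2 * n))"
  have t: "0 \<le> t" "t \<le> 1" unfolding t_def by (rule damping_base_bounds)+
  have "(cmod (Q n i k))\<^sup>2 \<le> (\<Sum>i<d. (cmod (Q n i k))\<^sup>2)"
    using assms by (intro member_le_sum) auto
  also have "\<dots> = real d * real L ^ (2 * n) * t" using d_pos L_pos by (simp add: t_def)
  finally have "damping J n k * (cmod (Q n i k))\<^sup>2 \<le> (1 - t) ^ J * (real d * real L ^ (2 * n) * t)"
    using t by (auto simp: damping_def t_def[symmetric] intro!: mult_left_mono)
  also have "\<dots> = real d * real L ^ (2 * n) * (t * (1 - t) ^ J)" by simp
  also have "\<dots> \<le> real d * real L ^ (2 * n) * (1 / real (Suc J))"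
    by (intro mult_left_mono mult_one_minus_power_le t) auto
  finally show ?thesis by simp
qed

definition V :: real where
  "V = (\<Sum>i<d. \<Sum>a\<in>UNIV. cmod (\<phi> i a))"

lemma cmod_phi_le: "i < d \<Longrightarrow> cmod (\<phi> i a) \<le> V"
  unfolding V_def
  by (rule order_trans[OF member_le_sum[of a UNIV "\<lambda>a. cmod (\<phi> i a)"]])
     (auto intro!: member_le_sum[of i "{..<d}" "\<lambda>i. \<Sum>a\<in>UNIV. cmod (\<phi> i a)"] sum_nonneg)

text \<open>
  Inside a supertile the values of \<open>\<phi>\<close> are those of a fixed sequence times the value at the type of the supertile,
  so the Fourier sum over each supertile is \<open>Q\<close> times a single term.
\<close>

lemma sum_blocks:
  assumes i: "i < d" and q1: "q1 \<le> length w"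
  shows "(\<Sum>p=q0 * L ^ n..<q1 * L ^ n. \<phi> i ((substitute_word \<rho> ^^ n) w ! p) * ee (real p * k))
       = Q n i k * (\<Sum>q=q0..<q1. \<phi> i (w ! q) * ee (real (q * L ^ n) * k))"
proof -
  have block: "(\<Sum>p=q * L ^ n..<q * L ^ n + L ^ n. \<phi> i ((substitute_word \<rho> ^^ n) w ! p) * ee (real p * k))
      = Q n i k * (\<phi> i (w ! q) * ee (real (q * L ^ n) * k))" if "q < length w" for q
  proof -
    have "(\<Sum>p=q * L ^ n..<q * L ^ n + L ^ n. \<phi> i ((substitute_word \<rho> ^^ n) w ! p) * ee (real p * k))
       = (\<Sum>s<L ^ n. \<phi> i ((substitute_word \<rho> ^^ n) w ! (s + q * L ^ n)) * ee (real (s + q * L ^ n) * k))"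
      using sum.shift_bounds_nat_ivl[of "\<lambda>p. \<phi> i ((substitute_word \<rho> ^^ n) w ! p) * ee (real p * k)" 0 "q * L ^ n" "L ^ n"]
      by (simp add: atLeast0LessThan add.commute)
    also have "\<dots> = (\<Sum>s<L ^ n. ev_iterate n i s * ee (real s * k) * (\<phi> i (w ! q) * ee (real (q * L ^ n) * k)))"
    proof (intro sum.cong refl)
      fix s assume s: "s \<in> {..<L ^ n}"
      have "s + q * L ^ n < Suc q * L ^ n" using s by simp
      also have "\<dots> \<le> L ^ n * length w" using that by (metis mult.commute mult_le_mono1 Suc_leI)
      finally have "(substitute_word \<rho> ^^ n) w ! (s + q * L ^ n) = (substitute_word \<rho> ^^ n) [w ! q] ! s"
        using nth_substitute_word_iterate[of \<rho> L "s + q * L ^ n" n w] length_rho s by simp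
      then show "\<phi> i ((substitute_word \<rho> ^^ n) w ! (s + q * L ^ n)) * ee (real (s + q * L ^ n) * k)
          = ev_iterate n i s * ee (real s * k) * (\<phi> i (w ! q) * ee (real (q * L ^ n) * k))"
        using eigenfunction_iterate[OF i, of s n "w ! q"] s by (simp add: ee_add ring_distribs)
    qed
    also have "\<dots> = Q n i k * (\<phi> i (w ! q) * ee (real (q * L ^ n) * k))"
      unfolding Q_eq_sum by (simp add: sum_distrib_right)
    finally show ?thesis .
  qed
  have "(\<Sum>p=q0 * L ^ n..<q1 * L ^ n. \<phi> i ((substitute_word \<rho> ^^ n) w ! p) * ee (real p * k))
     = (\<Sum>q=q0..<q1. \<Sum>p=q * L ^ n..<q * L ^ n + L ^ n. \<phi> i ((substitute_word \<rho> ^^ n) w ! p) * ee (real p * k))"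
  proof (cases "q0 \<le> q1")
    case True
    then show ?thesis
    proof (induction q1 rule: dec_induct)
      case (step m)
      have "q0 * L ^ n \<le> m * L ^ n" using step.hyps by simp
      then show ?case
        using step sum.atLeastLessThan_concat[of "q0 * L ^ n" "m * L ^ n" "m * L ^ n + L ^ n",
            where g = "\<lambda>p. \<phi> i ((substitute_word \<rho> ^^ n) w ! p) * ee (real p * k)"]
        by (simp add: add.commute)
    qed simp
  qed simp
  also have "\<dots> = (\<Sum>q=q0..<q1. Q n i k * (\<phi> i (w ! q) * ee (real (q * L ^ n) * k)))"
    using q1 by (intro sum.cong refl block) auto
  finally show ?thesis by (simp add: sum_distrib_left)
qed

text \<open>
  The word is a window of \<open>\<rho>\<^sup>n(w)\<close>.  On the smallest union of supertiles that covers it, the Fourier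
  sum contains the factor \<open>Q\<close>, which the damping controls; the superfluous letters belong to at most two supertiles and
  cost at most their number.  Words that are too short to be such a window have at most \<open>L\<^sup>n\<close> letters.
\<close>

lemma energy_eigenfunction_le:
  assumes "legal_word \<rho> b" and i: "i < d"
  shows "energy (damping J n) (\<lambda>q. \<phi> i (b ! q)) {..<length b}
      \<le> 4 * V\<^sup>2 * (real d * real L ^ (2 * n) / real (Suc J) * (real (length b) / real L ^ n + 2) + real L ^ n)"
    (is "?E \<le> 4 * V\<^sup>2 * (?S * (?l / ?M + 2) + ?M)")
proof -
  obtain N a pre post where dec: "(substitute_word \<rho> ^^ N) [a] = pre @ b @ post"
    using assms(1) unfolding legal_word_def sublist_def by blast
  have lenN: "L ^ N = length pre + length b + length post"
    using arg_cong[OF dec, of length] length_substitute_word_iterate[of \<rho> L N "[a]"] length_rho by simp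
  show ?thesis
  proof (cases "N < n")
    case True
    have "?E \<le> real (card {..<length b}) * V\<^sup>2"
      by (intro energy_le_card multiplier_damping cmod_phi_le i) auto
    also have "real (card {..<length b}) \<le> ?M"
    proof -
      have "length b \<le> L ^ N" using lenN by simp
      also have "\<dots> \<le> L ^ n" using True L_ge_2 by (intro power_increasing) auto
      finally show ?thesis by (simp flip: of_nat_power)
    qed
    then have "real (card {..<length b}) * V\<^sup>2 \<le> ?M * V\<^sup>2" by (intro mult_right_mono) auto
    also have "\<dots> \<le> 4 * V\<^sup>2 * (?S * (?l / ?M + 2) + ?M)"
    proof -
      have "0 \<le> ?S * (?l / ?M + 2)" by simp
      then have "0 \<le> V\<^sup>2 * (?S * (?l / ?M + 2))" by (intro mult_nonneg_nonneg) auto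
      moreover have "0 \<le> V\<^sup>2 * ?M" by simp
      ultimately show ?thesis by (simp add: algebra_simps)
    qed
    finally show ?thesis .
  next
    case False
    define w where "w = (substitute_word \<rho> ^^ (N - n)) [a]"
    define y where "y p = \<phi> i ((substitute_word \<rho> ^^ n) w ! p)" for p
    define s where "s = length pre"
    have dec': "(substitute_word \<rho> ^^ n) w = pre @ b @ post"
      using dec False funpow_add[of n "N - n" "substitute_word \<rho>"] by (simp add: w_def)
    have "s + length b \<le> L ^ n * length w"
      using arg_cong[OF dec', of length] length_substitute_word_iterate[of \<rho> L n w] length_rho
      by (simp add: s_def)
    then obtain q0 q1 where q: "q1 \<le> length w" "q0 \<le> q1" "q0 * L ^ n \<le> s" "s + length b \<le> q1 * L ^ n"
      "q1 * L ^ n - q0 * L ^ n \<le> length b + 2 * L ^ n"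
      using covering_blocks[of "L ^ n" s "length b" "length w"] by (metis L_power_pos)
    define A where "A = {q0 * L ^ n..<q1 * L ^ n}"
    define B where "B = {s..<s + length b}"
    have AB: "B \<subseteq> A" "finite A" using q by (auto simp: A_def B_def)
    have "card A \<le> length b + 2 * L ^ n" using q(5) by (simp add: A_def)
    then have cardA: "real (card A) \<le> ?l + 2 * ?M" by (simp flip: of_nat_power of_nat_add of_nat_mult)
    have blocks: "real (q1 - q0) \<le> ?l / ?M + 2"
    proof -
      have "real ((q1 - q0) * L ^ n) \<le> real (length b + 2 * L ^ n)"
        using q(5) by (simp only: diff_mult_distrib of_nat_le_iff)
      then show ?thesis using L_pos by (simp add: field_simps)
    qed
    have yle: "cmod (y p) \<le> V" for p unfolding y_def by (rule cmod_phi_le[OF i])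
    have EA: "energy (damping J n) y A \<le> V\<^sup>2 * (?S * (?l / ?M + 2))"
    proof -
      have "energy (damping J n) y A
          \<le> (LINT k|unit_measure 0. ?S * (cmod (\<Sum>q=q0..<q1. \<phi> i (w ! q) * ee (real (q * L ^ n) * k)))\<^sup>2)"
        unfolding energy_def
      proof (rule integral_mono)
        show "integrable (unit_measure 0) (\<lambda>k. damping J n k * (cmod (\<Sum>p\<in>A. y p * ee (real p * k)))\<^sup>2)"
          by (intro integrable_multiplier multiplier_damping trig_poly_nat_sum)
        show "integrable (unit_measure 0) (\<lambda>k. ?S * (cmod (\<Sum>q=q0..<q1. \<phi> i (w ! q) * ee (real (q * L ^ n) * k)))\<^sup>2)"
          by (intro integrable_mult_right integrable_Re_trig_poly[OF trig_poly_cmod_square]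
                trig_poly_sum trig_poly_scale trig_poly_ee_nat)
        fix k
        have "damping J n k * (cmod (\<Sum>p\<in>A. y p * ee (real p * k)))\<^sup>2
           = (damping J n k * (cmod (Q n i k))\<^sup>2) * (cmod (\<Sum>q=q0..<q1. \<phi> i (w ! q) * ee (real (q * L ^ n) * k)))\<^sup>2"
          unfolding A_def y_def sum_blocks[OF i q(1)] by (simp add: norm_mult power_mult_distrib)
        also have "\<dots> \<le> ?S * (cmod (\<Sum>q=q0..<q1. \<phi> i (w ! q) * ee (real (q * L ^ n) * k)))\<^sup>2"
          by (intro mult_right_mono damping_times_Q_le i) auto
        finally show "damping J n k * (cmod (\<Sum>p\<in>A. y p * ee (real p * k)))\<^sup>2
           \<le> ?S * (cmod (\<Sum>q=q0..<q1. \<phi> i (w ! q) * ee (real (q * L ^ n) * k)))\<^sup>2" .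
      qed
      also have "\<dots> = ?S * (\<Sum>q=q0..<q1. (cmod (\<phi> i (w ! q)))\<^sup>2)"
        by (simp only: integral_mult_right_zero parseval_multiples[OF finite_atLeastLessThan L_power_pos])
      also have "\<dots> \<le> ?S * (\<Sum>q=q0..<q1. V\<^sup>2)"
        by (intro mult_left_mono sum_mono power_mono cmod_phi_le i) auto
      also have "\<dots> = ?S * (real (q1 - q0) * V\<^sup>2)" by simp
      also have "\<dots> \<le> ?S * ((?l / ?M + 2) * V\<^sup>2)"
        by (intro mult_left_mono mult_right_mono blocks) auto
      finally show ?thesis by (simp add: mult_ac)
    qed
    have "?E = energy (damping J n) (\<lambda>q. y (q + s)) {..<length b}"
    proof -
      have "y (q + s) = \<phi> i (b ! q)" if "q < length b" for q
        using that by (simp add: y_def dec' s_def nth_append)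
      then show ?thesis unfolding energy_def by simp
    qed
    also have "\<dots> = energy (damping J n) y B"
      by (simp add: energy_shift B_def)
    \<comment> \<open>The window is the covering union of supertiles minus the rest \<open>A - B\<close>.\<close>
    also have "\<dots> = energy (damping J n) (\<lambda>p. y p + (if p \<in> A - B then - y p else 0)) A"
    proof -
      have "energy (damping J n) y B = energy (damping J n) (\<lambda>p. if p \<in> B then y p else 0) A"
        using AB by (simp add: energy_restrict)
      also have "\<dots> = energy (damping J n) (\<lambda>p. y p + (if p \<in> A - B then - y p else 0)) A"
      proof -
        have "(\<Sum>p\<in>A. (if p \<in> B then y p else 0) * ee (real p * k))
           = (\<Sum>p\<in>A. (y p + (if p \<in> A - B then - y p else 0)) * ee (real p * k))" for k
          by (intro sum.cong refl) auto
        then show ?thesis unfolding energy_def by simp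
      qed
      finally show ?thesis .
    qed
    also have "\<dots> \<le> 2 * energy (damping J n) y A + 2 * energy (damping J n) (\<lambda>p. if p \<in> A - B then - y p else 0) A"
      by (rule energy_add_le[OF multiplier_damping])
    also have "energy (damping J n) (\<lambda>p. if p \<in> A - B then - y p else 0) A = energy (damping J n) (\<lambda>p. - y p) (A - B)"
      using AB by (intro energy_restrict) auto
    finally have split: "?E \<le> 2 * energy (damping J n) y A + 2 * energy (damping J n) (\<lambda>p. - y p) (A - B)" .
    have "energy (damping J n) (\<lambda>p. - y p) (A - B) \<le> real (card (A - B)) * V\<^sup>2"
      using AB yle by (intro energy_le_card multiplier_damping) auto
    also have "\<dots> \<le> 2 * ?M * V\<^sup>2"
    proof (intro mult_right_mono)
      have "card (A - B) = card A - length b" using AB by (subst card_Diff_subset) (auto simp: B_def)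
      moreover have "length b \<le> card A" using card_mono[OF AB(2,1)] by (simp add: B_def)
      ultimately show "real (card (A - B)) \<le> 2 * ?M" using cardA by (simp add: of_nat_diff)
    qed simp
    finally have rest: "energy (damping J n) (\<lambda>p. - y p) (A - B) \<le> 2 * ?M * V\<^sup>2" .
    have "0 \<le> energy (damping J n) y A" by (rule energy_nonneg[OF multiplier_damping])
    then have "?E \<le> 4 * (V\<^sup>2 * (?S * (?l / ?M + 2))) + 4 * (?M * V\<^sup>2)"
      using split rest EA by linarith
    also have "\<dots> = 4 * V\<^sup>2 * (?S * (?l / ?M + 2) + ?M)" by (simp only: distrib_left mult_ac)
    finally show ?thesis .
  qed
qed

lemma AE_all_Q_exponential_decay:
  obtains c :: "nat \<Rightarrow> real" where "\<And>s. s < d \<Longrightarrow> c s > 0"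
    "AE k in lborel. \<forall>s\<in>{..<d}. eventually (\<lambda>N.
      (cmod (Q (N\<^sup>2) s k))\<^sup>2 \<le> real L ^ (N\<^sup>2) * exp (- c s * real (N\<^sup>2))) sequentially"
proof -
  have "\<exists>c. c > 0 \<and> (AE k in lborel. eventually (\<lambda>N.
      (cmod (Q (N\<^sup>2) s k))\<^sup>2 \<le> real L ^ (N\<^sup>2) * exp (- c * real (N\<^sup>2))) sequentially)"
    if "s < d" for s
    by (rule AE_Q_exponential_decay[OF that]) (intro exI conjI)
  then have "\<forall>s\<in>{..<d}. \<exists>c. c > 0 \<and> (AE k in lborel. eventually (\<lambda>N.
      (cmod (Q (N\<^sup>2) s k))\<^sup>2 \<le> real L ^ (N\<^sup>2) * exp (- c * real (N\<^sup>2))) sequentially)"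
    by simp
  from bchoice[OF this] obtain c where c: "\<forall>s\<in>{..<d}. c s > 0 \<and> (AE k in lborel. eventually (\<lambda>N.
      (cmod (Q (N\<^sup>2) s k))\<^sup>2 \<le> real L ^ (N\<^sup>2) * exp (- c s * real (N\<^sup>2))) sequentially)"
    by blast
  show thesis
  proof (rule that)
    show "c s > 0" if "s < d" for s using c that by simp
    show "AE k in lborel. \<forall>s\<in>{..<d}. eventually (\<lambda>N.
      (cmod (Q (N\<^sup>2) s k))\<^sup>2 \<le> real L ^ (N\<^sup>2) * exp (- c s * real (N\<^sup>2))) sequentially"
      using c by (intro AE_finite_allI) auto
  qed
qed

text \<open>
  The exponent exceeds \<open>L\<^sup>n\<close>, for \<open>n = i\<^sup>2\<close>, by the factor \<open>i\<close>: this tends to infinity, so that energies are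
  damped, but more slowly than any exponential in \<open>n\<close>, so that the multiplier still tends to one.
\<close>

definition damp :: "nat \<Rightarrow> real \<Rightarrow> real" where
  "damp i = damping (i * L ^ (i\<^sup>2)) (i\<^sup>2)"

lemma multiplier_damp: "multiplier (damp i)"
  unfolding damp_def by (rule multiplier_damping)

lemma measurable_damp [measurable]: "damp i \<in> borel_measurable borel"
proof -
  have "continuous_on UNIV (\<lambda>k. Re (complex_of_real (damp i k)))"
    by (intro continuous_on_Re continuous_trig_poly multiplierD(1) multiplier_damp)
  then show ?thesis by (intro borel_measurable_continuous_onI) simp
qed

text \<open>
  By Bernoulli's inequality, one minus the multiplier is at most the exponent times the average of
  \<open>|Q|\<^sup>2 / L\<^sup>2\<^sup>n\<close>; by the exponential decay of \<open>|Q|\<^sup>2 / L\<^sup>n\<close> this is eventually at most a finite sum of terms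
  \<open>i exp(- c i\<^sup>2)\<close>.
\<close>

lemma AE_damp_tendsto_1: "AE k in lborel. (\<lambda>i. damp i k) \<longlonglongrightarrow> 1"
proof -
  obtain c where c: "\<And>s. s < d \<Longrightarrow> c s > 0"
    and decay: "AE k in lborel. \<forall>s\<in>{..<d}. eventually (\<lambda>N.
      (cmod (Q (N\<^sup>2) s k))\<^sup>2 \<le> real L ^ (N\<^sup>2) * exp (- c s * real (N\<^sup>2))) sequentially"
    using AE_all_Q_exponential_decay by blast
  from decay show ?thesis
  proof eventually_elim
    case (elim k)
    define r where "r i = (\<Sum>s<d. real i * exp (- c s * real (i\<^sup>2)))" for i
    have r: "r \<longlonglongrightarrow> 0"
    proof -
      have "(\<lambda>i. real i * exp (- c s * real (i\<^sup>2))) \<longlonglongrightarrow> 0" if "s < d" for s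
      proof -
        have "(\<lambda>i. real i * exp (- C * real (i\<^sup>2))) \<longlonglongrightarrow> 0" if "C > 0" for C
        proof (rule tendsto_sandwich[OF _ _ tendsto_const])
          show "(\<lambda>i. 1 / (C * real i)) \<longlonglongrightarrow> 0"
            using tendsto_mult_right_zero[OF lim_inverse_n, of "1 / C"] by (simp add: field_simps)
          show "eventually (\<lambda>i. real i * exp (- C * real (i\<^sup>2)) \<le> 1 / (C * real i)) sequentially"
            using eventually_gt_at_top[of 0]
          proof eventually_elim
            case (elim i)
            have "x * exp (- x) \<le> 1" for x :: real
            proof -
              have "x \<le> exp x" using exp_ge_add_one_self[of x] by linarith
              then have "x * exp (- x) \<le> exp x * exp (- x)" by (intro mult_right_mono) auto
              then show ?thesis by (simp add: exp_minus)
            qed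
            from this[of "C * real (i\<^sup>2)"]
            have "(C * real i) * (real i * exp (- C * real (i\<^sup>2))) \<le> 1"
              by (simp add: power2_eq_square mult_ac)
            then show ?case using elim that by (simp only: pos_le_divide_eq mult_pos_pos of_nat_0_less_iff mult.commute)
          qed
        qed auto
        then show ?thesis using c[OF that] by blast
      qed
      then have "(\<lambda>i. \<Sum>s<d. real i * exp (- c s * real (i\<^sup>2))) \<longlonglongrightarrow> (\<Sum>s<d. 0)"
        by (intro tendsto_sum) auto
      then show ?thesis by (simp add: r_def[abs_def])
    qed
    have "eventually (\<lambda>i. \<forall>s\<in>{..<d}. (cmod (Q (i\<^sup>2) s k))\<^sup>2 \<le> real L ^ (i\<^sup>2) * exp (- c s * real (i\<^sup>2))) sequentially"
      using elim by (intro eventually_ball_finite) auto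
    then have lower: "eventually (\<lambda>i. 1 - r i \<le> damp i k) sequentially"
    proof eventually_elim
      case (elim i)
      define t where "t = (\<Sum>s<d. (cmod (Q (i\<^sup>2) s k))\<^sup>2) / (real d * real L ^ (2 * i\<^sup>2))"
      have t: "0 \<le> t" "t \<le> 1" unfolding t_def by (rule damping_base_bounds)+
      have "real (i * L ^ i\<^sup>2) * t = real i * (\<Sum>s<d. (cmod (Q (i\<^sup>2) s k))\<^sup>2) / (real d * real L ^ i\<^sup>2)"
        by (simp add: t_def mult_2 power_add)
      also have "\<dots> \<le> real i * (\<Sum>s<d. real L ^ i\<^sup>2 * exp (- c s * real (i\<^sup>2))) / (real d * real L ^ i\<^sup>2)"
        using elim by (intro divide_right_mono mult_left_mono sum_mono) auto
      also have "\<dots> = r i / real d"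
        using L_ge_2 by (simp add: r_def sum_distrib_left[symmetric])
      also have "\<dots> \<le> r i"
      proof -
        have "r i \<ge> 0" by (auto simp: r_def intro!: sum_nonneg)
        then show ?thesis using d_pos by (simp add: divide_le_eq mult_le_cancel_left1)
      qed
      finally have "real (i * L ^ i\<^sup>2) * t \<le> r i" .
      moreover have "1 + real (i * L ^ i\<^sup>2) * (- t) \<le> (1 + - t) ^ (i * L ^ i\<^sup>2)"
        using t by (intro Bernoulli_inequality) auto
      ultimately show ?case by (simp add: damp_def damping_def t_def[symmetric])
    qed
    show ?case
    proof (rule tendsto_sandwich[OF lower _ _ tendsto_const])
      show "(\<lambda>i. 1 - r i) \<longlonglongrightarrow> 1" using tendsto_diff[OF tendsto_const r, of 1] by simp
    qed (use multiplierD(3)[OF multiplier_damp] in simp)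
  qed
qed

text \<open>
  The fraction \<open>C / i\<close> of the trivial bound \<open>K\<^sup>2 length b\<close> survives, up to an error that does not grow with the
  word.
\<close>

theorem energy_legal_word_le:
  obtains C :: real and E :: "nat \<Rightarrow> real"
  where "C \<ge> 0" "\<And>i. E i \<ge> 0"
    "\<And>i b u K. i > 0 \<Longrightarrow> legal_word \<rho> b \<Longrightarrow> (\<And>a. cmod (u a) \<le> K) \<Longrightarrow>
       energy (damp i) (\<lambda>q. u (b ! q)) {..<length b} \<le> K\<^sup>2 * (C / real i * real (length b) + E i)"
proof -
  define C where "C = 4 * (real d)\<^sup>2 * V\<^sup>2 * real d"
  define E where "E i = 4 * (real d)\<^sup>2 * V\<^sup>2 * (2 * real d * real L ^ i\<^sup>2 + real L ^ i\<^sup>2)" for i :: nat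
  have "energy (damp i) (\<lambda>q. u (b ! q)) {..<length b} \<le> K\<^sup>2 * (C / real i * real (length b) + E i)"
    if i: "i > 0" and b: "legal_word \<rho> b" and u: "\<And>a. cmod (u a) \<le> K" for i b u K
  proof -
    define M where "M = real L ^ i\<^sup>2"
    define l where "l = real (length b)"
    have M: "M > 0" by (simp add: M_def)
    define X where "X = 4 * V\<^sup>2 * (real d * l / real i + 2 * real d * M + M)"
    have single: "energy (damp i) (\<lambda>q. \<phi> s (b ! q)) {..<length b} \<le> X" if "s < d" for s
    proof -
      have S: "real d * real L ^ (2 * i\<^sup>2) / real (Suc (i * L ^ i\<^sup>2)) \<le> real d * M / real i"
      proof -
        have "real d * real L ^ (2 * i\<^sup>2) / real (Suc (i * L ^ i\<^sup>2)) \<le> real d * real L ^ (2 * i\<^sup>2) / (real i * M)"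
          using i M by (intro divide_left_mono mult_pos_pos) (auto simp: M_def add_pos_nonneg)
        also have "\<dots> = real d * M / real i"
          using M by (simp add: M_def mult_2 power_add)
        finally show ?thesis .
      qed
      have "energy (damp i) (\<lambda>q. \<phi> s (b ! q)) {..<length b}
          \<le> 4 * V\<^sup>2 * (real d * real L ^ (2 * i\<^sup>2) / real (Suc (i * L ^ i\<^sup>2)) * (l / M + 2) + M)"
        unfolding damp_def M_def l_def by (rule energy_eigenfunction_le[OF b that])
      also have "\<dots> \<le> 4 * V\<^sup>2 * (real d * M / real i * (l / M + 2) + M)"
        using S M by (intro mult_left_mono add_mono mult_right_mono) (auto simp: l_def)
      also have "real d * M / real i * (l / M + 2) = real d * l / real i + 2 * real d * M / real i"
        using M i by (simp add: field_simps)
      also have "4 * V\<^sup>2 * (real d * l / real i + 2 * real d * M / real i + M) \<le> X"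
      proof -
        have "2 * real d * M / real i \<le> 2 * real d * M"
          using i M divide_left_mono[of 1 "real i" "2 * real d * M"] by simp
        then show ?thesis unfolding X_def by (intro mult_left_mono add_mono) auto
      qed
      finally show ?thesis .
    qed
    have "(\<lambda>q. u (b ! q)) = (\<lambda>q. \<Sum>s<d. u (\<kappa> s) * \<phi> s (b ! q))"
      using expansion by (intro ext) auto
    then have "energy (damp i) (\<lambda>q. u (b ! q)) {..<length b}
        \<le> real (card {..<d}) * (\<Sum>s<d. (cmod (u (\<kappa> s)))\<^sup>2 * energy (damp i) (\<lambda>q. \<phi> s (b ! q)) {..<length b})"
      using energy_linear_combination_le[OF multiplier_damp finite_lessThan, where c = "\<lambda>s. u (\<kappa> s)"
          and x = "\<lambda>s q. \<phi> s (b ! q)" and A = "{..<length b}"] by simp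
    also have "\<dots> \<le> real (card {..<d}) * (\<Sum>s<d. K\<^sup>2 * X)"
      by (intro mult_left_mono sum_mono mult_mono power_mono u single energy_nonneg multiplier_damp) auto
    also have "\<dots> = K\<^sup>2 * ((real d)\<^sup>2 * X)" by (simp add: power2_eq_square mult_ac)
    also have "(real d)\<^sup>2 * X = C / real i * real (length b) + E i"
      by (simp add: X_def C_def E_def M_def l_def algebra_simps add_divide_distrib)
    finally show ?thesis .
  qed
  moreover have "C \<ge> 0" "E i \<ge> 0" for i by (auto simp: C_def E_def)
  ultimately show thesis using that by blast
qed

end

section \<open>Positivity of the Lyapunov exponents\<close>

text \<open>
  Summing over all positions, with an indicator, makes the order of summation interchangeable.
\<close>

lemma fourier_matrix_entry:
  assumes "length (\<rho> b) = L"
  shows "fourier_matrix \<rho> k $ a $ b = (\<Sum>r<L. if \<rho> b ! r = a then ee (real r * k) else 0)"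
proof -
  have "fourier_matrix \<rho> k $ a $ b = (\<Sum>r\<in>{r. r < L \<and> \<rho> b ! r = a}. ee (real r * k))"
    unfolding fourier_matrix_def displacement_set_def
    by (simp only: vec_lambda_beta assms ee_eq_exp of_real_mult of_real_of_nat_eq mult.assoc)
  also have "\<dots> = (\<Sum>r<L. if \<rho> b ! r = a then ee (real r * k) else 0)"
    by (intro sum.mono_neutral_cong_left) auto
  finally show ?thesis .
qed

context abelian_columns
begin

text \<open>
  The bilinear pairing with \<open>\<phi>\<close>, without complex conjugation: it diagonalises the Fourier matrix from the left.
\<close>

definition pairing :: "nat \<Rightarrow> complex^'a \<Rightarrow> complex" where
  "pairing s x = (\<Sum>a\<in>UNIV. \<phi> s a * x $ a)"

lemma pairing_fourier_matrix:
  assumes "s < d"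
  shows "pairing s (fourier_matrix \<rho> k *v x) = P s k * pairing s x"
proof -
  note ind = fourier_matrix_entry[OF length_rho]
  have "(\<Sum>a\<in>UNIV. \<phi> s a * fourier_matrix \<rho> k $ a $ b) = P s k * \<phi> s b" for b
  proof -
    have "(\<Sum>a\<in>UNIV. \<phi> s a * fourier_matrix \<rho> k $ a $ b)
        = (\<Sum>a\<in>UNIV. \<Sum>r<L. if \<rho> b ! r = a then \<phi> s a * ee (real r * k) else 0)"
      by (simp only: ind sum_distrib_left if_distrib[of "\<lambda>x. _ * x"] mult_zero_right)
    also have "\<dots> = (\<Sum>r<L. \<Sum>a\<in>UNIV. if \<rho> b ! r = a then \<phi> s a * ee (real r * k) else 0)"
      by (rule sum.swap)
    also have "\<dots> = (\<Sum>r<L. \<phi> s (\<rho> b ! r) * ee (real r * k))" by simp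
    also have "\<dots> = P s k * \<phi> s b"
      unfolding P_def sum_distrib_right by (intro sum.cong refl) (simp add: eigenfunction[OF assms])
    finally show ?thesis .
  qed
  note col = this
  have "pairing s (fourier_matrix \<rho> k *v x)
      = (\<Sum>a\<in>UNIV. \<Sum>b\<in>UNIV. \<phi> s a * fourier_matrix \<rho> k $ a $ b * x $ b)"
    by (simp only: pairing_def matrix_vector_mult_def vec_lambda_beta sum_distrib_left mult.assoc)
  also have "\<dots> = (\<Sum>b\<in>UNIV. \<Sum>a\<in>UNIV. \<phi> s a * fourier_matrix \<rho> k $ a $ b * x $ b)"
    by (rule sum.swap)
  also have "\<dots> = (\<Sum>b\<in>UNIV. P s k * \<phi> s b * x $ b)"
    by (simp only: col sum_distrib_right[symmetric])
  finally show ?thesis by (simp only: pairing_def sum_distrib_left mult.assoc)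
qed

lemma pairing_nonzero:
  assumes "x \<noteq> 0"
  obtains s where "s < d" "pairing s x \<noteq> 0"
proof -
  obtain b where "x $ b \<noteq> 0" using assms by (auto simp: vec_eq_iff)
  have "x $ b = (\<Sum>a\<in>UNIV. (if a = b then 1 else 0) * x $ a)"
    by (simp add: if_distrib[of "\<lambda>z. z * _"] cong: if_cong)
  also have "\<dots> = (\<Sum>a\<in>UNIV. (\<Sum>s<d. (if \<kappa> s = b then 1 else 0) * \<phi> s a) * x $ a)"
    by (simp only: expansion[of "\<lambda>a. if a = b then 1 else 0", symmetric])
  also have "\<dots> = (\<Sum>s<d. (if \<kappa> s = b then 1 else 0) * pairing s x)"
    unfolding pairing_def sum_distrib_left sum_distrib_right
    by (subst sum.swap) (simp add: mult.assoc)
  finally have expand_x: "x $ b = (\<Sum>s<d. (if \<kappa> s = b then 1 else 0) * pairing s x)" .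
  show thesis
  proof (rule ccontr)
    assume "\<not> thesis"
    then have "\<And>s. s < d \<Longrightarrow> pairing s x = 0" using that by blast
    then show False using \<open>x $ b \<noteq> 0\<close> expand_x by simp
  qed
qed

lemma invertible_fourier_matrix:
  assumes "\<And>s. s < d \<Longrightarrow> P s k \<noteq> 0"
  shows "invertible (fourier_matrix \<rho> k)"
proof -
  have "\<forall>x. fourier_matrix \<rho> k *v x = 0 \<longrightarrow> x = 0"
  proof (intro allI impI, rule ccontr)
    fix x assume 0: "fourier_matrix \<rho> k *v x = 0" and "x \<noteq> 0"
    then obtain s where s: "s < d" "pairing s x \<noteq> 0" using pairing_nonzero by blast
    have "pairing s (0 :: complex^'a) = 0" by (simp add: pairing_def)
    then have "P s k * pairing s x = 0"
      using pairing_fourier_matrix[OF s(1), of k x] 0 by simp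
    with assms[OF s(1)] s(2) show False by simp
  qed
  then show ?thesis unfolding invertible_left_inverse matrix_left_invertible_ker .
qed

lemma pairing_inverse_cocycle:
  assumes s: "s < d" and nz: "\<And>j s. s < d \<Longrightarrow> P s (real L ^ j * k) \<noteq> 0"
  shows "pairing s x = Q n s k * pairing s (inverse_cocycle L \<rho> n k *v x)"
proof (induction n)
  case (Suc n)
  let ?B = "fourier_matrix \<rho> (real L ^ n * k)"
  have "?B ** matrix_inv ?B = mat 1"
  proof -
    have "\<exists>A'. ?B ** A' = mat 1 \<and> A' ** ?B = mat 1"
      using invertible_fourier_matrix[of "real L ^ n * k"] nz unfolding invertible_def by blast
    from someI_ex[OF this] show ?thesis unfolding matrix_inv_def by blast
  qed
  then have "?B *v (inverse_cocycle L \<rho> (Suc n) k *v x) = inverse_cocycle L \<rho> n k *v x"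
    by (simp add: matrix_vector_mul_assoc matrix_mul_assoc)
  then have "pairing s (inverse_cocycle L \<rho> n k *v x)
      = P s (real L ^ n * k) * pairing s (inverse_cocycle L \<rho> (Suc n) k *v x)"
    using pairing_fourier_matrix[OF s, of "real L ^ n * k" "inverse_cocycle L \<rho> (Suc n) k *v x"] by simp
  then show ?case using Suc by (simp add: Q_def)
qed (simp add: Q_def)

lemma norm_pairing_le: "s < d \<Longrightarrow> cmod (pairing s x) \<le> real CARD('a) * V * norm x"
proof -
  assume s: "s < d"
  have "cmod (pairing s x) \<le> (\<Sum>a\<in>(UNIV::'a set). V * norm x)"
    unfolding pairing_def
  proof (rule sum_norm_le)
    fix a
    have "0 \<le> V" using cmod_phi_le[OF s, of a] norm_ge_zero order_trans by blast
    then show "cmod (\<phi> s a * x $ a) \<le> V * norm x"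
      unfolding norm_mult by (intro mult_mono cmod_phi_le s) (auto simp: Finite_Cartesian_Product.norm_nth_le)
  qed
  then show ?thesis by (simp add: mult_ac)
qed

text \<open>
  \<open>P(k)\<close> is a polynomial in \<open>e(k)\<close> with constant term of modulus one.
\<close>

lemma countable_zeros_P:
  assumes "s < d"
  shows "countable {k. P s k = 0}"
proof -
  define p where "p = (\<Sum>r<L. monom (ev s r) r)"
  have "poly.coeff p 0 = ev s 0"
    using L_pos by (simp add: p_def coeff_sum monom.rep_eq)
  then have "p \<noteq> 0" using cmod_ev[OF assms L_pos] by auto
  then have fin: "finite {z. poly p z = 0}" by (rule poly_roots_finite)
  have Pp: "P s k = poly p (ee k)" for k
    by (simp add: P_def p_def poly_sum poly_monom ee_of_nat_mult)
  have "countable {k. ee k = z}" for z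
  proof (cases "\<exists>k0. ee k0 = z")
    case True
    then obtain k0 where k0: "ee k0 = z" by blast
    have "{k. ee k = z} \<subseteq> (\<lambda>n::int. k0 + of_int n) ` UNIV"
    proof
      fix k assume "k \<in> {k. ee k = z}"
      then have "ee (k - k0) = ee k0 * cnj (ee k0)" using k0 by (simp only: ee_diff mem_Collect_eq)
      then have "ee (k - k0) = 1" by simp
      then have "cos (2 * pi * (k - k0)) = 1"
        by (metis ee_def cis.sel(1) one_complex.sel(1))
      then obtain n :: int where "2 * pi * (k - k0) = of_int n * 2 * pi"
        using cos_one_2pi_int by blast
      then have "k = k0 + of_int n" by simp
      then show "k \<in> (\<lambda>n::int. k0 + of_int n) ` UNIV" by blast
    qed
    then show ?thesis by (rule countable_subset) auto
  qed auto
  moreover have "{k. P s k = 0} = (\<Union>z\<in>{z. poly p z = 0}. {k. ee k = z})"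
    by (auto simp: Pp)
  ultimately show ?thesis using fin by (simp add: countable_finite)
qed

text \<open>
  Outside a countable set of \<open>k\<close> all matrices along the orbit are invertible.  A nonzero vector has a nonzero
  pairing with some \<open>\<phi>\<close>, and this pairing is \<open>Q\<^sub>n\<close> times that of the \<open>n\<close>-th iterate.  The norm of
  the iterate is therefore at least a constant over \<open>|Q\<^sub>n|\<close>.  For the upper limit the
  squares \<open>n = N\<^sup>2\<close> suffice.
\<close>

theorem lyapunov_exponents_positive:
  "AE k in lborel. \<forall>\<theta>\<in>lyapunov_exponents L \<rho> k. \<theta> > 0"
proof -
  have "AE k in lborel. P s (real L ^ j * k) \<noteq> 0" if "s < d" for s j
  proof -
    have "{k. P s (real L ^ j * k) = 0} \<subseteq> (\<lambda>x. x / real L ^ j) ` {x. P s x = 0}"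
      by (auto simp: image_iff intro!: exI[of _ "real L ^ j * _"])
    then have "countable {k. P s (real L ^ j * k) = 0}"
      using countable_zeros_P[OF that] by (meson countable_image countable_subset)
    then have "AE k in lborel. k \<notin> {k. P s (real L ^ j * k) = 0}"
      by (intro AE_not_in countable_imp_null_set_lborel)
    then show ?thesis by simp
  qed
  then have nz: "AE k in lborel. \<forall>j. \<forall>s\<in>{..<d}. P s (real L ^ j * k) \<noteq> 0"
    unfolding AE_all_countable by (intro allI AE_finite_allI) auto
  obtain c where c: "\<And>s. s < d \<Longrightarrow> c s > 0"
    and decay: "AE k in lborel. \<forall>s\<in>{..<d}. eventually (\<lambda>N.
      (cmod (Q (N\<^sup>2) s k))\<^sup>2 \<le> real L ^ (N\<^sup>2) * exp (- c s * real (N\<^sup>2))) sequentially"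
    using AE_all_Q_exponential_decay by blast
  from nz decay show ?thesis
  proof eventually_elim
    case (elim k)
    show ?case
    proof
      fix \<theta> assume "\<theta> \<in> lyapunov_exponents L \<rho> k"
      then obtain x where x: "x \<noteq> 0" and \<theta>: "\<theta> = lyapunov_exponent L \<rho> k x"
        by (auto simp: lyapunov_exponents_def)
      obtain s where s: "s < d" "pairing s x \<noteq> 0" using pairing_nonzero[OF x] by blast
      define C where "C = cmod (pairing s x) / (real CARD('a) * V)"
      have "V > 0"
      proof (rule ccontr)
        assume "\<not> V > 0"
        then have "real CARD('a) * V * norm x \<le> 0" by (simp add: mult_nonneg_nonpos mult_nonpos_nonneg)
        with norm_pairing_le[OF s(1), of x] have "cmod (pairing s x) \<le> 0" by linarith
        with s(2) show False by simp
      qed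
      then have "C > 0" using s(2) by (simp add: C_def)
      define a where "a n = ln (norm ((real L powr (real n / 2)) *\<^sub>R (inverse_cocycle L \<rho> n k *v x))) / real n" for n
      have "eventually (\<lambda>N. (cmod (Q (N\<^sup>2) s k))\<^sup>2 \<le> real L ^ (N\<^sup>2) * exp (- c s * real (N\<^sup>2))) sequentially"
        using elim s(1) by blast
      moreover have "eventually (\<lambda>N. - (c s / 4) \<le> ln C / real (N\<^sup>2)) sequentially"
      proof -
        have "filterlim (\<lambda>N. real (N\<^sup>2)) at_top sequentially"
          by (rule filterlim_at_top_mono[OF filterlim_real_sequentially])
             (auto intro!: always_eventually simp: power2_eq_square simp flip: of_nat_mult)
        then have "(\<lambda>N. ln C / real (N\<^sup>2)) \<longlonglongrightarrow> 0"
          by (intro tendsto_divide_0[OF tendsto_const] filterlim_at_top_imp_at_infinity)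
        then show ?thesis
          using order_tendstoD(1)[of _ 0 sequentially "- (c s / 4)"] c[OF s(1)]
          by (force elim: eventually_mono)
      qed
      ultimately have "eventually (\<lambda>N. c s / 4 \<le> a (N\<^sup>2)) sequentially"
        using eventually_gt_at_top[of 0]
      proof eventually_elim
        case (elim N)
        define n where "n = N\<^sup>2"
        have "n > 0" using elim(3) by (simp add: n_def)
        define y where "y = norm ((real L powr (real n / 2)) *\<^sub>R (inverse_cocycle L \<rho> n k *v x))"
        have pair: "pairing s x = Q n s k * pairing s (inverse_cocycle L \<rho> n k *v x)"
          using pairing_inverse_cocycle[OF s(1)] \<open>\<forall>j. \<forall>s\<in>{..<d}. P s (real L ^ j * k) \<noteq> 0\<close> by blast
        have powr2: "(real L powr (real n / 2))\<^sup>2 = real L ^ n"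
          by (simp add: powr_powr power2_eq_square powr_add[symmetric] powr_realpow)
        have "cmod (Q n s k) \<le> real L powr (real n / 2) * exp (- c s * real n / 2)"
        proof (rule power2_le_imp_le)
          have "(exp (- c s * real n / 2))\<^sup>2 = exp (- c s * real n)"
            by (simp add: power2_eq_square exp_add[symmetric])
          then show "(cmod (Q n s k))\<^sup>2 \<le> (real L powr (real n / 2) * exp (- c s * real n / 2))\<^sup>2"
            using elim(1) by (simp add: power_mult_distrib powr2 n_def[symmetric])
        qed simp
        then have "cmod (pairing s x) \<le> (real L powr (real n / 2) * exp (- c s * real n / 2))
            * (real CARD('a) * V * norm (inverse_cocycle L \<rho> n k *v x))"
          unfolding pair norm_mult by (intro mult_mono norm_pairing_le s) auto
        also have "\<dots> = real CARD('a) * V * (exp (- c s * real n / 2) * y)"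
          by (simp add: y_def mult_ac)
        finally have "C \<le> exp (- c s * real n / 2) * y"
          using \<open>V > 0\<close> by (simp add: C_def divide_le_eq mult_ac)
        then have "exp (c s * real n / 2) * C \<le> exp (c s * real n / 2) * (exp (- c s * real n / 2) * y)"
          by (intro mult_left_mono) auto
        also have "\<dots> = y" by (simp add: mult.assoc[symmetric] exp_add[symmetric])
        finally have "exp (c s * real n / 2) * C \<le> y" .
        then have "ln (exp (c s * real n / 2) * C) \<le> ln y"
          using \<open>C > 0\<close> by (subst ln_le_cancel_iff) (auto intro: less_le_trans[of 0 "exp (c s * real n / 2) * C"])
        then have "c s * real n / 2 + ln C \<le> ln y"
          using \<open>C > 0\<close> by (simp add: ln_mult)
        then have "(c s * real n / 2 + ln C) / real n \<le> a n"
          unfolding a_def y_def[symmetric] by (intro divide_right_mono) auto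
        moreover have "(c s * real n / 2 + ln C) / real n = c s / 2 + ln C / real n"
          using \<open>n > 0\<close> by (simp add: field_simps)
        ultimately show ?case using elim(2) by (simp add: n_def)
      qed
      then have ev: "eventually (\<lambda>N. ereal (c s / 4) \<le> (ereal \<circ> a \<circ> (\<lambda>N. N\<^sup>2)) N) sequentially"
        by simp
      have "ereal (c s / 4) \<le> limsup (ereal \<circ> a \<circ> (\<lambda>N. N\<^sup>2))"
        by (rule le_Limsup[OF sequentially_bot ev])
      also have "\<dots> \<le> limsup (ereal \<circ> a)"
        by (rule limsup_subseq_mono) (auto simp: strict_mono_def power_strict_mono)
      also have "\<dots> = \<theta>" unfolding \<theta> lyapunov_exponent_def a_def by (simp add: comp_def)
      finally show "\<theta> > 0" using c[OF s(1)] by (auto intro: less_le_trans[of 0 "ereal (c s / 4)"])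
    qed
  qed
qed

end

section \<open>Tilings in the hull\<close>

definition legal_sequence :: "'a substitution \<Rightarrow> (int \<Rightarrow> 'a) \<Rightarrow> bool" where
  "legal_sequence \<rho> w \<longleftrightarrow> (\<forall>m n. legal_word \<rho> (map w [m..n]))"

lemma map_upto_shift: "map (\<lambda>j. f (j + s)) [m..n] = map f [m + s..n + (s::int)]"
  by (rule nth_equalityI) (auto simp: algebra_simps)

lemma legal_sequence_shift: "legal_sequence \<rho> w \<Longrightarrow> legal_sequence \<rho> (\<lambda>j. w (j + s))"
  unfolding legal_sequence_def map_upto_shift by simp

lemma legal_word_sublist: "legal_word \<rho> w \<Longrightarrow> sublist v w \<Longrightarrow> legal_word \<rho> v"
  unfolding legal_word_def by (meson sublist_order.order_trans)

lemma translate_tiling_of: "translate t (tiling_of x w) = tiling_of (x + t) w"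
  unfolding translate_def tiling_of_def by (auto simp: image_iff algebra_simps) 

lemma tiling_of_shift: "tiling_of (x + of_int s) w = tiling_of x (\<lambda>j. w (j - s))"
proof
  fix i
  show "tiling_of (x + of_int s) w i = tiling_of x (\<lambda>j. w (j - s)) i"
  proof (intro set_eqI iffI)
    fix y assume "y \<in> tiling_of (x + of_int s) w i"
    then obtain n where "y = x + of_int s + of_int n" "w n = i" by (auto simp: tiling_of_def)
    then show "y \<in> tiling_of x (\<lambda>j. w (j - s)) i"
      unfolding tiling_of_def by (intro CollectI exI[of _ "n + s"]) auto
  next
    fix y assume "y \<in> tiling_of x (\<lambda>j. w (j - s)) i"
    then obtain n where "y = x + of_int n" "w (n - s) = i" by (auto simp: tiling_of_def)
    then show "y \<in> tiling_of (x + of_int s) w i"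
      unfolding tiling_of_def by (intro CollectI exI[of _ "n - s"]) auto
  qed
qed

lemma mem_tiling_of: "x + of_int n \<in> tiling_of x w i \<longleftrightarrow> w n = i"
  by (auto simp: tiling_of_def)

text \<open>
  The hull enters the argument only through this property of its elements.
\<close>

definition legal_tiling :: "'a substitution \<Rightarrow> 'a tiling \<Rightarrow> bool" where
  "legal_tiling \<rho> \<Lambda> \<longleftrightarrow> (\<exists>x w. \<Lambda> = tiling_of x w \<and> legal_sequence \<rho> w)"

lemma legal_tiling_translate: "legal_tiling \<rho> \<Lambda> \<Longrightarrow> legal_tiling \<rho> (translate t \<Lambda>)"
  unfolding legal_tiling_def using translate_tiling_of by metis

lemma legal_tiling_through:
  assumes "legal_tiling \<rho> \<Lambda>" "p \<in> \<Lambda> i"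
  obtains w where "\<Lambda> = tiling_of p w" "legal_sequence \<rho> w"
proof -
  obtain x w where xw: "\<Lambda> = tiling_of x w" "legal_sequence \<rho> w"
    using assms(1) by (auto simp: legal_tiling_def)
  then obtain n where n: "p = x + of_int n" using assms(2) by (auto simp: tiling_of_def)
  have "\<Lambda> = tiling_of p (\<lambda>j. w (j + n))"
    unfolding n tiling_of_shift by (simp add: xw(1))
  then show thesis using that legal_sequence_shift[OF xw(2)] by blast
qed

lemma legal_tiling_unit_offset:
  assumes "legal_tiling \<rho> \<Lambda>"
  obtains x w where "0 \<le> x" "x < 1" "\<Lambda> = tiling_of x w" "legal_sequence \<rho> w"
proof -
  obtain x w where xw: "\<Lambda> = tiling_of x w" "legal_sequence \<rho> w"
    using assms by (auto simp: legal_tiling_def)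
  have "x + of_int (- \<lfloor>x\<rfloor>) \<in> \<Lambda> (w (- \<lfloor>x\<rfloor>))"
    unfolding xw(1) mem_tiling_of by simp
  from legal_tiling_through[OF assms this] obtain w' where
    "\<Lambda> = tiling_of (x + of_int (- \<lfloor>x\<rfloor>)) w'" "legal_sequence \<rho> w'" .
  moreover have "0 \<le> x + of_int (- \<lfloor>x\<rfloor>)" "x + of_int (- \<lfloor>x\<rfloor>) < 1"
    by (simp_all add: floor_less_iff) linarith
  ultimately show thesis using that by blast
qed

text \<open>
  One vertex \<open>p\<close> near the origin fixes the lattice \<open>p + \<int>\<close> of all approximating tilings.  The letter at
  each lattice point is then the same in all approximations that reach it.
\<close>

lemma legal_tiling_of_local_limits:
  assumes "\<And>R. R > 0 \<Longrightarrow> \<exists>\<Lambda>'. legal_tiling \<rho> \<Lambda>' \<and> (\<forall>i y. \<bar>y\<bar> < R \<longrightarrow> (y \<in> \<Lambda> i \<longleftrightarrow> y \<in> \<Lambda>' i))"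
  shows "legal_tiling \<rho> \<Lambda>"
proof -
  obtain \<Lambda>' where leg: "legal_tiling \<rho> \<Lambda>'" and agree: "\<And>i y. \<bar>y\<bar> < 2 \<Longrightarrow> y \<in> \<Lambda> i \<longleftrightarrow> y \<in> \<Lambda>' i"
    using assms[of 2] by auto
  obtain p w0 where p: "0 \<le> p" "p < 1" "\<Lambda>' = tiling_of p w0"
    using legal_tiling_unit_offset[OF leg] by blast
  have pL: "p \<in> \<Lambda> (w0 0)"
    using agree[of p "w0 0"] p mem_tiling_of[of p 0 w0] by simp
  have "\<exists>w. legal_sequence \<rho> w \<and> (\<forall>i y. \<bar>y\<bar> < R \<longrightarrow> (y \<in> \<Lambda> i \<longleftrightarrow> y \<in> tiling_of p w i))" if "R \<ge> 2" for R
  proof -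
    obtain \<Lambda>' where *: "legal_tiling \<rho> \<Lambda>'" "\<And>i y. \<bar>y\<bar> < R \<Longrightarrow> y \<in> \<Lambda> i \<longleftrightarrow> y \<in> \<Lambda>' i"
      using assms[of R] \<open>R \<ge> 2\<close> by auto
    have "p \<in> \<Lambda>' (w0 0)" using *(2)[of p] pL p \<open>R \<ge> 2\<close> by simp
    from legal_tiling_through[OF *(1) this] show ?thesis using *(2) by metis
  qed
  then obtain W where W: "\<And>R. R \<ge> 2 \<Longrightarrow> legal_sequence \<rho> (W R)"
    "\<And>R i y. R \<ge> 2 \<Longrightarrow> \<bar>y\<bar> < R \<Longrightarrow> y \<in> \<Lambda> i \<longleftrightarrow> y \<in> tiling_of p (W R) i"
    by metis
  have W_iff: "W R n = i \<longleftrightarrow> p + of_int n \<in> \<Lambda> i" if "R \<ge> 2" "\<bar>p + of_int n\<bar> < R" for R n i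
    using W(2)[OF that] mem_tiling_of by metis
  \<comment> \<open>The radius is just large enough for the approximation to reach the point \<open>p + n\<close>.\<close>
  define w where "w n = W (\<bar>p + of_int n\<bar> + 2) n" for n
  have w_iff: "w n = i \<longleftrightarrow> p + of_int n \<in> \<Lambda> i" for n i
    unfolding w_def by (rule W_iff) auto
  have "\<Lambda> = tiling_of p w"
  proof (intro ext set_eqI iffI)
    fix i y assume "y \<in> \<Lambda> i"
    then have "y \<in> tiling_of p (W (\<bar>y\<bar> + 2)) i" using W(2)[of "\<bar>y\<bar> + 2" y i] by simp
    then obtain n where "y = p + of_int n" by (auto simp: tiling_of_def)
    then show "y \<in> tiling_of p w i" using \<open>y \<in> \<Lambda> i\<close> by (simp add: mem_tiling_of w_iff)
  next
    fix i y assume "y \<in> tiling_of p w i"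
    then obtain n where "y = p + of_int n" "w n = i" by (auto simp: tiling_of_def)
    then show "y \<in> \<Lambda> i" using w_iff by simp
  qed
  moreover have "legal_sequence \<rho> w"
    unfolding legal_sequence_def
  proof (intro allI)
    fix m n
    define R where "R = \<bar>real_of_int m\<bar> + \<bar>real_of_int n\<bar> + 3"
    have "map w [m..n] = map (W R) [m..n]"
    proof (intro map_cong refl)
      fix j assume "j \<in> set [m..n]"
      then have "\<bar>real_of_int j\<bar> \<le> \<bar>real_of_int m\<bar> + \<bar>real_of_int n\<bar>" by auto
      then have "\<bar>p + of_int j\<bar> < R" using p by (simp add: R_def)
      then have "W R j = i \<longleftrightarrow> w j = i" for i
        using W_iff[of R j i] w_iff[of j i] by (simp add: R_def)
      then show "w j = W R j" by blast
    qed
    then show "legal_word \<rho> (map w [m..n])"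
      using W(1)[of R] by (simp only: legal_sequence_def) (simp add: R_def)
  qed
  ultimately show ?thesis unfolding legal_tiling_def by blast
qed

text \<open>
  Legality is preserved by translations and by local limits, so the legal tilings form a closed set that
  contains the orbit of the fixed point.
\<close>

theorem hull_legal_tiling:
  assumes "is_hull L \<rho> Y" "\<Lambda> \<in> Y"
  shows "legal_tiling \<rho> \<Lambda>"
proof -
  obtain \<Lambda>0 where "inflation_fixed_point L \<rho> \<Lambda>0" and Y: "Y = hull_of_tiling \<Lambda>0"
    using assms(1) by (auto simp: is_hull_def)
  then have \<Lambda>0: "legal_tiling \<rho> \<Lambda>0"
    unfolding inflation_fixed_point_def legal_tiling_def legal_sequence_def by blast
  have "closedin local_topology (Collect (legal_tiling \<rho>))"
    unfolding closedin_def openin_local_topology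
  proof (intro conjI ballI subsetI)
    have "openin local_topology UNIV"
      unfolding openin_local_topology by (auto intro: exI[of _ 1])
    then show "\<Lambda> \<in> topspace local_topology" for \<Lambda> :: "'a tiling"
      using openin_subset by blast
    fix \<Lambda> assume "\<Lambda> \<in> topspace local_topology - Collect (legal_tiling \<rho>)"
    then have not: "\<not> legal_tiling \<rho> \<Lambda>" by simp
    show "\<exists>\<epsilon>>0. local_ball \<epsilon> \<Lambda> \<subseteq> topspace local_topology - Collect (legal_tiling \<rho>)"
    proof (rule ccontr)
      assume "\<not> ?thesis"
      with \<open>\<And>\<Lambda>. \<Lambda> \<in> topspace local_topology\<close>
      have ball: "\<exists>\<Lambda>'\<in>local_ball \<epsilon> \<Lambda>. legal_tiling \<rho> \<Lambda>'" if "\<epsilon> > 0" for \<epsilon>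
        using that by blast
      have "legal_tiling \<rho> \<Lambda>"
      proof (rule legal_tiling_of_local_limits)
        fix R :: real assume "R > 0"
        define \<epsilon> where "\<epsilon> = 1 / (R + 1)"
        have \<epsilon>: "\<epsilon> > 0" "\<epsilon> < 1" "1 / \<epsilon> = R + 1" using \<open>R > 0\<close> by (auto simp: \<epsilon>_def)
        obtain \<Lambda>' s where *: "legal_tiling \<rho> \<Lambda>'" "\<bar>s\<bar> < \<epsilon>"
          "\<And>i. \<Lambda>' i \<inter> ball 0 (R + 1) = translate s \<Lambda> i \<inter> ball 0 (R + 1)"
          using ball[OF \<epsilon>(1)] unfolding local_ball_def \<epsilon>(3) by blast
        have "y \<in> \<Lambda> i \<longleftrightarrow> y \<in> translate (- s) \<Lambda>' i" if "\<bar>y\<bar> < R" for y i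
        proof -
          have "y + s \<in> ball 0 (R + 1)" using that *(2) \<epsilon>(2) by (simp add: dist_real_def)
          then have "y + s \<in> \<Lambda>' i \<longleftrightarrow> y + s \<in> translate s \<Lambda> i" using *(3)[of i] by blast
          then show ?thesis by (auto simp: translate_def image_iff algebra_simps)
        qed
        then show "\<exists>\<Lambda>'. legal_tiling \<rho> \<Lambda>' \<and> (\<forall>i y. \<bar>y\<bar> < R \<longrightarrow> (y \<in> \<Lambda> i \<longleftrightarrow> y \<in> \<Lambda>' i))"
          using legal_tiling_translate[OF *(1)] by blast
      qed
      with not show False ..
    qed
  qed
  moreover have "range (\<lambda>t. translate t \<Lambda>0) \<subseteq> Collect (legal_tiling \<rho>)"
    using legal_tiling_translate[OF \<Lambda>0] by auto
  ultimately have "Y \<subseteq> Collect (legal_tiling \<rho>)"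
    unfolding Y hull_of_tiling_def by (intro closure_of_minimal)
  with assms(2) show ?thesis by blast
qed

section \<open>Energy of block codes\<close>

text \<open>
  A legal word that is longer than a supertile of level \<open>N\<close> occurs in a supertile of higher level, which is a
  concatenation of supertiles of level \<open>N\<close>.
\<close>

lemma legal_word_desubstitute:
  assumes "\<And>a. length (\<rho> a) = L" "L \<ge> 2" "legal_word \<rho> b" "length b > L ^ N"
  obtains v s where "legal_word \<rho> v" "s + length b \<le> L ^ N * length v"
    "\<And>q. q < length b \<Longrightarrow> b ! q = (substitute_word \<rho> ^^ N) v ! (s + q)"
proof -
  obtain n a pre post where dec: "(substitute_word \<rho> ^^ n) [a] = pre @ b @ post"
    using assms(3) unfolding legal_word_def sublist_def by blast
  have "L ^ n = length pre + length b + length post"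
    using arg_cong[OF dec, of length] length_substitute_word_iterate[of \<rho> L n "[a]"] assms(1) by simp
  then have "L ^ N < L ^ n" using assms(4) by simp
  then have "N < n" using assms(2) by (metis not_le power_increasing le_trans one_le_numeral)
  define v where "v = (substitute_word \<rho> ^^ (n - N)) [a]"
  have dec': "(substitute_word \<rho> ^^ N) v = pre @ b @ post"
    using dec \<open>N < n\<close> funpow_add[of N "n - N" "substitute_word \<rho>"] by (simp add: v_def)
  show thesis
  proof (rule that[of v "length pre"])
    show "legal_word \<rho> v" unfolding legal_word_def v_def by blast
    show "length pre + length b \<le> L ^ N * length v"
      using arg_cong[OF dec', of length] length_substitute_word_iterate[of \<rho> L N v] assms(1) by simp
    show "b ! q = (substitute_word \<rho> ^^ N) v ! (length pre + q)" if "q < length b" for q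
      using that by (simp add: dec' nth_append)
  qed
qed

definition block_code :: "(int \<Rightarrow> 'a) \<Rightarrow> nat \<Rightarrow> (int \<Rightarrow> 'b) \<Rightarrow> bool" where
  "block_code w r G \<longleftrightarrow> (\<forall>j j'. (\<forall>i. \<bar>i\<bar> \<le> int r \<longrightarrow> w (j + i) = w (j' + i)) \<longrightarrow> G j = G j')"

context abelian_columns
begin

text \<open>
  Sampled with step \<open>L\<^sup>N\<close>, the positions \<open>t + q L\<^sup>N\<close> have a common offset in their supertiles of level \<open>N\<close>.
  If the window of radius \<open>r\<close> around that offset stays inside the supertile, \<open>G\<close> is a function of the supertile type, and
  the types form a legal word.  This fails for at most \<open>2 r\<close> of the \<open>L\<^sup>N\<close> offsets, where the trivial bound
  is used.
\<close>

lemma energy_block_code_le: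
  assumes damp: "\<And>b u K. legal_word \<rho> b \<Longrightarrow> (\<And>a. cmod (u a) \<le> K) \<Longrightarrow>
       energy D (\<lambda>q. u (b ! q)) {..<length b} \<le> K\<^sup>2 * (\<beta> * real (length b) + \<eta>)"
    and D: "multiplier D" and nonneg: "\<beta> \<ge> 0" "\<eta> \<ge> 0"
    and w: "legal_sequence \<rho> w" and G: "block_code w r G" "\<And>j. cmod (G j) \<le> K"
  shows "(\<Sum>t<L ^ N. energy D (\<lambda>q. G (int t + int q * int (L ^ N))) {..<R})
     \<le> real (L ^ N) * (K\<^sup>2 * (\<beta> * real R + \<eta>)) + 2 * real r * (real R * K\<^sup>2)"
proof (cases "R = 0")
  case True
  then show ?thesis using nonneg by (simp add: energy_def)
next
  case False
  define H where "H = L ^ N"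
  have H: "H > 0" by (simp add: H_def)
  \<comment> \<open>All sampled positions, for every offset, together with their windows of radius \<open>r\<close>.\<close>
  define b where "b = map w [- int r..int ((R + 1) * H + r)]"
  have "int ((R + 1) * H + r) - (- int r) + 1 = int ((R + 1) * H + 2 * r + 1)" by simp
  then have lenb: "length b = (R + 1) * H + 2 * r + 1"
    by (simp only: b_def length_map length_upto nat_int)
  have "legal_word \<rho> b" using w by (simp add: b_def legal_sequence_def)
  moreover have "length b > L ^ N" by (simp add: lenb H_def)
  ultimately obtain v s where v: "legal_word \<rho> v" "s + length b \<le> L ^ N * length v"
    "\<And>q. q < length b \<Longrightarrow> b ! q = (substitute_word \<rho> ^^ N) v ! (s + q)"
    using legal_word_desubstitute[of \<rho> L b N] length_rho L_ge_2 by blast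
  define s' where "s' = s + r"
  have letters: "w (int t + int q * int H + i)
      = (substitute_word \<rho> ^^ N) [v ! ((s' + t) div H + q)] ! nat (int ((s' + t) mod H) + i)"
    if t: "t < H" and q: "q < R" and m: "r \<le> (s' + t) mod H" "(s' + t) mod H + r < H"
      and i: "\<bar>i\<bar> \<le> int r" for t q i
  proof -
    define p where "p = nat (int t + int q * int H + i + int r)"
    have p: "int p = int t + int q * int H + i + int r"
    proof -
      have "0 \<le> int t + int q * int H" by simp
      then show ?thesis using i unfolding p_def by linarith
    qed
    have "t + q * H < (q + 1) * H" using t by simp
    also have "\<dots> \<le> R * H" using q by (intro mult_le_mono1) simp
    finally have "t + q * H < R * H" .
    then have "int t + int q * int H < int R * int H" by (metis of_nat_add of_nat_less_iff of_nat_mult)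
    then have "int p < int (length b)" using i p lenb by simp
    then have pb: "p < length b" by simp
    then have "b ! p = w (- int r + int p)" by (simp add: b_def)
    then have "w (int t + int q * int H + i) = (substitute_word \<rho> ^^ N) v ! (s + p)"
      using v(3)[OF pb] p by simp
    also have "\<dots> = (substitute_word \<rho> ^^ N) [v ! ((s + p) div H)] ! ((s + p) mod H)"
      using nth_substitute_word_iterate[of \<rho> L "s + p" N v] length_rho v(2) pb by (simp add: H_def)
    also have "s + p = ((s' + t) div H + q) * H + nat (int ((s' + t) mod H) + i)"
    proof -
      have "int (s' + t) = int ((s' + t) div H) * int H + int ((s' + t) mod H)"
        by (metis div_mult_mod_eq of_nat_add of_nat_mult)
      then have "int (s + p) = int (((s' + t) div H + q) * H + nat (int ((s' + t) mod H) + i))"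
        using m i p by (simp add: s'_def algebra_simps)
      then show ?thesis by (simp only: of_nat_eq_iff)
    qed
    also have "(((s' + t) div H + q) * H + nat (int ((s' + t) mod H) + i)) div H = (s' + t) div H + q"
      using m i H by (subst div_mult_self3) auto
    also have "(((s' + t) div H + q) * H + nat (int ((s' + t) mod H) + i)) mod H = nat (int ((s' + t) mod H) + i)"
      using m i H by (subst mod_mult_self3) auto
    finally show ?thesis .
  qed
  define E where "E t = energy D (\<lambda>q. G (int t + int q * int H)) {..<R}" for t
  have good: "E t \<le> K\<^sup>2 * (\<beta> * real R + \<eta>)"
    if t: "t < H" and m: "r \<le> (s' + t) mod H" "(s' + t) mod H + r < H" for t
  proof -
    define q0 where "q0 = (s' + t) div H"
    \<comment> \<open>The value of \<open>G\<close> at any sampled supertile of type \<open>a\<close>; types that do not occur get the value zero.\<close>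
    define u where "u a = (if \<exists>q<R. v ! (q0 + q) = a then G (int t + int (SOME q. q < R \<and> v ! (q0 + q) = a) * int H) else 0)" for a
    have u: "u (v ! (q0 + q)) = G (int t + int q * int H)" if q: "q < R" for q
    proof -
      define q' where "q' = (SOME q'. q' < R \<and> v ! (q0 + q') = v ! (q0 + q))"
      have q': "q' < R \<and> v ! (q0 + q') = v ! (q0 + q)"
        unfolding q'_def by (rule someI[of _ q]) (use q in simp)
      have "G (int t + int q' * int H) = G (int t + int q * int H)"
        using G(1) letters[OF t _ m] q' q unfolding block_code_def q0_def by (metis (no_types, lifting))
      then show ?thesis using q by (auto simp: u_def q'_def)
    qed
    have "K \<ge> 0" using G(2)[of 0] norm_ge_zero order_trans by blast
    then have uK: "cmod (u a) \<le> K" for a using G(2) by (simp add: u_def)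
    define b' where "b' = take R (drop q0 v)"
    have "q0 + R \<le> length v"
    proof -
      have "(q0 + R) * H \<le> s' + t + R * H" by (simp add: q0_def add_mult_distrib)
      also have "\<dots> < s + length b" using t by (simp add: s'_def lenb)
      also have "\<dots> \<le> length v * H" using v(2) by (simp add: H_def mult.commute)
      finally show ?thesis using H by simp
    qed
    then have b': "length b' = R" "\<And>q. q < R \<Longrightarrow> b' ! q = v ! (q0 + q)" by (auto simp: b'_def)
    have "legal_word \<rho> b'"
      using v(1) by (rule legal_word_sublist)
        (auto simp: b'_def intro: sublist_order.order_trans[OF sublist_take sublist_drop])
    from damp[OF this uK] have "energy D (\<lambda>q. u (b' ! q)) {..<R} \<le> K\<^sup>2 * (\<beta> * real R + \<eta>)"
      by (simp add: b')
    moreover have "energy D (\<lambda>q. u (b' ! q)) {..<R} = E t"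
    proof -
      have "(\<Sum>q<R. u (b' ! q) * ee (real q * k)) = (\<Sum>q<R. G (int t + int q * int H) * ee (real q * k))" for k
        by (intro sum.cong refl) (simp add: b' u)
      then show ?thesis by (simp add: E_def energy_def)
    qed
    ultimately show ?thesis by simp
  qed
  have bad: "E t \<le> real R * K\<^sup>2" for t
    unfolding E_def using energy_le_card[OF D finite_lessThan, of R "\<lambda>q. G (int t + int q * int H)" K] G(2) by simp
  define B where "B = {t. t < H \<and> \<not> (r \<le> (s' + t) mod H \<and> (s' + t) mod H + r < H)}"
  have B: "B \<subseteq> {..<H}" "finite B" by (auto simp: B_def)
  have "card B \<le> 2 * r"
  proof -
    have inj: "inj_on (\<lambda>t. (s' + t) mod H) {..<H}"
    proof (rule linorder_inj_onI)
      fix x y assume *: "x < y" "x \<in> {..<H}" "y \<in> {..<H}"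
      show "(s' + x) mod H \<noteq> (s' + y) mod H"
      proof
        assume "(s' + x) mod H = (s' + y) mod H"
        then have "H dvd (s' + y) - (s' + x)"
          using * by (metis mod_eq_dvd_iff_nat add_le_cancel_left less_imp_le)
        then show False using * by (auto dest: dvd_imp_le)
      qed
    qed auto
    have "card B = card ((\<lambda>t. (s' + t) mod H) ` B)"
      by (rule card_image[symmetric]) (rule inj_on_subset[OF inj B(1)])
    also have "\<dots> \<le> card ({..<r} \<union> {H - r..<H})"
      using H by (intro card_mono) (auto simp: B_def)
    also have "\<dots> \<le> card {..<r} + card {H - r..<H}" by (rule card_Un_le)
    also have "\<dots> \<le> 2 * r" by simp
    finally show ?thesis .
  qed
  have "(\<Sum>t<H. E t) \<le> (\<Sum>t<H. K\<^sup>2 * (\<beta> * real R + \<eta>) + (if t \<in> B then real R * K\<^sup>2 else 0))"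
  proof (intro sum_mono)
    fix t assume "t \<in> {..<H}"
    then show "E t \<le> K\<^sup>2 * (\<beta> * real R + \<eta>) + (if t \<in> B then real R * K\<^sup>2 else 0)"
      using good[of t] bad[of t] nonneg by (auto simp: B_def intro: order_trans[OF bad])
  qed
  also have "\<dots> = real H * (K\<^sup>2 * (\<beta> * real R + \<eta>)) + real (card B) * (real R * K\<^sup>2)"
    using B by (simp add: sum.distrib sum.If_cases Int_absorb1)
  also have "real (card B) * (real R * K\<^sup>2) \<le> 2 * real r * (real R * K\<^sup>2)"
    using \<open>card B \<le> 2 * r\<close> by (intro mult_right_mono) auto
  finally show ?thesis by (simp add: E_def H_def)
qed

end

section \<open>Approximation by functions of finite range\<close>

definition agree_within :: "real \<Rightarrow> 'a tiling \<Rightarrow> 'a tiling \<Rightarrow> bool" where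
  "agree_within r \<Lambda> \<Lambda>' \<longleftrightarrow> (\<forall>i y. \<bar>y\<bar> \<le> r \<longrightarrow> (y \<in> \<Lambda> i \<longleftrightarrow> y \<in> \<Lambda>' i))"

definition local_function :: "'a tiling set \<Rightarrow> real \<Rightarrow> ('a tiling \<Rightarrow> 'b) \<Rightarrow> bool" where
  "local_function Y r f \<longleftrightarrow> (\<forall>\<Lambda>\<in>Y. \<forall>\<Lambda>'\<in>Y. agree_within r \<Lambda> \<Lambda>' \<longrightarrow> f \<Lambda> = f \<Lambda>')"

lemma local_function_mono: "local_function Y r f \<Longrightarrow> r \<le> r' \<Longrightarrow> local_function Y r' f"
  unfolding local_function_def agree_within_def by (meson order_trans)

lemma local_function_common:
  assumes "local_function Y r f" "local_function Y r' g"
  shows "local_function Y (max r r') (\<lambda>\<Lambda>. h (f \<Lambda>) (g \<Lambda>))"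
proof -
  have "local_function Y (max r r') f" "local_function Y (max r r') g"
    using assms by (auto intro: local_function_mono)
  then have *: "f \<Lambda> = f \<Lambda>'" "g \<Lambda> = g \<Lambda>'"
    if "\<Lambda> \<in> Y" "\<Lambda>' \<in> Y" "agree_within (max r r') \<Lambda> \<Lambda>'" for \<Lambda> \<Lambda>'
    using that unfolding local_function_def by blast+
  show ?thesis unfolding local_function_def
  proof (intro ballI impI)
    fix \<Lambda> \<Lambda>' assume "\<Lambda> \<in> Y" "\<Lambda>' \<in> Y" "agree_within (max r r') \<Lambda> \<Lambda>'"
    from *[OF this] show "h (f \<Lambda>) (g \<Lambda>) = h (f \<Lambda>') (g \<Lambda>')" by simp
  qed
qed

text \<open>
  Leaving an open interval for the position of the patch makes these sets open, and they are still determined by a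
  bounded part of the tiling.
\<close>

definition cylinder :: "real \<Rightarrow> real \<Rightarrow> nat \<Rightarrow> 'a list \<Rightarrow> 'a tiling set" where
  "cylinder \<alpha> \<beta> m u = {\<Lambda>. \<exists>s. \<alpha> < s \<and> s < \<beta> \<and> (\<forall>j<length u. s + real j - real m \<in> \<Lambda> (u ! j))}"

lemma openin_cylinder: "openin local_topology (cylinder \<alpha> \<beta> m u)"
  unfolding openin_local_topology
proof
  fix \<Lambda> assume "\<Lambda> \<in> cylinder \<alpha> \<beta> m u"
  then obtain s where s: "\<alpha> < s" "s < \<beta>" "\<And>j. j < length u \<Longrightarrow> s + real j - real m \<in> \<Lambda> (u ! j)"
    by (auto simp: cylinder_def)
  define T where "T = \<bar>s\<bar> + real (length u) + real m + 2"
  \<comment> \<open>The first two terms keep a shifted position between \<open>\<alpha>\<close> and \<open>\<beta>\<close>; the last keeps the patch inside the ball.\<close>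
  define \<epsilon> where "\<epsilon> = min (min (s - \<alpha>) (\<beta> - s)) (1 / T)"
  have T: "T \<ge> 2" by (simp add: T_def)
  have \<epsilon>: "\<epsilon> > 0" "\<epsilon> \<le> s - \<alpha>" "\<epsilon> \<le> \<beta> - s" "\<epsilon> \<le> 1 / T" using s T by (auto simp: \<epsilon>_def)
  then have "1 / \<epsilon> \<ge> T" using T by (simp add: field_simps)
  have "1 / T \<le> 1" using T by simp
  then have "\<epsilon> \<le> 1" using \<epsilon>(4) by linarith
  have "local_ball \<epsilon> \<Lambda> \<subseteq> cylinder \<alpha> \<beta> m u"
  proof
    fix \<Lambda>' assume "\<Lambda>' \<in> local_ball \<epsilon> \<Lambda>"
    then obtain t where t: "\<bar>t\<bar> < \<epsilon>" "\<And>i. \<Lambda>' i \<inter> ball 0 (1 / \<epsilon>) = translate t \<Lambda> i \<inter> ball 0 (1 / \<epsilon>)"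
      by (auto simp: local_ball_def)
    have "s + t + real j - real m \<in> \<Lambda>' (u ! j)" if "j < length u" for j
    proof -
      have "\<bar>s + t + real j - real m\<bar> < T" using t(1) \<open>\<epsilon> \<le> 1\<close> that by (auto simp: T_def abs_le_iff)
      then have "s + t + real j - real m \<in> ball 0 (1 / \<epsilon>)" using \<open>1 / \<epsilon> \<ge> T\<close> by (simp add: dist_real_def)
      moreover have "s + t + real j - real m \<in> translate t \<Lambda> (u ! j)"
        using s(3)[OF that] unfolding translate_def
        by (intro image_eqI[of _ _ "s + real j - real m"]) simp_all
      ultimately show ?thesis using t(2)[of "u ! j"] by blast
    qed
    moreover have "\<alpha> < s + t" "s + t < \<beta>" using t(1) \<epsilon> by auto
    ultimately show "\<Lambda>' \<in> cylinder \<alpha> \<beta> m u" unfolding cylinder_def by blast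
  qed
  with \<epsilon>(1) show "\<exists>\<epsilon>>0. local_ball \<epsilon> \<Lambda> \<subseteq> cylinder \<alpha> \<beta> m u" by blast
qed

lemma local_function_cylinder:
  "local_function Y (\<bar>\<alpha>\<bar> + \<bar>\<beta>\<bar> + real m + real (length u)) (\<lambda>\<Lambda>. \<Lambda> \<in> cylinder \<alpha> \<beta> m u)"
proof -
  let ?r = "\<bar>\<alpha>\<bar> + \<bar>\<beta>\<bar> + real m + real (length u)"
  have "\<Lambda>' \<in> cylinder \<alpha> \<beta> m u" if agree: "agree_within ?r \<Lambda> \<Lambda>'" and mem: "\<Lambda> \<in> cylinder \<alpha> \<beta> m u" for \<Lambda> \<Lambda>'
  proof -
    obtain s where s: "\<alpha> < s" "s < \<beta>" "\<And>j. j < length u \<Longrightarrow> s + real j - real m \<in> \<Lambda> (u ! j)"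
      using mem by (auto simp: cylinder_def)
    have "s + real j - real m \<in> \<Lambda>' (u ! j)" if "j < length u" for j
    proof -
      have "\<bar>s + real j - real m\<bar> \<le> ?r" using s(1,2) that by (auto simp: abs_le_iff)
      then show ?thesis using s(3)[OF that] agree by (simp add: agree_within_def)
    qed
    with s show ?thesis by (auto simp: cylinder_def)
  qed
  moreover have "agree_within ?r \<Lambda>' \<Lambda>" if "agree_within ?r \<Lambda> \<Lambda>'" for \<Lambda> \<Lambda>' :: "'a tiling"
    using that by (simp add: agree_within_def)
  ultimately show ?thesis unfolding local_function_def by blast
qed

text \<open>
  The word is taken long enough to fill the interval on which a tiling in the local ball has to agree, and the
  interval of positions short enough for the allowed shift.
\<close>

lemma cylinder_neighbourhood:
  assumes Y: "\<And>\<Lambda>. \<Lambda> \<in> Y \<Longrightarrow> legal_tiling \<rho> \<Lambda>"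
    and U: "openin (subtopology local_topology Y) U" and "\<Lambda> \<in> U"
  obtains \<alpha> \<beta> m u where "\<alpha> \<in> \<rat>" "\<beta> \<in> \<rat>" "\<Lambda> \<in> cylinder \<alpha> \<beta> m u" "cylinder \<alpha> \<beta> m u \<inter> Y \<subseteq> U"
proof -
  obtain T where T: "openin local_topology T" "U = T \<inter> Y"
    using U by (auto simp: openin_subtopology)
  obtain \<epsilon>0 where \<epsilon>0: "\<epsilon>0 > 0" "local_ball \<epsilon>0 \<Lambda> \<subseteq> T"
    using T \<open>\<Lambda> \<in> U\<close> unfolding openin_local_topology by blast
  define \<epsilon> where "\<epsilon> = min \<epsilon>0 1"
  have \<epsilon>: "\<epsilon> > 0" "\<epsilon> \<le> 1" using \<epsilon>0 by (auto simp: \<epsilon>_def)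
  have ball: "local_ball \<epsilon> \<Lambda> \<subseteq> T"
    using local_ball_mono[of \<epsilon> \<epsilon>0 \<Lambda>] \<epsilon>0 \<epsilon> by (auto simp: \<epsilon>_def)
  obtain x w where x: "0 \<le> x" "x < 1" "\<Lambda> = tiling_of x w"
  proof -
    have "\<Lambda> \<in> Y" using T(2) \<open>\<Lambda> \<in> U\<close> by blast
    from legal_tiling_unit_offset[OF Y[OF this]] that show thesis by blast
  qed
  obtain \<alpha> where \<alpha>: "\<alpha> \<in> \<rat>" "x - \<epsilon> < \<alpha>" "\<alpha> < x" using Rats_dense_in_real[of "x - \<epsilon>" x] \<epsilon> by auto
  obtain \<beta> where \<beta>: "\<beta> \<in> \<rat>" "x < \<beta>" "\<beta> < x + \<epsilon>" using Rats_dense_in_real[of x "x + \<epsilon>"] \<epsilon> by auto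
  define m where "m = nat \<lceil>1 / \<epsilon>\<rceil> + 2"
  have m: "real m \<ge> 1 / \<epsilon> + 2" unfolding m_def by (simp add: real_nat_ceiling_ge)
  define u where "u = map (\<lambda>j. w (int j - int m)) [0..<2 * m + 1]"
  have len: "length u = 2 * m + 1" and nth: "\<And>j. j < 2 * m + 1 \<Longrightarrow> u ! j = w (int j - int m)"
    unfolding u_def by (simp_all del: upt_Suc)
  have pos: "s + real j - real m = s + of_int (int j - int m)" for s j by simp
  show thesis
  proof (rule that[OF \<alpha>(1) \<beta>(1)])
    show "\<Lambda> \<in> cylinder \<alpha> \<beta> m u"
    proof -
      have "x + real j - real m \<in> \<Lambda> (u ! j)" if "j < length u" for j
        using that unfolding x(3) pos mem_tiling_of by (simp add: len nth)
      then show ?thesis using \<alpha> \<beta> by (auto simp: cylinder_def)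
    qed
    show "cylinder \<alpha> \<beta> m u \<inter> Y \<subseteq> U"
    proof
      fix \<Lambda>' assume "\<Lambda>' \<in> cylinder \<alpha> \<beta> m u \<inter> Y"
      then obtain s where s: "\<alpha> < s" "s < \<beta>" "\<And>j. j < length u \<Longrightarrow> s + real j - real m \<in> \<Lambda>' (u ! j)"
        and "\<Lambda>' \<in> Y" by (auto simp: cylinder_def)
      have "s \<in> \<Lambda>' (w 0)" using s(3)[of m] by (simp add: len nth)
      then obtain w' where w': "\<Lambda>' = tiling_of s w'"
        using legal_tiling_through[OF Y[OF \<open>\<Lambda>' \<in> Y\<close>], of s "w 0"] by blast
      have ww: "w' n = w n" if "\<bar>n\<bar> \<le> int m" for n
      proof -
        define j where "j = nat (n + int m)"
        have j: "int j = n + int m" "j < 2 * m + 1" using that by (auto simp: j_def)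
        show ?thesis using s(3)[of j] j(2) unfolding pos w' mem_tiling_of by (simp add: len nth j(1))
      qed
      have near: "\<bar>n\<bar> \<le> int m" if "s + of_int n \<in> ball 0 (1 / \<epsilon>)" for n
      proof -
        have "\<bar>s\<bar> < 2" using s x \<alpha> \<beta> \<epsilon> by auto
        moreover have "\<bar>s + of_int n\<bar> < 1 / \<epsilon>" using that by (simp add: dist_real_def)
        ultimately have "\<bar>real_of_int n\<bar> \<le> real m" using m by linarith
        then show ?thesis by linarith
      qed
      have "\<Lambda>' i \<inter> ball 0 (1 / \<epsilon>) = translate (s - x) \<Lambda> i \<inter> ball 0 (1 / \<epsilon>)" for i
        unfolding w' x(3) translate_tiling_of using ww near by (auto simp: tiling_of_def)
      moreover have "\<bar>s - x\<bar> < \<epsilon>" using s \<alpha> \<beta> by auto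
      ultimately have "\<Lambda>' \<in> local_ball \<epsilon> \<Lambda>" unfolding local_ball_def by blast
      then show "\<Lambda>' \<in> U" using ball T(2) \<open>\<Lambda>' \<in> Y\<close> by blast
    qed
  qed
qed

locale invariant_system =
  fixes \<rho> :: "'a::finite substitution" and Y :: "'a tiling set" and \<mu> :: "'a tiling measure"
  assumes legal: "\<And>\<Lambda>. \<Lambda> \<in> Y \<Longrightarrow> legal_tiling \<rho> \<Lambda>"
    and invariant: "invariant_probability Y \<mu>"
begin

lemma sets_mu: "sets \<mu> = sigma_sets Y {U. openin (subtopology local_topology Y) U}"
  and space_mu [simp]: "space \<mu> = Y"
proof -
  have "{U. openin (subtopology local_topology Y) U} \<subseteq> Pow Y"
    using openin_subset by fastforce
  then have *: "sets (hull_borel Y) = sigma_sets Y {U. openin (subtopology local_topology Y) U}"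
    "space (hull_borel Y) = Y"
    unfolding hull_borel_def by (simp_all add: sets_measure_of space_measure_of)
  have "sets \<mu> = sets (hull_borel Y)" using invariant by (simp add: invariant_probability_def)
  then show "sets \<mu> = sigma_sets Y {U. openin (subtopology local_topology Y) U}" "space \<mu> = Y"
    using * sets_eq_imp_space_eq by metis+
qed

sublocale prob_space \<mu>
  using invariant by (simp add: invariant_probability_def)

lemma measurable_translate [measurable]: "translate t \<in> measurable \<mu> \<mu>"
  and distr_translate: "distr \<mu> \<mu> (translate t) = \<mu>"
  using invariant by (simp_all add: invariant_probability_def)

lemma translate_in_Y: "\<Lambda> \<in> Y \<Longrightarrow> translate t \<Lambda> \<in> Y"
  using measurable_space[OF measurable_translate] by simp

text \<open>
  Complements and countable unions inherit this property, and the cylinders have it trivially.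
\<close>

definition locally_approximable :: "'a tiling set \<Rightarrow> bool" where
  "locally_approximable A \<longleftrightarrow> A \<in> sets \<mu> \<and>
     (\<forall>\<epsilon>>0. \<exists>A' r. A' \<in> sets \<mu> \<and> local_function Y r (\<lambda>\<Lambda>. \<Lambda> \<in> A') \<and> prob ((A - A') \<union> (A' - A)) < \<epsilon>)"

lemma locally_approximableE:
  assumes "locally_approximable A" "\<epsilon> > 0"
  obtains A' r where "A' \<in> sets \<mu>" "local_function Y r (\<lambda>\<Lambda>. \<Lambda> \<in> A')" "prob ((A - A') \<union> (A' - A)) < \<epsilon>"
  using assms unfolding locally_approximable_def by blast

lemma locally_approximable_local:
  assumes "A \<in> sets \<mu>" "local_function Y r (\<lambda>\<Lambda>. \<Lambda> \<in> A)"
  shows "locally_approximable A"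
  unfolding locally_approximable_def using assms by (auto intro!: exI[of _ A])

lemma locally_approximable_Un:
  assumes "locally_approximable A" "locally_approximable B"
  shows "locally_approximable (A \<union> B)"
  unfolding locally_approximable_def
proof (intro conjI allI impI)
  have AB [measurable]: "A \<in> sets \<mu>" "B \<in> sets \<mu>"
    using assms by (simp_all add: locally_approximable_def)
  then show "A \<union> B \<in> sets \<mu>" by simp
  fix \<epsilon> :: real assume "\<epsilon> > 0"
  then have "\<epsilon> / 2 > 0" by simp
  obtain A' r where A': "A' \<in> sets \<mu>" "local_function Y r (\<lambda>\<Lambda>. \<Lambda> \<in> A')" "prob ((A - A') \<union> (A' - A)) < \<epsilon> / 2"
    using locally_approximableE[OF assms(1) \<open>\<epsilon> / 2 > 0\<close>] .
  obtain B' r' where B': "B' \<in> sets \<mu>" "local_function Y r' (\<lambda>\<Lambda>. \<Lambda> \<in> B')" "prob ((B - B') \<union> (B' - B)) < \<epsilon> / 2"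
    using locally_approximableE[OF assms(2) \<open>\<epsilon> / 2 > 0\<close>] .
  have "prob (((A \<union> B) - (A' \<union> B')) \<union> ((A' \<union> B') - (A \<union> B)))
      \<le> prob (((A - A') \<union> (A' - A)) \<union> ((B - B') \<union> (B' - B)))"
    using A'(1) B'(1) by (intro finite_measure_mono) auto
  also have "\<dots> \<le> prob ((A - A') \<union> (A' - A)) + prob ((B - B') \<union> (B' - B))"
    using A'(1) B'(1) by (intro measure_Un_le) auto
  also have "\<dots> < \<epsilon>" using A' B' by simp
  finally have "prob (((A \<union> B) - (A' \<union> B')) \<union> ((A' \<union> B') - (A \<union> B))) < \<epsilon>" .
  moreover have "local_function Y (max r r') (\<lambda>\<Lambda>. \<Lambda> \<in> A' \<union> B')"
    using local_function_common[OF A'(2) B'(2), of "(\<or>)"] by simp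
  ultimately show "\<exists>C r. C \<in> sets \<mu> \<and> local_function Y r (\<lambda>\<Lambda>. \<Lambda> \<in> C) \<and>
      prob (((A \<union> B) - C) \<union> (C - (A \<union> B))) < \<epsilon>"
    using A'(1) B'(1) by (intro exI[of _ "A' \<union> B'"]) auto
qed

lemma locally_approximable_empty: "locally_approximable {}"
  by (rule locally_approximable_local[of _ 0]) (auto simp: local_function_def)

lemma locally_approximable_UN_nat:
  fixes A :: "nat \<Rightarrow> 'a tiling set"
  assumes "\<And>n. locally_approximable (A n)"
  shows "locally_approximable (\<Union>n. A n)"
  unfolding locally_approximable_def
proof (intro conjI allI impI)
  have A [measurable]: "A n \<in> sets \<mu>" for n
    using assms by (simp add: locally_approximable_def)
  then show U: "(\<Union>n. A n) \<in> sets \<mu>" by blast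
  fix \<epsilon> :: real assume "\<epsilon> > 0"
  define B where "B n = (\<Union>i<n. A i)" for n
  have B: "locally_approximable (B n)" for n
    unfolding B_def
    by (induction n) (auto simp: lessThan_Suc locally_approximable_empty intro: locally_approximable_Un assms)
  have Bs: "B n \<in> sets \<mu>" for n using B by (simp add: locally_approximable_def)
  have UB: "(\<Union>n. B n) = (\<Union>n. A n)"
    unfolding B_def by auto
  have "incseq B" unfolding B_def incseq_def by (auto intro: less_le_trans)
  then have "(\<lambda>n. prob (B n)) \<longlonglongrightarrow> prob (\<Union>n. B n)"
    using Bs by (intro finite_Lim_measure_incseq) auto
  then have "eventually (\<lambda>n. prob (\<Union>n. B n) - \<epsilon> / 2 < prob (B n)) sequentially"
    by (rule order_tendstoD) (use \<open>\<epsilon> > 0\<close> in simp)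
  then obtain n where n: "prob (\<Union>n. A n) - \<epsilon> / 2 < prob (B n)"
    unfolding UB by (auto dest: eventually_happens)
  have sub: "B n \<subseteq> (\<Union>n. A n)" by (auto simp: B_def)
  have diff: "prob ((\<Union>n. A n) - B n) < \<epsilon> / 2"
    using n by (subst finite_measure_Diff[OF U Bs sub]) simp
  obtain C r where C: "C \<in> sets \<mu>" "local_function Y r (\<lambda>\<Lambda>. \<Lambda> \<in> C)" "prob ((B n - C) \<union> (C - B n)) < \<epsilon> / 2"
    using locally_approximableE[OF B[of n], of "\<epsilon> / 2"] \<open>\<epsilon> > 0\<close> by auto
  have "prob (((\<Union>n. A n) - C) \<union> (C - (\<Union>n. A n))) \<le> prob (((\<Union>n. A n) - B n) \<union> ((B n - C) \<union> (C - B n)))"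
    using U Bs[of n] C(1) sub by (intro finite_measure_mono) auto
  also have "\<dots> \<le> prob ((\<Union>n. A n) - B n) + prob ((B n - C) \<union> (C - B n))"
    using U Bs[of n] C(1) by (intro measure_Un_le) auto
  also have "\<dots> < \<epsilon>" using diff C(3) by simp
  finally show "\<exists>C r. C \<in> sets \<mu> \<and> local_function Y r (\<lambda>\<Lambda>. \<Lambda> \<in> C) \<and>
      prob (((\<Union>n. A n) - C) \<union> (C - (\<Union>n. A n))) < \<epsilon>"
    using C by blast
qed

lemma locally_approximable_countable_Union:
  assumes "countable \<D>" "\<And>A. A \<in> \<D> \<Longrightarrow> locally_approximable A"
  shows "locally_approximable (\<Union>\<D>)"
proof (cases "\<D> = {}")
  case False
  then have "\<Union>\<D> = (\<Union>n. from_nat_into \<D> n)"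
    using assms(1) by (metis range_from_nat_into)
  then show ?thesis
    using locally_approximable_UN_nat[of "from_nat_into \<D>"] assms(2) from_nat_into[OF False] by simp
qed (simp add: locally_approximable_empty)

lemma cylinder_in_sets: "cylinder \<alpha> \<beta> m u \<inter> Y \<in> sets \<mu>"
  unfolding sets_mu
  using openin_cylinder[of \<alpha> \<beta> m u] by (intro sigma_sets.Basic) (auto simp: openin_subtopology)

text \<open>
  An open set is the union of the cylinders with rational bounds that it contains, of which there are countably many.
\<close>

theorem locally_approximable_sets:
  assumes "A \<in> sets \<mu>"
  shows "locally_approximable A"
  using assms unfolding sets_mu
proof (induction rule: sigma_sets.induct)
  case (Basic U)
  define \<D> where "\<D> = {W. W \<in> (\<lambda>(\<alpha>, \<beta>, m, u). cylinder \<alpha> \<beta> m u \<inter> Y) ` (\<rat> \<times> \<rat> \<times> UNIV \<times> lists UNIV) \<and> W \<subseteq> U}"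
  have "countable (\<rat> \<times> \<rat> \<times> (UNIV :: nat set) \<times> lists (UNIV :: 'a set))"
    by (intro countable_SIGMA countable_rat countable_lists countableI_type countable_finite finite)
  then have "countable \<D>"
    unfolding \<D>_def by (rule countable_subset[OF _ countable_image, rotated]) blast
  moreover have "locally_approximable W" if WD: "W \<in> \<D>" for W
  proof -
    obtain \<alpha> \<beta> m u where W: "W = cylinder \<alpha> \<beta> m u \<inter> Y" using WD by (auto simp: \<D>_def)
    have "local_function Y (\<bar>\<alpha>\<bar> + \<bar>\<beta>\<bar> + real m + real (length u)) (\<lambda>\<Lambda>. \<Lambda> \<in> W)"
      using local_function_cylinder[of Y \<alpha> \<beta> m u] unfolding W local_function_def by auto
    then show ?thesis using cylinder_in_sets unfolding W by (intro locally_approximable_local)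
  qed
  moreover have "U = \<Union>\<D>"
  proof (intro equalityI subsetI)
    fix \<Lambda> assume "\<Lambda> \<in> U"
    then have "\<Lambda> \<in> Y" using Basic openin_subset[of "subtopology local_topology Y" U] by auto
    obtain \<alpha> \<beta> m u where "\<alpha> \<in> \<rat>" "\<beta> \<in> \<rat>" "\<Lambda> \<in> cylinder \<alpha> \<beta> m u" "cylinder \<alpha> \<beta> m u \<inter> Y \<subseteq> U"
    proof -
      have "openin (subtopology local_topology Y) U" using Basic by simp
      from cylinder_neighbourhood[OF legal this \<open>\<Lambda> \<in> U\<close>] that show thesis by blast
    qed
    then have "cylinder \<alpha> \<beta> m u \<inter> Y \<in> \<D>" unfolding \<D>_def
      by (intro CollectI conjI image_eqI[of _ _ "(\<alpha>, \<beta>, m, u)"]) auto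
    then show "\<Lambda> \<in> \<Union>\<D>" using \<open>\<Lambda> \<in> cylinder \<alpha> \<beta> m u\<close> \<open>\<Lambda> \<in> Y\<close> by blast
  qed (auto simp: \<D>_def)
  ultimately show ?case using locally_approximable_countable_Union[of \<D>] by simp
next
  case Empty
  show ?case by (rule locally_approximable_empty)
next
  case (Compl A)
  show ?case
    unfolding locally_approximable_def
  proof (intro conjI allI impI)
    have A: "A \<in> sets \<mu>" using Compl.IH by (simp add: locally_approximable_def)
    then show "Y - A \<in> sets \<mu>" using sets.compl_sets[OF A] by simp
    fix \<epsilon> :: real assume "\<epsilon> > 0"
    obtain A' r where A': "A' \<in> sets \<mu>" "local_function Y r (\<lambda>\<Lambda>. \<Lambda> \<in> A')" "prob ((A - A') \<union> (A' - A)) < \<epsilon>"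
      using locally_approximableE[OF Compl.IH \<open>\<epsilon> > 0\<close>] .
    have "A \<subseteq> Y" "A' \<subseteq> Y"
      using sets.sets_into_space[OF A] sets.sets_into_space[OF A'(1)] by simp_all
    then have *: "(Y - A - (Y - A')) \<union> (Y - A' - (Y - A)) = (A - A') \<union> (A' - A)"
      by blast
    have "local_function Y r (\<lambda>\<Lambda>. \<Lambda> \<in> Y - A')"
      using A'(2) unfolding local_function_def by blast
    moreover have "Y - A' \<in> sets \<mu>" using sets.compl_sets[OF A'(1)] by simp
    ultimately show "\<exists>C r. C \<in> sets \<mu> \<and> local_function Y r (\<lambda>\<Lambda>. \<Lambda> \<in> C) \<and>
        prob (((Y - A) - C) \<union> (C - (Y - A))) < \<epsilon>"
      using A'(3) by (intro exI[of _ "Y - A'"] exI[of _ r] conjI) (simp_all only: *)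
  qed
next
  case (Union A)
  then show ?case by (intro locally_approximable_UN_nat)
qed

lemma integrable_bounded:
  assumes "f \<in> borel_measurable \<mu>" "\<And>\<Lambda>. norm (f \<Lambda>) \<le> (K::real)"
  shows "integrable \<mu> (f :: _ \<Rightarrow> _::{banach, second_countable_topology})"
  using assms by (intro integrable_const_bound[of _ K]) auto

lemma local_approximation_L1:
  fixes f :: "'a tiling \<Rightarrow> complex"
  assumes "integrable \<mu> f"
  shows "\<forall>\<epsilon>>0. \<exists>f0 r K. f0 \<in> borel_measurable \<mu> \<and> local_function Y r f0 \<and>
     (\<forall>\<Lambda>. cmod (f0 \<Lambda>) \<le> K) \<and> (LINT \<Lambda>|\<mu>. cmod (f \<Lambda> - f0 \<Lambda>)) < \<epsilon>"
  using assms
proof (induction rule: integrable_induct)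
  case (base A c)
  show ?case
  proof (intro allI impI)
    fix \<epsilon> :: real assume "\<epsilon> > 0"
    have "locally_approximable A" using base by (intro locally_approximable_sets)
    moreover have "\<epsilon> / (cmod c + 1) > 0" using \<open>\<epsilon> > 0\<close> by (simp add: add_nonneg_pos)
    ultimately obtain A' r where A': "A' \<in> sets \<mu>" "local_function Y r (\<lambda>\<Lambda>. \<Lambda> \<in> A')"
      "prob ((A - A') \<union> (A' - A)) < \<epsilon> / (cmod c + 1)"
      using locally_approximableE by metis
    define D where "D = (A - A') \<union> (A' - A)"
    have D: "D \<in> sets \<mu>" using A' base by (auto simp: D_def)
    then have "D \<inter> Y = D" using sets.sets_into_space[OF D] by auto
    have "(LINT \<Lambda>|\<mu>. cmod (indicator A \<Lambda> *\<^sub>R c - indicator A' \<Lambda> *\<^sub>R c)) = (LINT \<Lambda>|\<mu>. indicator D \<Lambda> * cmod c)"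
      by (intro Bochner_Integration.integral_cong refl) (auto simp: D_def indicator_def)
    also have "\<dots> = prob D * cmod c" using D \<open>D \<inter> Y = D\<close> by simp
    also have "\<dots> \<le> prob D * (cmod c + 1)" by (intro mult_left_mono) auto
    also have "\<dots> < \<epsilon>" using A'(3) by (simp add: D_def pos_less_divide_eq add_nonneg_pos)
    finally have "(LINT \<Lambda>|\<mu>. cmod (indicator A \<Lambda> *\<^sub>R c - indicator A' \<Lambda> *\<^sub>R c)) < \<epsilon>" .
    moreover have "local_function Y r (\<lambda>\<Lambda>. indicator A' \<Lambda> *\<^sub>R c)"
      using A'(2) by (auto simp: local_function_def indicator_def)
    moreover have "cmod (indicator A' \<Lambda> *\<^sub>R c) \<le> cmod c" for \<Lambda> by (simp add: indicator_def)
    ultimately show "\<exists>f0 r K. f0 \<in> borel_measurable \<mu> \<and> local_function Y r f0 \<and>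
       (\<forall>\<Lambda>. cmod (f0 \<Lambda>) \<le> K) \<and> (LINT \<Lambda>|\<mu>. cmod (indicator A \<Lambda> *\<^sub>R c - f0 \<Lambda>)) < \<epsilon>"
      using A'(1) by (intro exI[of _ "\<lambda>\<Lambda>. indicator A' \<Lambda> *\<^sub>R c"] exI[of _ r] exI[of _ "cmod c"] conjI allI) auto
  qed
next
  case (add f g)
  show ?case
  proof (intro allI impI)
    fix \<epsilon> :: real assume "\<epsilon> > 0"
    then have "\<epsilon> / 2 > 0" by simp
    obtain f0 r K where f0: "f0 \<in> borel_measurable \<mu>" "local_function Y r f0" "\<And>\<Lambda>. cmod (f0 \<Lambda>) \<le> K"
      "(LINT \<Lambda>|\<mu>. cmod (f \<Lambda> - f0 \<Lambda>)) < \<epsilon> / 2"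
      using add.IH(1) \<open>\<epsilon> / 2 > 0\<close> by blast
    obtain g0 r' K' where g0: "g0 \<in> borel_measurable \<mu>" "local_function Y r' g0" "\<And>\<Lambda>. cmod (g0 \<Lambda>) \<le> K'"
      "(LINT \<Lambda>|\<mu>. cmod (g \<Lambda> - g0 \<Lambda>)) < \<epsilon> / 2"
      using add.IH(2) \<open>\<epsilon> / 2 > 0\<close> by blast
    have int: "integrable \<mu> f0" "integrable \<mu> g0"
      using f0 g0 by (auto intro: integrable_bounded)
    have "(LINT \<Lambda>|\<mu>. cmod ((f \<Lambda> + g \<Lambda>) - (f0 \<Lambda> + g0 \<Lambda>)))
        \<le> (LINT \<Lambda>|\<mu>. cmod (f \<Lambda> - f0 \<Lambda>) + cmod (g \<Lambda> - g0 \<Lambda>))"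
      using int add.hyps by (intro integral_mono) (auto simp: add_diff_add norm_triangle_ineq)
    also have "\<dots> < \<epsilon>"
      using int add.hyps f0(4) g0(4) by (subst Bochner_Integration.integral_add) auto
    finally have "(LINT \<Lambda>|\<mu>. cmod ((f \<Lambda> + g \<Lambda>) - (f0 \<Lambda> + g0 \<Lambda>))) < \<epsilon>" .
    moreover have "cmod (f0 \<Lambda> + g0 \<Lambda>) \<le> K + K'" for \<Lambda>
      using f0(3) g0(3) by (meson add_mono norm_triangle_ineq order_trans)
    ultimately show "\<exists>h r K. h \<in> borel_measurable \<mu> \<and> local_function Y r h \<and>
       (\<forall>\<Lambda>. cmod (h \<Lambda>) \<le> K) \<and> (LINT \<Lambda>|\<mu>. cmod (f \<Lambda> + g \<Lambda> - h \<Lambda>)) < \<epsilon>"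
      using f0(1) g0(1) local_function_common[OF f0(2) g0(2), of "(+)"]
      by (intro exI[of _ "\<lambda>\<Lambda>. f0 \<Lambda> + g0 \<Lambda>"] exI[of _ "max r r'"] exI[of _ "K + K'"] conjI allI) auto
  qed
next
  case (lim f s)
  show ?case
  proof (intro allI impI)
    fix \<epsilon> :: real assume "\<epsilon> > 0"
    have "(\<lambda>i. LINT \<Lambda>|\<mu>. cmod (f \<Lambda> - s i \<Lambda>)) \<longlonglongrightarrow> (LINT \<Lambda>|\<mu>. 0)"
    proof (rule integral_dominated_convergence[where w = "\<lambda>\<Lambda>. 3 * cmod (f \<Lambda>)"])
      show "integrable \<mu> (\<lambda>\<Lambda>. 3 * cmod (f \<Lambda>))" using lim.hyps by auto
      show "AE \<Lambda> in \<mu>. (\<lambda>i. cmod (f \<Lambda> - s i \<Lambda>)) \<longlonglongrightarrow> 0"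
      proof (rule AE_I2)
        fix \<Lambda> assume "\<Lambda> \<in> space \<mu>"
        from lim.hyps(2)[OF this] have "(\<lambda>i. f \<Lambda> - s i \<Lambda>) \<longlonglongrightarrow> f \<Lambda> - f \<Lambda>" by (intro tendsto_intros)
        then show "(\<lambda>i. cmod (f \<Lambda> - s i \<Lambda>)) \<longlonglongrightarrow> 0" by (simp add: tendsto_norm_zero_iff)
      qed
      show "AE \<Lambda> in \<mu>. norm (cmod (f \<Lambda> - s i \<Lambda>)) \<le> 3 * cmod (f \<Lambda>)" for i
      proof (rule AE_I2)
        fix \<Lambda> assume "\<Lambda> \<in> space \<mu>"
        have "cmod (f \<Lambda> - s i \<Lambda>) \<le> cmod (f \<Lambda>) + cmod (s i \<Lambda>)" by (rule norm_triangle_ineq4)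
        also have "\<dots> \<le> 3 * cmod (f \<Lambda>)" using lim.hyps(3)[OF \<open>\<Lambda> \<in> space \<mu>\<close>, of i] by simp
        finally show "norm (cmod (f \<Lambda> - s i \<Lambda>)) \<le> 3 * cmod (f \<Lambda>)" by simp
      qed
    qed (use lim.hyps in auto)
    then have "eventually (\<lambda>i. (LINT \<Lambda>|\<mu>. cmod (f \<Lambda> - s i \<Lambda>)) < \<epsilon> / 2) sequentially"
      by (rule order_tendstoD) (use \<open>\<epsilon> > 0\<close> in simp)
    then obtain i where i: "(LINT \<Lambda>|\<mu>. cmod (f \<Lambda> - s i \<Lambda>)) < \<epsilon> / 2"
      by (auto dest: eventually_happens)
    obtain f0 r K where f0: "f0 \<in> borel_measurable \<mu>" "local_function Y r f0" "\<And>\<Lambda>. cmod (f0 \<Lambda>) \<le> K"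
      "(LINT \<Lambda>|\<mu>. cmod (s i \<Lambda> - f0 \<Lambda>)) < \<epsilon> / 2"
      using lim.IH[of i] half_gt_zero[OF \<open>\<epsilon> > 0\<close>] by blast
    have int: "integrable \<mu> f0" using f0 by (auto intro: integrable_bounded)
    have "(LINT \<Lambda>|\<mu>. cmod (f \<Lambda> - f0 \<Lambda>)) \<le> (LINT \<Lambda>|\<mu>. cmod (f \<Lambda> - s i \<Lambda>) + cmod (s i \<Lambda> - f0 \<Lambda>))"
      using int lim.hyps by (intro integral_mono) (auto intro: norm_triangle_sub order_trans[OF _ norm_triangle_ineq])
    also have "\<dots> < \<epsilon>"
      using int lim.hyps f0(4) i by (subst Bochner_Integration.integral_add) auto
    finally show "\<exists>f0 r K. f0 \<in> borel_measurable \<mu> \<and> local_function Y r f0 \<and>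
       (\<forall>\<Lambda>. cmod (f0 \<Lambda>) \<le> K) \<and> (LINT \<Lambda>|\<mu>. cmod (f \<Lambda> - f0 \<Lambda>)) < \<epsilon>"
      using f0 by blast
  qed
qed

text \<open>
  The function is first cut off at a large height, then approximated in the mean.  Among functions with a common
  bound, approximation in the mean implies approximation in the square mean.
\<close>

theorem local_approximation_L2:
  assumes f: "square_integrable \<mu> f" and "\<epsilon> > 0"
  obtains f0 r K where "f0 \<in> borel_measurable \<mu>" "local_function Y r f0" "\<And>\<Lambda>. cmod (f0 \<Lambda>) \<le> K"
    "(LINT \<Lambda>|\<mu>. (cmod (f \<Lambda> - f0 \<Lambda>))\<^sup>2) < \<epsilon>"
proof -
  have fm [measurable]: "f \<in> borel_measurable \<mu>" and f2: "integrable \<mu> (\<lambda>\<Lambda>. (cmod (f \<Lambda>))\<^sup>2)"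
    using f by (auto simp: square_integrable_def)
  define fc where "fc n \<Lambda> = (if cmod (f \<Lambda>) \<le> real n then f \<Lambda> else 0)" for n \<Lambda>
  have [measurable]: "fc n \<in> borel_measurable \<mu>" for n unfolding fc_def[abs_def] by measurable
  have "(\<lambda>n. LINT \<Lambda>|\<mu>. (cmod (f \<Lambda> - fc n \<Lambda>))\<^sup>2) \<longlonglongrightarrow> (LINT \<Lambda>|\<mu>. 0)"
  proof (rule integral_dominated_convergence[where w = "\<lambda>\<Lambda>. (cmod (f \<Lambda>))\<^sup>2"])
    show "AE \<Lambda> in \<mu>. (\<lambda>n. (cmod (f \<Lambda> - fc n \<Lambda>))\<^sup>2) \<longlonglongrightarrow> 0"
    proof (rule AE_I2)
      fix \<Lambda>
      have "eventually (\<lambda>n. (cmod (f \<Lambda> - fc n \<Lambda>))\<^sup>2 = 0) sequentially"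
        using eventually_ge_at_top[of "nat \<lceil>cmod (f \<Lambda>)\<rceil>"]
      proof eventually_elim
        case (elim n)
        then have "cmod (f \<Lambda>) \<le> real n" by linarith
        then show ?case by (simp add: fc_def)
      qed
      then show "(\<lambda>n. (cmod (f \<Lambda> - fc n \<Lambda>))\<^sup>2) \<longlonglongrightarrow> 0" by (rule tendsto_eventually)
    qed
    show "AE \<Lambda> in \<mu>. norm ((cmod (f \<Lambda> - fc n \<Lambda>))\<^sup>2) \<le> (cmod (f \<Lambda>))\<^sup>2" for n
      by (rule AE_I2) (simp add: fc_def)
  qed (use f2 in auto)
  then have "eventually (\<lambda>n. (LINT \<Lambda>|\<mu>. (cmod (f \<Lambda> - fc n \<Lambda>))\<^sup>2) < \<epsilon> / 4) sequentially"
    by (rule order_tendstoD) (use \<open>\<epsilon> > 0\<close> in simp)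
  then obtain n where n: "(LINT \<Lambda>|\<mu>. (cmod (f \<Lambda> - fc n \<Lambda>))\<^sup>2) < \<epsilon> / 4"
    by (auto dest: eventually_happens)
  have fcn: "cmod (fc n \<Lambda>) \<le> real n" for \<Lambda> by (simp add: fc_def)
  have intfc: "integrable \<mu> (fc n)" by (rule integrable_bounded[OF _ fcn]) simp
  define \<delta> where "\<delta> = \<epsilon> / (4 * (3 * real n + 1))"
  have "\<delta> > 0" using \<open>\<epsilon> > 0\<close> by (simp add: \<delta>_def)
  obtain h r K where h [measurable]: "h \<in> borel_measurable \<mu>" and h': "local_function Y r h" "\<And>\<Lambda>. cmod (h \<Lambda>) \<le> K"
    "(LINT \<Lambda>|\<mu>. cmod (fc n \<Lambda> - h \<Lambda>)) < \<delta>"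
    using local_approximation_L1[OF intfc] \<open>\<delta> > 0\<close> by blast
  \<comment> \<open>Cutting \<open>h\<close> off at twice the bound of \<open>fc n\<close> moves it no further away from \<open>fc n\<close>.\<close>
  define f0 where "f0 \<Lambda> = (if cmod (h \<Lambda>) \<le> 2 * real n then h \<Lambda> else 0)" for \<Lambda>
  have f0 [measurable]: "f0 \<in> borel_measurable \<mu>" unfolding f0_def[abs_def] by measurable
  have closer: "cmod (fc n \<Lambda> - f0 \<Lambda>) \<le> cmod (fc n \<Lambda> - h \<Lambda>)" for \<Lambda>
    using fcn[of \<Lambda>] norm_triangle_ineq2[of "h \<Lambda>" "fc n \<Lambda>"] by (simp add: f0_def norm_minus_commute)
  have f0n: "cmod (f0 \<Lambda>) \<le> 2 * real n" for \<Lambda> by (simp add: f0_def)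
  have this_bound: "(cmod (fc n \<Lambda> - f0 \<Lambda>))\<^sup>2 \<le> (3 * real n + 1) * cmod (fc n \<Lambda> - h \<Lambda>)" for \<Lambda>
  proof -
    have "cmod (fc n \<Lambda> - f0 \<Lambda>) \<le> 3 * real n + 1"
      using norm_triangle_ineq4[of "fc n \<Lambda>" "f0 \<Lambda>"] fcn[of \<Lambda>] f0n[of \<Lambda>] by linarith
    then show ?thesis unfolding power2_eq_square using closer[of \<Lambda>] by (intro mult_mono) auto
  qed
  have "(cmod (f \<Lambda> - f0 \<Lambda>))\<^sup>2 \<le> 2 * (cmod (f \<Lambda> - fc n \<Lambda>))\<^sup>2 + 2 * ((3 * real n + 1) * cmod (fc n \<Lambda> - h \<Lambda>))" for \<Lambda>
  proof -
    have "f \<Lambda> - f0 \<Lambda> = (f \<Lambda> - fc n \<Lambda>) + (fc n \<Lambda> - f0 \<Lambda>)" by simp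
    then have "(cmod (f \<Lambda> - f0 \<Lambda>))\<^sup>2 \<le> 2 * (cmod (f \<Lambda> - fc n \<Lambda>))\<^sup>2 + 2 * (cmod (fc n \<Lambda> - f0 \<Lambda>))\<^sup>2"
      using cmod_add_square_le by metis
    also have "\<dots> \<le> 2 * (cmod (f \<Lambda> - fc n \<Lambda>))\<^sup>2 + 2 * ((3 * real n + 1) * cmod (fc n \<Lambda> - h \<Lambda>))"
      using this_bound[of \<Lambda>] by linarith
    finally show ?thesis .
  qed
  moreover have int1: "integrable \<mu> (\<lambda>\<Lambda>. (cmod (f \<Lambda> - fc n \<Lambda>))\<^sup>2)"
    by (rule Bochner_Integration.integrable_bound[OF f2]) (auto simp: fc_def)
  moreover have int2: "integrable \<mu> (\<lambda>\<Lambda>. cmod (fc n \<Lambda> - h \<Lambda>))"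
    using integrable_bounded[OF h h'(2)] intfc by auto
  ultimately have "(LINT \<Lambda>|\<mu>. (cmod (f \<Lambda> - f0 \<Lambda>))\<^sup>2)
      \<le> (LINT \<Lambda>|\<mu>. 2 * (cmod (f \<Lambda> - fc n \<Lambda>))\<^sup>2 + 2 * ((3 * real n + 1) * cmod (fc n \<Lambda> - h \<Lambda>)))"
    by (intro integral_mono') auto
  also have "\<dots> = 2 * (LINT \<Lambda>|\<mu>. (cmod (f \<Lambda> - fc n \<Lambda>))\<^sup>2) + 2 * ((3 * real n + 1) * (LINT \<Lambda>|\<mu>. cmod (fc n \<Lambda> - h \<Lambda>)))"
    using int1 int2 by simp
  also have "\<dots> < \<epsilon>"
  proof -
    have "(3 * real n + 1) * (LINT \<Lambda>|\<mu>. cmod (fc n \<Lambda> - h \<Lambda>)) < (3 * real n + 1) * \<delta>"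
      using h'(3) by (intro mult_strict_left_mono) auto
    also have "\<dots> = \<epsilon> / 4" unfolding \<delta>_def by (simp add: field_simps)
    finally show ?thesis using n by simp
  qed
  finally have "(LINT \<Lambda>|\<mu>. (cmod (f \<Lambda> - f0 \<Lambda>))\<^sup>2) < \<epsilon>" .
  moreover have "local_function Y r f0"
    using h'(1) by (auto simp: local_function_def f0_def)
  ultimately show thesis using that[OF f0 _ f0n] by blast
qed

end

section \<open>Singularity of the spectral measures\<close>

text \<open>
  For each \<open>q\<close> there is one partner \<open>q'\<close>, unless it falls outside the window, which happens for at most
  \<open>2 |m|\<close> values of \<open>q\<close>.
\<close>

lemma pair_count_bounds:
  fixes m :: int and R :: nat
  defines "cnt \<equiv> (\<Sum>q<R. \<Sum>q'<R. if m + int q = int q' then 1 else (0::real))"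
  shows "\<bar>cnt - real R\<bar> \<le> 2 * \<bar>real_of_int m\<bar>"
proof -
  define B where "B = {q. q < R \<and> \<not> (0 \<le> m + int q \<and> m + int q < int R)}"
  have inner: "(\<Sum>q'<R. if m + int q = int q' then 1 else (0::real)) = (if q \<in> B then 0 else 1)" if "q < R" for q
  proof (cases "q \<in> B")
    case True
    then show ?thesis by (auto simp: B_def intro!: sum.neutral)
  next
    case False
    then have "0 \<le> m + int q" "m + int q < int R" using that by (auto simp: B_def)
    then have "(m + int q = int q') = (q' = nat (m + int q))" "nat (m + int q) < R" for q' by auto
    then show ?thesis using False by simp
  qed
  have "cnt = (\<Sum>q<R. if q \<in> B then 0 else 1)"
    unfolding cnt_def by (intro sum.cong refl) (simp add: inner)
  also have "\<dots> = (\<Sum>q<R. 1 - (if q \<in> B then 1 else 0))" by (intro sum.cong refl) auto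
  also have "\<dots> = real R - real (card B)"
  proof -
    have "{..<R} \<inter> B = B" by (auto simp: B_def)
    then show ?thesis by (simp add: sum_subtractf sum.If_cases)
  qed
  finally have cnt: "cnt = real R - real (card B)" .
  have "card B \<le> card ({..<nat \<bar>m\<bar>} \<union> {R - nat \<bar>m\<bar>..<R})"
    by (intro card_mono) (auto simp: B_def)
  also have "\<dots> \<le> card {..<nat \<bar>m\<bar>} + card {R - nat \<bar>m\<bar>..<R}" by (rule card_Un_le)
  also have "\<dots> \<le> 2 * nat \<bar>m\<bar>" by simp
  finally have "real (card B) \<le> real (2 * nat \<bar>m\<bar>)" by (simp only: of_nat_le_iff)
  then show ?thesis unfolding cnt by simp
qed

lemma pair_count_tendsto:
  "(\<lambda>R. (\<Sum>q<R. \<Sum>q'<R. if m + int q = int q' then 1 else (0::real)) / real R) \<longlonglongrightarrow> 1"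
proof -
  define cnt where "cnt R = (\<Sum>q<R. \<Sum>q'<R. if m + int q = int q' then 1 else (0::real))" for R
  have "(\<lambda>R. (cnt R - real R) / real R) \<longlonglongrightarrow> 0"
  proof (rule tendsto_rabs_zero_cancel, rule tendsto_sandwich[OF _ _ tendsto_const])
    show "(\<lambda>R. 2 * \<bar>real_of_int m\<bar> / real R) \<longlonglongrightarrow> 0" by (rule lim_const_over_n)
    show "\<forall>\<^sub>F R in sequentially. \<bar>(cnt R - real R) / real R\<bar> \<le> 2 * \<bar>real_of_int m\<bar> / real R"
      using pair_count_bounds[where m = m] by (auto simp: cnt_def abs_divide intro!: always_eventually divide_right_mono)
  qed auto
  then have "(\<lambda>R. 1 + (cnt R - real R) / real R) \<longlonglongrightarrow> 1 + 0" by (intro tendsto_intros)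
  moreover have "\<forall>\<^sub>F R in sequentially. 1 + (cnt R - real R) / real R = cnt R / real R"
    using eventually_gt_at_top[of 0] by eventually_elim (simp add: field_simps)
  ultimately show ?thesis unfolding cnt_def by (simp add: tendsto_cong)
qed

lemma measurable_cnj [measurable]: "cnj \<in> borel_measurable borel"
  by (intro borel_measurable_continuous_onI continuous_intros)

lemma energy_complex:
  assumes "multiplier D"
  shows "complex_of_real (energy D x A) = (LINT k|unit_measure 0. of_real (D k) *
     (\<Sum>q\<in>A. x q * ee (real q * k)) * cnj (\<Sum>q\<in>A. x q * ee (real q * k)))"
  unfolding energy_def integral_complex_of_real[symmetric] of_real_mult complex_norm_square mult.assoc ..

text \<open>
  The energy for complex multipliers, in which it is linear.
\<close>

definition twisted_form :: "(real \<Rightarrow> complex) \<Rightarrow> (nat \<Rightarrow> complex) \<Rightarrow> nat \<Rightarrow> complex" where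
  "twisted_form g x R = (LINT k|unit_measure 0. g k *
     (\<Sum>q<R. x q * ee (real q * k)) * cnj (\<Sum>q<R. x q * ee (real q * k)))"

lemma twisted_form_ee:
  "twisted_form (\<lambda>k. ee (of_int m * k)) x R
     = (\<Sum>q<R. \<Sum>q'<R. if m + int q = int q' then x q * cnj (x q') else 0)"
  unfolding twisted_form_def by (rule integral_ee_times_trig_sum) simp

lemma twisted_form_add:
  assumes "trig_poly g" "trig_poly h"
  shows "twisted_form (\<lambda>k. g k + h k) x R = twisted_form g x R + twisted_form h x R"
proof -
  have "integrable (unit_measure 0) (\<lambda>k. u k * (\<Sum>q<R. x q * ee (real q * k)) * cnj (\<Sum>q<R. x q * ee (real q * k)))"
    if "trig_poly u" for u
    by (intro integrable_unit_measure_trig_poly trig_poly_mult that trig_poly_nat_sum trig_poly_cnj)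
  from Bochner_Integration.integral_add[OF this[OF assms(1)] this[OF assms(2)]]
  show ?thesis by (simp add: twisted_form_def distrib_right)
qed

lemma twisted_form_scale: "twisted_form (\<lambda>k. c * g k) x R = c * twisted_form g x R"
  by (simp add: twisted_form_def mult.assoc)

context invariant_system
begin

lemma integral_translate:
  fixes h :: "'a tiling \<Rightarrow> 'b::{banach, second_countable_topology}"
  assumes [measurable]: "h \<in> borel_measurable \<mu>"
  shows "(LINT \<Lambda>|\<mu>. h (translate s \<Lambda>)) = (LINT \<Lambda>|\<mu>. h \<Lambda>)"
  using integral_distr[OF measurable_translate assms, of s] by (simp add: distr_translate)

lemma square_integrable_translate:
  assumes "square_integrable \<mu> h"
  shows "square_integrable \<mu> (\<lambda>\<Lambda>. h (translate s \<Lambda>))"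
proof -
  have [measurable]: "h \<in> borel_measurable \<mu>" and int: "integrable \<mu> (\<lambda>\<Lambda>. (cmod (h \<Lambda>))\<^sup>2)"
    using assms by (auto simp: square_integrable_def)
  have "integrable (distr \<mu> \<mu> (translate s)) (\<lambda>\<Lambda>. (cmod (h \<Lambda>))\<^sup>2)" using int by (simp add: distr_translate)
  then have "integrable \<mu> (\<lambda>\<Lambda>. (cmod (h (translate s \<Lambda>)))\<^sup>2)"
    by (rule integrable_distr[OF measurable_translate])
  moreover have "(\<lambda>\<Lambda>. h (translate s \<Lambda>)) \<in> borel_measurable \<mu>" by measurable
  ultimately show ?thesis unfolding square_integrable_def by simp
qed

lemma integrable_product:
  assumes "square_integrable \<mu> f" "square_integrable \<mu> g"
  shows "integrable \<mu> (\<lambda>\<Lambda>. cnj (f \<Lambda>) * g \<Lambda>)"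
proof (rule Bochner_Integration.integrable_bound)
  show "integrable \<mu> (\<lambda>\<Lambda>. (cmod (f \<Lambda>))\<^sup>2 + (cmod (g \<Lambda>))\<^sup>2)"
    using assms by (auto simp: square_integrable_def)
  show "AE \<Lambda> in \<mu>. norm (cnj (f \<Lambda>) * g \<Lambda>) \<le> norm ((cmod (f \<Lambda>))\<^sup>2 + (cmod (g \<Lambda>))\<^sup>2)"
  proof (rule AE_I2)
    fix \<Lambda>
    have "2 * (cmod (f \<Lambda>) * cmod (g \<Lambda>)) \<le> (cmod (f \<Lambda>))\<^sup>2 + (cmod (g \<Lambda>))\<^sup>2"
      using sum_squares_bound[of "cmod (f \<Lambda>)" "cmod (g \<Lambda>)"] by (simp add: mult.assoc)
    moreover have "0 \<le> cmod (f \<Lambda>) * cmod (g \<Lambda>)" by simp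
    ultimately show "norm (cnj (f \<Lambda>) * g \<Lambda>) \<le> norm ((cmod (f \<Lambda>))\<^sup>2 + (cmod (g \<Lambda>))\<^sup>2)"
      by (simp only: norm_mult complex_mod_cnj real_norm_def)
  qed
qed (use assms in \<open>auto simp: square_integrable_def\<close>)

lemma square_integrable_bounded:
  assumes "f \<in> borel_measurable \<mu>" "\<And>\<Lambda>. cmod (f \<Lambda>) \<le> K"
  shows "square_integrable \<mu> f"
  unfolding square_integrable_def
  using assms by (auto intro!: integrable_bounded[of _ "K\<^sup>2"] power_mono)

lemma square_integrable_diff:
  assumes "square_integrable \<mu> f" "square_integrable \<mu> g"
  shows "square_integrable \<mu> (\<lambda>\<Lambda>. f \<Lambda> - g \<Lambda>)"
  unfolding square_integrable_def
proof
  show m: "(\<lambda>\<Lambda>. f \<Lambda> - g \<Lambda>) \<in> borel_measurable \<mu>"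
    using assms by (auto simp: square_integrable_def)
  show "integrable \<mu> (\<lambda>\<Lambda>. (cmod (f \<Lambda> - g \<Lambda>))\<^sup>2)"
  proof (rule Bochner_Integration.integrable_bound)
    show "integrable \<mu> (\<lambda>\<Lambda>. 2 * (cmod (f \<Lambda>))\<^sup>2 + 2 * (cmod (g \<Lambda>))\<^sup>2)"
      using assms by (auto simp: square_integrable_def)
    show "AE \<Lambda> in \<mu>. norm ((cmod (f \<Lambda> - g \<Lambda>))\<^sup>2) \<le> norm (2 * (cmod (f \<Lambda>))\<^sup>2 + 2 * (cmod (g \<Lambda>))\<^sup>2)"
      using cmod_add_square_le[of "f _" "- g _"] by (intro AE_I2) simp
  qed (use m in auto)
qed

text \<open>
  The conjugate makes the character \<open>e(m k)\<close> in the energy correspond to \<open>\<integral> e(m H k)\<close> in the spectral measure,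
  with the same sign of \<open>m\<close>.
\<close>

definition orbit_values :: "('a tiling \<Rightarrow> complex) \<Rightarrow> nat \<Rightarrow> nat \<Rightarrow> 'a tiling \<Rightarrow> nat \<Rightarrow> complex" where
  "orbit_values f H t \<Lambda> q = cnj (f (translate (- (real t + real q * real H)) \<Lambda>))"

lemma orbit_values_correlation:
  assumes f: "square_integrable \<mu> f" and \<sigma>: "is_spectral_measure \<mu> f \<sigma>" and q: "m + int q = int q'"
  shows "(LINT \<Lambda>|\<mu>. orbit_values f H t \<Lambda> q * cnj (orbit_values f H t \<Lambda> q'))
    = (LINT k|\<sigma>. ee (of_int m * (real H * k)))"
proof -
  have [measurable]: "f \<in> borel_measurable \<mu>" using f by (simp add: square_integrable_def)
  define a where "a = - (real t + real q * real H)"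
  define s where "s = of_int m * real H"
  have "- (real t + real q' * real H) = a + (- s)"
  proof -
    have "real q' = of_int m + real q" using q by (metis of_int_add of_int_of_nat_eq)
    then show ?thesis by (simp add: a_def s_def algebra_simps)
  qed
  then have "translate (- (real t + real q' * real H)) \<Lambda> = translate (- s) (translate a \<Lambda>)" for \<Lambda> :: "'a tiling"
    by (simp add: translate_def image_image algebra_simps)
  then have "(LINT \<Lambda>|\<mu>. orbit_values f H t \<Lambda> q * cnj (orbit_values f H t \<Lambda> q'))
      = (LINT \<Lambda>|\<mu>. (\<lambda>\<Lambda>. cnj (f \<Lambda>) * f (translate (- s) \<Lambda>)) (translate a \<Lambda>))"
    by (simp add: orbit_values_def a_def)
  also have "\<dots> = (LINT \<Lambda>|\<mu>. cnj (f \<Lambda>) * f (translate (- s) \<Lambda>))"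
    by (rule integral_translate) measurable
  also have "\<dots> = (LINT k|\<sigma>. exp (2 * pi * \<i> * of_real (k * s)))"
    using \<sigma> by (simp add: is_spectral_measure_def koopman_def)
  also have "\<dots> = (LINT k|\<sigma>. ee (of_int m * (real H * k)))"
    by (simp only: ee_eq_exp s_def mult_ac)
  finally show ?thesis .
qed

lemma integrable_orbit_product:
  assumes f: "square_integrable \<mu> f"
  shows "integrable \<mu> (\<lambda>\<Lambda>. orbit_values f H t \<Lambda> q * cnj (orbit_values f H t \<Lambda> q'))"
  unfolding orbit_values_def complex_cnj_cnj
  by (intro integrable_product square_integrable_translate f)

lemma integrable_twisted_form:
  assumes "square_integrable \<mu> f" "trig_poly g"
  shows "integrable \<mu> (\<lambda>\<Lambda>. twisted_form g (orbit_values f H t \<Lambda>) R)"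
  using assms(2)
proof induction
  case (trig_poly_ee m)
  have "integrable \<mu> (\<lambda>\<Lambda>. if m + int q = int q' then orbit_values f H t \<Lambda> q * cnj (orbit_values f H t \<Lambda> q') else 0)" for q q'
    using integrable_orbit_product[OF assms(1)] by (cases "m + int q = int q'") simp_all
  then show ?case
    unfolding twisted_form_ee by (intro Bochner_Integration.integrable_sum)
qed (auto simp: twisted_form_add twisted_form_scale)

text \<open>
  By linearity the multiplier may be taken to be a character \<open>e(m k)\<close>.  By invariance, each pair
  \<open>(q, q + m)\<close> then contributes the same correlation, which is the Fourier coefficient of the spectral measure, and there are
  \<open>R - |m|\<close> such pairs.
\<close>

lemma twisted_form_tendsto:
  assumes f: "square_integrable \<mu> f" and \<sigma>: "is_spectral_measure \<mu> f \<sigma>" and "trig_poly g"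
  shows "(\<lambda>R. (LINT \<Lambda>|\<mu>. twisted_form g (orbit_values f H t \<Lambda>) R) / of_nat R)
     \<longlonglongrightarrow> (LINT k|\<sigma>. g (real H * k))"
  using assms(3)
proof induction
  case (trig_poly_ee m)
  define I where "I = (LINT k|\<sigma>. ee (of_int m * (real H * k)))"
  have "(LINT \<Lambda>|\<mu>. twisted_form (\<lambda>k. ee (of_int m * k)) (orbit_values f H t \<Lambda>) R)
      = of_real (\<Sum>q<R. \<Sum>q'<R. if m + int q = int q' then 1 else (0::real)) * I" for R
  proof -
    have *: "integrable \<mu> (\<lambda>\<Lambda>. if m + int q = int q' then orbit_values f H t \<Lambda> q * cnj (orbit_values f H t \<Lambda> q') else 0)" for q q'
      using integrable_orbit_product[OF f] by (cases "m + int q = int q'") simp_all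
    have **: "(LINT \<Lambda>|\<mu>. (if m + int q = int q' then orbit_values f H t \<Lambda> q * cnj (orbit_values f H t \<Lambda> q') else 0))
        = of_real (if m + int q = int q' then 1 else (0::real)) * I" for q q'
      using orbit_values_correlation[OF f \<sigma>, of m q q' H t] by (simp add: I_def)
    have "(LINT \<Lambda>|\<mu>. twisted_form (\<lambda>k. ee (of_int m * k)) (orbit_values f H t \<Lambda>) R)
       = (\<Sum>q<R. LINT \<Lambda>|\<mu>. (\<Sum>q'<R. if m + int q = int q' then orbit_values f H t \<Lambda> q * cnj (orbit_values f H t \<Lambda> q') else 0))"
      unfolding twisted_form_ee
      by (rule Bochner_Integration.integral_sum) (intro Bochner_Integration.integrable_sum *)
    also have "\<dots> = (\<Sum>q<R. \<Sum>q'<R. LINT \<Lambda>|\<mu>. (if m + int q = int q' then orbit_values f H t \<Lambda> q * cnj (orbit_values f H t \<Lambda> q') else 0))"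
      by (rule sum.cong[OF refl], rule Bochner_Integration.integral_sum) (rule *)
    also have "\<dots> = (\<Sum>q<R. \<Sum>q'<R. of_real (if m + int q = int q' then 1 else (0::real)) * I)"
      by (simp only: **)
    finally show ?thesis by (simp only: of_real_sum sum_distrib_right)
  qed
  then have "(\<lambda>R. (LINT \<Lambda>|\<mu>. twisted_form (\<lambda>k. ee (of_int m * k)) (orbit_values f H t \<Lambda>) R) / of_nat R)
     = (\<lambda>R. of_real ((\<Sum>q<R. \<Sum>q'<R. if m + int q = int q' then 1 else (0::real)) / real R) * I)"
    by (simp add: fun_eq_iff)
  also have "\<dots> \<longlonglongrightarrow> of_real 1 * I"
    by (intro tendsto_intros pair_count_tendsto)
  finally show ?case by (simp add: I_def)
next
  case (trig_poly_add g h)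
  have \<sigma>': "finite_measure \<sigma>" "sets \<sigma> = sets borel" using \<sigma> by (auto simp: is_spectral_measure_def)
  have "(LINT k|\<sigma>. g (real H * k) + h (real H * k)) = (LINT k|\<sigma>. g (real H * k)) + (LINT k|\<sigma>. h (real H * k))"
    using trig_poly_comp_scale[of _ H] trig_poly_add.hyps \<sigma>'
    by (intro Bochner_Integration.integral_add integrable_trig_poly) auto
  then show ?case
    using tendsto_add[OF trig_poly_add.IH] trig_poly_add.hyps
    by (simp add: twisted_form_add integrable_twisted_form f add_divide_distrib)
next
  case (trig_poly_scale g c)
  then show ?case
    using tendsto_mult_left[OF trig_poly_scale.IH, of c]
    by (simp add: twisted_form_scale)
qed

lemma integral_energy_tendsto:
  assumes f: "square_integrable \<mu> f" and \<sigma>: "is_spectral_measure \<mu> f \<sigma>" and D: "multiplier D"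
  shows "(\<lambda>R. (LINT \<Lambda>|\<mu>. energy D (orbit_values f H t \<Lambda>) {..<R}) / real R) \<longlonglongrightarrow> (LINT k|\<sigma>. D (real H * k))"
proof -
  have eq: "twisted_form (\<lambda>k. of_real (D k)) x R = of_real (energy D x {..<R})" for x R
    unfolding twisted_form_def by (rule energy_complex[OF D, symmetric])
  have "(\<lambda>R. complex_of_real ((LINT \<Lambda>|\<mu>. energy D (orbit_values f H t \<Lambda>) {..<R}) / real R))
      \<longlonglongrightarrow> complex_of_real (LINT k|\<sigma>. D (real H * k))"
    using twisted_form_tendsto[OF f \<sigma> multiplierD(1)[OF D], of H t] unfolding eq by simp
  then show ?thesis by (simp only: tendsto_of_real_iff)
qed

lemma integrable_energy:
  assumes f: "square_integrable \<mu> f" and D: "multiplier D"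
  shows "integrable \<mu> (\<lambda>\<Lambda>. energy D (orbit_values f H t \<Lambda>) {..<R})"
proof -
  have eq: "twisted_form (\<lambda>k. of_real (D k)) x R = of_real (energy D x {..<R})" for x
    unfolding twisted_form_def by (rule energy_complex[OF D, symmetric])
  from integrable_Re[OF integrable_twisted_form[OF f multiplierD(1)[OF D], of H t R]]
  show ?thesis by (simp add: eq)
qed

lemma integral_energy_le:
  assumes f: "square_integrable \<mu> f" and D: "multiplier D"
  shows "(LINT \<Lambda>|\<mu>. energy D (orbit_values f H t \<Lambda>) {..<R}) \<le> real R * (LINT \<Lambda>|\<mu>. (cmod (f \<Lambda>))\<^sup>2)"
proof -
  have [measurable]: "f \<in> borel_measurable \<mu>" using f by (simp add: square_integrable_def)
  have int: "integrable \<mu> (\<lambda>\<Lambda>. (cmod (orbit_values f H t \<Lambda> q))\<^sup>2)" for q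
    using square_integrable_translate[OF f] unfolding orbit_values_def complex_mod_cnj
    by (simp add: square_integrable_def)
  have "(LINT \<Lambda>|\<mu>. energy D (orbit_values f H t \<Lambda>) {..<R})
      \<le> (LINT \<Lambda>|\<mu>. (\<Sum>q<R. (cmod (orbit_values f H t \<Lambda> q))\<^sup>2))"
    by (intro integral_mono integrable_energy f D Bochner_Integration.integrable_sum int
          energy_le_sum_squares finite_lessThan)
  also have "\<dots> = (\<Sum>q<R. LINT \<Lambda>|\<mu>. (cmod (orbit_values f H t \<Lambda> q))\<^sup>2)"
    by (rule Bochner_Integration.integral_sum) (rule int)
  also have "\<dots> = (\<Sum>q<R. LINT \<Lambda>|\<mu>. (cmod (f \<Lambda>))\<^sup>2)"
    unfolding orbit_values_def complex_mod_cnj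
    by (intro sum.cong refl integral_translate[of "\<lambda>\<Lambda>. (cmod (f \<Lambda>))\<^sup>2"]) measurable
  finally show ?thesis by simp
qed

lemma block_code_local_function:
  assumes f: "local_function Y r f" and \<Lambda>: "\<Lambda> \<in> Y" "\<Lambda> = tiling_of x w" "0 \<le> x" "x < 1"
    and r': "r + 1 \<le> real r'"
  shows "block_code w r' (\<lambda>j. h (f (translate (- of_int j) \<Lambda>)))"
  unfolding block_code_def
proof (intro allI impI)
  fix j j' assume agree: "\<forall>i. \<bar>i\<bar> \<le> int r' \<longrightarrow> w (j + i) = w (j' + i)"
  have tr: "translate (- of_int j) \<Lambda> = tiling_of x (\<lambda>n. w (n + j))" for j
    using tiling_of_shift[of x "- j" w] unfolding \<Lambda>(2) translate_tiling_of by simp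
  have "agree_within r (translate (- of_int j) \<Lambda>) (translate (- of_int j') \<Lambda>)"
    unfolding agree_within_def tr
  proof (intro allI impI)
    fix i y assume y: "\<bar>y\<bar> \<le> r"
    have "w (n + j) = w (n + j')" if "y = x + of_int n" for n
    proof -
      have "\<bar>real_of_int n\<bar> \<le> real r'" using y that \<Lambda>(3,4) r' by linarith
      then have "\<bar>n\<bar> \<le> int r'" by linarith
      then have "w (j + n) = w (j' + n)" using agree by blast
      then show ?thesis by (simp only: add.commute)
    qed
    then show "y \<in> tiling_of x (\<lambda>n. w (n + j)) i \<longleftrightarrow> y \<in> tiling_of x (\<lambda>n. w (n + j')) i"
      by (auto simp: tiling_of_def)
  qed
  then have "f (translate (- of_int j) \<Lambda>) = f (translate (- of_int j') \<Lambda>)"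
    using f translate_in_Y[OF \<Lambda>(1)] unfolding local_function_def by blast
  then show "h (f (translate (- of_int j) \<Lambda>)) = h (f (translate (- of_int j') \<Lambda>))" by simp
qed

end

locale abelian_system =
  abelian_columns \<rho> L d \<phi> \<kappa> ev + invariant_system \<rho> Y \<mu>
  for \<rho> :: "'a::finite substitution" and L d \<phi> \<kappa> ev Y \<mu>
begin

text \<open>
  The energy of the orbit of \<open>f\<close> is at most twice the sum of those of \<open>f0\<close> and \<open>f - f0\<close>.  The former is bounded
  pointwise, on average over the offsets \<open>t\<close>; the latter by the square mean of \<open>f - f0\<close>.  By invariance the
  limit for \<open>f\<close> is the same for every offset, so averaging over \<open>t\<close> loses nothing.
\<close>

lemma integral_damp_le:
  assumes f: "square_integrable \<mu> f" and \<sigma>: "is_spectral_measure \<mu> f \<sigma>"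
    and f0: "f0 \<in> borel_measurable \<mu>" "local_function Y r f0" "\<And>\<Lambda>. cmod (f0 \<Lambda>) \<le> K"
    and r': "r + 1 \<le> real r'"
    and damp: "\<And>b u K. legal_word \<rho> b \<Longrightarrow> (\<And>a. cmod (u a) \<le> K) \<Longrightarrow>
       energy D (\<lambda>q. u (b ! q)) {..<length b} \<le> K\<^sup>2 * (\<beta> * real (length b) + \<eta>)"
    and D: "multiplier D" and nonneg: "\<beta> \<ge> 0" "\<eta> \<ge> 0"
  shows "(LINT k|\<sigma>. D (real (L ^ N) * k))
     \<le> 2 * K\<^sup>2 * \<beta> + 4 * real r' * K\<^sup>2 / real (L ^ N) + 2 * (LINT \<Lambda>|\<mu>. (cmod (f \<Lambda> - f0 \<Lambda>))\<^sup>2)"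
proof -
  define H where "H = L ^ N"
  have H: "real H > 0" by (simp add: H_def)
  define \<epsilon> where "\<epsilon> = (LINT \<Lambda>|\<mu>. (cmod (f \<Lambda> - f0 \<Lambda>))\<^sup>2)"
  define I where "I h t R = (LINT \<Lambda>|\<mu>. energy D (orbit_values h H t \<Lambda>) {..<R})" for h t R
  have sf0: "square_integrable \<mu> f0" by (rule square_integrable_bounded[OF f0(1,3)])
  have sdiff: "square_integrable \<mu> (\<lambda>\<Lambda>. f \<Lambda> - f0 \<Lambda>)" by (rule square_integrable_diff[OF f sf0])
  have split: "I f t R \<le> 2 * I f0 t R + 2 * (real R * \<epsilon>)" for t R
  proof -
    have "I f t R \<le> (LINT \<Lambda>|\<mu>. 2 * energy D (orbit_values f0 H t \<Lambda>) {..<R}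
        + 2 * energy D (orbit_values (\<lambda>\<Lambda>. f \<Lambda> - f0 \<Lambda>) H t \<Lambda>) {..<R})"
      unfolding I_def
    proof (rule integral_mono)
      fix \<Lambda>
      have "orbit_values f H t \<Lambda> = (\<lambda>q. orbit_values f0 H t \<Lambda> q + orbit_values (\<lambda>\<Lambda>. f \<Lambda> - f0 \<Lambda>) H t \<Lambda> q)"
        by (simp add: orbit_values_def fun_eq_iff)
      then show "energy D (orbit_values f H t \<Lambda>) {..<R} \<le> 2 * energy D (orbit_values f0 H t \<Lambda>) {..<R}
        + 2 * energy D (orbit_values (\<lambda>\<Lambda>. f \<Lambda> - f0 \<Lambda>) H t \<Lambda>) {..<R}"
        using energy_add_le[OF D] by metis
    qed (intro integrable_energy f D Bochner_Integration.integrable_add integrable_mult_right sf0 sdiff)+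
    also have "\<dots> = 2 * I f0 t R + 2 * (LINT \<Lambda>|\<mu>. energy D (orbit_values (\<lambda>\<Lambda>. f \<Lambda> - f0 \<Lambda>) H t \<Lambda>) {..<R})"
      by (simp add: I_def integrable_energy D sf0 sdiff)
    also have "\<dots> \<le> 2 * I f0 t R + 2 * (real R * \<epsilon>)"
      unfolding \<epsilon>_def by (intro add_left_mono mult_left_mono integral_energy_le sdiff D) auto
    finally show ?thesis .
  qed
  have local_bound: "(\<Sum>t<H. I f0 t R) \<le> real H * (K\<^sup>2 * (\<beta> * real R + \<eta>)) + 2 * real r' * (real R * K\<^sup>2)" for R
  proof -
    have "(\<Sum>t<H. I f0 t R) = (LINT \<Lambda>|\<mu>. (\<Sum>t<H. energy D (orbit_values f0 H t \<Lambda>) {..<R}))"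
      unfolding I_def by (rule Bochner_Integration.integral_sum[symmetric]) (rule integrable_energy[OF sf0 D])
    also have "\<dots> \<le> (LINT \<Lambda>|\<mu>. real H * (K\<^sup>2 * (\<beta> * real R + \<eta>)) + 2 * real r' * (real R * K\<^sup>2))"
    proof (rule integral_mono)
      fix \<Lambda> assume "\<Lambda> \<in> space \<mu>"
      then have "\<Lambda> \<in> Y" by simp
      obtain x w where xw: "0 \<le> x" "x < 1" "\<Lambda> = tiling_of x w" "legal_sequence \<rho> w"
        using legal_tiling_unit_offset[OF legal[OF \<open>\<Lambda> \<in> Y\<close>]] by blast
      define G where "G j = cnj (f0 (translate (- of_int j) \<Lambda>))" for j
      have "block_code w r' G"
        unfolding G_def by (rule block_code_local_function[OF f0(2) \<open>\<Lambda> \<in> Y\<close> xw(3,1,2) r'])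
      moreover have "cmod (G j) \<le> K" for j using f0(3) by (simp add: G_def)
      ultimately have "(\<Sum>t<L ^ N. energy D (\<lambda>q. G (int t + int q * int (L ^ N))) {..<R})
          \<le> real (L ^ N) * (K\<^sup>2 * (\<beta> * real R + \<eta>)) + 2 * real r' * (real R * K\<^sup>2)"
        by (intro energy_block_code_le[OF damp D nonneg xw(4)])
      moreover have "(\<lambda>q. G (int t + int q * int H)) = orbit_values f0 H t \<Lambda>" for t
        by (simp add: G_def orbit_values_def fun_eq_iff)
      ultimately show "(\<Sum>t<H. energy D (orbit_values f0 H t \<Lambda>) {..<R})
          \<le> real H * (K\<^sup>2 * (\<beta> * real R + \<eta>)) + 2 * real r' * (real R * K\<^sup>2)"
        unfolding H_def[symmetric] by simp
    qed (intro Bochner_Integration.integrable_sum integrable_energy sf0 D, simp)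
    finally show ?thesis using prob_space by simp
  qed
  have "(\<Sum>t<H. I f t R / real R) \<le> 2 * (real H * (K\<^sup>2 * \<beta>) + 2 * real r' * K\<^sup>2) + 2 * real H * \<epsilon>
      + 2 * real H * K\<^sup>2 * \<eta> / real R" if "R > 0" for R
  proof -
    have "(\<Sum>t<H. I f t R) \<le> (\<Sum>t<H. 2 * I f0 t R + 2 * (real R * \<epsilon>))"
      by (intro sum_mono split)
    also have "\<dots> = 2 * (\<Sum>t<H. I f0 t R) + real H * (2 * (real R * \<epsilon>))"
      by (simp add: sum.distrib sum_distrib_left)
    also have "\<dots> \<le> 2 * (real H * (K\<^sup>2 * (\<beta> * real R + \<eta>)) + 2 * real r' * (real R * K\<^sup>2)) + real H * (2 * (real R * \<epsilon>))"
      by (intro add_right_mono mult_left_mono local_bound) auto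
    finally have "(\<Sum>t<H. I f t R) / real R \<le> (2 * (real H * (K\<^sup>2 * (\<beta> * real R + \<eta>)) + 2 * real r' * (real R * K\<^sup>2)) + real H * (2 * (real R * \<epsilon>))) / real R"
      by (intro divide_right_mono) auto
    also have "\<dots> = 2 * (real H * (K\<^sup>2 * \<beta>) + 2 * real r' * K\<^sup>2) + 2 * real H * \<epsilon> + 2 * real H * K\<^sup>2 * \<eta> / real R"
      using that by (simp add: field_simps)
    finally show ?thesis by (simp add: sum_divide_distrib)
  qed
  then have ev: "eventually (\<lambda>R. (\<Sum>t<H. I f t R / real R) \<le> 2 * (real H * (K\<^sup>2 * \<beta>) + 2 * real r' * K\<^sup>2) + 2 * real H * \<epsilon>
      + 2 * real H * K\<^sup>2 * \<eta> / real R) sequentially"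
    using eventually_gt_at_top[of 0] by (rule eventually_mono[rotated])
  have lim1: "(\<lambda>R. \<Sum>t<H. I f t R / real R) \<longlonglongrightarrow> (\<Sum>t<H. LINT k|\<sigma>. D (real H * k))"
    unfolding I_def by (intro tendsto_sum integral_energy_tendsto f \<sigma> D)
  have "(\<lambda>R. 2 * (real H * (K\<^sup>2 * \<beta>) + 2 * real r' * K\<^sup>2) + 2 * real H * \<epsilon> + 2 * real H * K\<^sup>2 * \<eta> / real R)
      \<longlonglongrightarrow> 2 * (real H * (K\<^sup>2 * \<beta>) + 2 * real r' * K\<^sup>2) + 2 * real H * \<epsilon> + 0"
    by (intro tendsto_intros lim_const_over_n)
  from tendsto_le[OF _ this lim1 ev]
  have "real H * (LINT k|\<sigma>. D (real H * k)) \<le> 2 * (real H * (K\<^sup>2 * \<beta>) + 2 * real r' * K\<^sup>2) + 2 * real H * \<epsilon>"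
    by simp
  also have "\<dots> = real H * (2 * K\<^sup>2 * \<beta> + 4 * real r' * K\<^sup>2 / real H + 2 * \<epsilon>)"
    using H by (simp add: field_simps)
  finally show ?thesis using H unfolding \<epsilon>_def H_def[symmetric] by (simp only: mult_le_cancel_left_pos)
qed

text \<open>
  For given \<open>\<delta>\<close>, the approximation \<open>f0\<close> of \<open>f\<close> is chosen first, then the level \<open>N\<close> in terms of the
  range of \<open>f0\<close>, and finally the damping.
\<close>

theorem spectral_measure_singular:
  assumes f: "square_integrable \<mu> f" and \<sigma>: "is_spectral_measure \<mu> f \<sigma>"
  shows "singular_measure \<sigma>"
proof (rule singular_measure_criterion[where \<psi> = "\<lambda>_. 1"])
  have fin: "finite_measure \<sigma>" using \<sigma> by (simp add: is_spectral_measure_def)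
  show sets: "sets \<sigma> = sets borel" using \<sigma> by (simp add: is_spectral_measure_def)
  fix \<delta> :: real assume "\<delta> > 0"
  obtain C E where CE: "C \<ge> 0" "\<And>i. E i \<ge> 0"
    "\<And>i b u K. i > 0 \<Longrightarrow> legal_word \<rho> b \<Longrightarrow> (\<And>a. cmod (u a) \<le> K) \<Longrightarrow>
       energy (damp i) (\<lambda>q. u (b ! q)) {..<length b} \<le> K\<^sup>2 * (C / real i * real (length b) + E i)"
    using energy_legal_word_le by blast
  obtain f0 r K where f0: "f0 \<in> borel_measurable \<mu>" "local_function Y r f0" "\<And>\<Lambda>. cmod (f0 \<Lambda>) \<le> K"
    "(LINT \<Lambda>|\<mu>. (cmod (f \<Lambda> - f0 \<Lambda>))\<^sup>2) < \<delta> / 8"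
    using local_approximation_L2[OF f, of "\<delta> / 8"] \<open>\<delta> > 0\<close> by auto
  define r' where "r' = nat \<lceil>r\<rceil> + 1"
  have r': "r + 1 \<le> real r'" unfolding r'_def by linarith
  obtain N where N: "4 * real r' * K\<^sup>2 / (\<delta> / 4) < real L ^ N"
    using real_arch_pow[of "real L"] L_ge_2 by auto
  obtain i0 where i0: "2 * K\<^sup>2 * C / (\<delta> / 4) < real i0" using reals_Archimedean2 by blast
  define g where "g i k = damp (i + i0 + 1) (real (L ^ N) * k)" for i k
  have gm [measurable]: "g i \<in> borel_measurable borel" for i
    unfolding g_def[abs_def] by (rule measurable_compose[OF _ measurable_damp]) measurable
  have "AE k in lborel. (\<lambda>i. g i k) \<longlonglongrightarrow> 1"
  proof -
    have "AE k in lborel. (\<lambda>i. damp i (0 + real (L ^ N) * k)) \<longlonglongrightarrow> 1"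
      by (rule AE_borel_affine[OF _ _ AE_damp_tendsto_1]) (use L_ge_2 in auto)
    then show ?thesis
    proof eventually_elim
      case (elim k)
      from LIMSEQ_ignore_initial_segment[OF elim, of "i0 + 1"] show ?case by (simp add: g_def add.assoc)
    qed
  qed
  moreover have "(\<integral>\<^sup>+k. ennreal (g i k * 1) \<partial>\<sigma>) \<le> ennreal \<delta>" for i
  proof -
    have ii: "i + i0 + 1 > 0" by simp
    have int: "integrable \<sigma> (g i)"
      using integrable_Re[OF integrable_trig_poly[OF trig_poly_comp_scale[OF multiplierD(1)[OF multiplier_damp[of "i + i0 + 1"]], of "L ^ N"] fin sets]]
      by (simp add: g_def[abs_def])
    have "(LINT k|\<sigma>. g i k) \<le> 2 * K\<^sup>2 * (C / real (i + i0 + 1)) + 4 * real r' * K\<^sup>2 / real (L ^ N)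
        + 2 * (LINT \<Lambda>|\<mu>. (cmod (f \<Lambda> - f0 \<Lambda>))\<^sup>2)"
      unfolding g_def
      by (rule integral_damp_le[OF f \<sigma> f0(1,2,3) r' CE(3)[OF ii] multiplier_damp _ CE(2)]) (use CE(1) in auto)
    also have "\<dots> \<le> \<delta> / 4 + \<delta> / 4 + \<delta> / 4"
    proof (intro add_mono)
      have "2 * K\<^sup>2 * C < \<delta> / 4 * real i0"
        using i0 \<open>\<delta> > 0\<close> by (simp add: field_simps)
      also have "\<dots> \<le> \<delta> / 4 * real (i + i0 + 1)" using \<open>\<delta> > 0\<close> by (intro mult_left_mono) auto
      finally show "2 * K\<^sup>2 * (C / real (i + i0 + 1)) \<le> \<delta> / 4" by (simp add: divide_le_eq)
      show "4 * real r' * K\<^sup>2 / real (L ^ N) \<le> \<delta> / 4"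
        using N \<open>\<delta> > 0\<close> L_ge_2 by (simp add: field_simps)
      show "2 * (LINT \<Lambda>|\<mu>. (cmod (f \<Lambda> - f0 \<Lambda>))\<^sup>2) \<le> \<delta> / 4" using f0(4) by simp
    qed
    also have "\<dots> \<le> \<delta>" using \<open>\<delta> > 0\<close> by simp
    finally have "(LINT k|\<sigma>. g i k) \<le> \<delta>" .
    moreover have "(\<integral>\<^sup>+k. ennreal (g i k * 1) \<partial>\<sigma>) = ennreal (LINT k|\<sigma>. g i k)"
      using nn_integral_eq_integral[OF int] multiplierD(2)[OF multiplier_damp] by (simp add: g_def[abs_def])
    ultimately show ?thesis by (simp add: ennreal_leI)
  qed
  ultimately show "\<exists>g :: nat \<Rightarrow> real \<Rightarrow> real. (\<forall>i. g i \<in> borel_measurable borel) \<and> (\<forall>i k. 0 \<le> g i k)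
       \<and> (AE k in lborel. (\<lambda>i. g i k) \<longlonglongrightarrow> 1) \<and> (\<forall>i. (\<integral>\<^sup>+k. ennreal (g i k * 1) \<partial>\<sigma>) \<le> ennreal \<delta>)"
    using gm multiplierD(2)[OF multiplier_damp] by (intro exI[of _ g]) (auto simp: g_def)
qed auto

end

section \<open>Uniform pair frequencies\<close>

lemma count_list_substitute_word:
  fixes \<rho> :: "'a::finite substitution"
  shows "count_list (substitute_word \<rho> w) i = (\<Sum>k\<in>UNIV. count_list (\<rho> k) i * count_list w k)"
proof (induction w)
  case (Cons a w)
  have "count_list (substitute_word \<rho> (a # w)) i = count_list (\<rho> a) i + (\<Sum>k\<in>UNIV. count_list (\<rho> k) i * count_list w k)"
    using Cons by (simp add: substitute_word_def)
  also have "count_list (\<rho> a) i = (\<Sum>k\<in>UNIV. if k = a then count_list (\<rho> k) i else 0)" by simp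
  finally show ?case
    by (simp only: sum.distrib[symmetric]) (intro sum.cong refl, auto)
qed (simp add: substitute_word_def)

lemma substitution_matrix_power:
  "(((**) (substitution_matrix \<rho>) ^^ n) (mat 1)) $ i $ j = real (count_list ((substitute_word \<rho> ^^ n) [j]) i)"
proof (induction n arbitrary: i)
  case (Suc n)
  then show ?case
    by (simp add: matrix_matrix_mult_def count_list_substitute_word) (simp add: substitution_matrix_def)
qed (simp add: mat_def)

lemma primitive_substitution_letters:
  assumes "primitive_substitution \<rho>"
  obtains m where "m \<ge> 1" "\<And>a b. b \<in> set ((substitute_word \<rho> ^^ m) [a])"
proof -
  obtain m where m: "m \<ge> 1" "\<And>i j. (((**) (substitution_matrix \<rho>) ^^ m) (mat 1)) $ i $ j > 0"
    using assms by (auto simp: primitive_substitution_def primitive_matrix_def)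
  have "b \<in> set ((substitute_word \<rho> ^^ m) [a])" for a b
    using m(2)[of b a] unfolding substitution_matrix_power by (metis count_notin less_irrefl of_nat_0)
  with m(1) that show thesis by blast
qed

text \<open>
  Averaging over supertiles keeps the values in the range of the preceding level, up to \<open>z / L\<^sup>n\<close>.  After \<open>m\<close> steps
  every letter occurs, in particular one at which the minimum is attained, so the oscillation shrinks by a
  fixed factor.
\<close>

lemma averaging_limit:
  fixes a :: "nat \<Rightarrow> 'a::finite \<Rightarrow> real" and y :: "nat \<Rightarrow> 'a \<Rightarrow> nat \<Rightarrow> 'a"
  assumes L: "L \<ge> 2" and a: "\<And>n x. 0 \<le> a n x" "\<And>n x. a n x \<le> 1"
    and rec: "\<And>n m x. \<bar>a (n + m) x - (\<Sum>s<L ^ m. a n (y m x s)) / real L ^ m\<bar> \<le> real z / real L ^ n"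
    and m: "m \<ge> 1" "\<And>x b. \<exists>s<L ^ m. y m x s = b"
  shows "\<exists>A. \<forall>x. (\<lambda>n. a n x) \<longlonglongrightarrow> A"
proof -
  define hi where "hi n = Max (range (a n))" for n
  define lo where "lo n = Min (range (a n))" for n
  have hi: "a n x \<le> hi n" and lo: "lo n \<le> a n x" for n x by (simp_all add: hi_def lo_def)
  have "lo n \<in> range (a n)" for n unfolding lo_def by (intro Min_in) auto
  then have lo_attained: "\<exists>b. a n b = lo n" for n by (metis imageE)
  have Lp: "real L ^ k > 0" for k using L by simp
  have upper: "a (n + k) x \<le> hi n + real z / real L ^ n" for n k x
  proof -
    have "(\<Sum>s<L ^ k. a n (y k x s)) \<le> (\<Sum>s<L ^ k. hi n)" by (intro sum_mono hi)
    then have "(\<Sum>s<L ^ k. a n (y k x s)) / real L ^ k \<le> hi n"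
      using Lp[of k] by (simp add: divide_le_eq mult.commute)
    then show ?thesis using rec[of n k x] by linarith
  qed
  have lower: "a (n + k) x \<ge> lo n - real z / real L ^ n" for n k x
  proof -
    have "(\<Sum>s<L ^ k. lo n) \<le> (\<Sum>s<L ^ k. a n (y k x s))" by (intro sum_mono lo)
    then have "lo n \<le> (\<Sum>s<L ^ k. a n (y k x s)) / real L ^ k"
      using Lp[of k] by (simp add: le_divide_eq mult.commute)
    then show ?thesis using rec[of n k x] by linarith
  qed
  define \<delta> where "\<delta> = 1 / real L ^ m"
  have "2 \<le> L ^ m" using L m(1) self_le_power[of L m] by linarith
  then have "2 \<le> real (L ^ m)" by (simp only: numeral_le_real_of_nat_iff)
  then have "2 \<le> real L ^ m" by simp
  then have \<delta>: "0 < \<delta>" "\<delta> \<le> 1 / 2"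
    using Lp[of m] divide_left_mono[of 2 "real L ^ m" 1] by (simp_all add: \<delta>_def)
  have strict: "a (n + m) x \<le> hi n - \<delta> * (hi n - lo n) + real z / real L ^ n" for n x
  proof -
    obtain b where b: "a n b = lo n" using lo_attained by blast
    obtain s0 where s0: "s0 < L ^ m" "y m x s0 = b" using m(2) by blast
    have "(\<Sum>s<L ^ m. a n (y m x s)) \<le> (\<Sum>s<L ^ m. hi n - (if s = s0 then hi n - lo n else 0))"
      using hi[of n] b s0 by (intro sum_mono) auto
    also have "\<dots> = real L ^ m * hi n - (hi n - lo n)" using s0 by (simp add: sum_subtractf)
    finally have "(\<Sum>s<L ^ m. a n (y m x s)) / real L ^ m \<le> (real L ^ m * hi n - (hi n - lo n)) / real L ^ m"
      using Lp[of m] by (intro divide_right_mono) auto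
    also have "\<dots> = hi n - \<delta> * (hi n - lo n)"
      using Lp[of m] by (simp add: \<delta>_def field_simps)
    finally show ?thesis using rec[of n m x] by linarith
  qed
  \<comment> \<open>The error term is absorbed by adding a multiple of it to the oscillation.\<close>
  define K where "K = 8 * real z + 1"
  define W where "W n = (hi n - lo n) + K / real L ^ n" for n
  define \<theta> where "\<theta> = max (1 - \<delta>) (3 / 4)"
  have \<theta>: "0 \<le> \<theta>" "\<theta> < 1" using \<delta> by (auto simp: \<theta>_def)
  have osc: "hi n - lo n \<ge> 0" for n using hi[of n undefined] lo[of n undefined] by linarith
  have W_step: "W (n + m) \<le> \<theta> * W n" for n
  proof -
    have "hi (n + m) \<le> hi n - \<delta> * (hi n - lo n) + real z / real L ^ n"
      unfolding hi_def[of "n + m"] using strict by (intro Max.boundedI) auto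
    moreover have "lo (n + m) \<ge> lo n - real z / real L ^ n"
      unfolding lo_def[of "n + m"] using lower by (intro Min.boundedI) auto
    moreover have "(1 - \<delta>) * (hi n - lo n) = hi n - lo n - \<delta> * (hi n - lo n)"
      by (simp add: algebra_simps)
    ultimately have "hi (n + m) - lo (n + m) \<le> (1 - \<delta>) * (hi n - lo n) + 2 * (real z / real L ^ n)"
      by linarith
    moreover have "K / real L ^ (n + m) = \<delta> * (K / real L ^ n)" by (simp add: \<delta>_def power_add)
    ultimately have "W (n + m) \<le> (1 - \<delta>) * (hi n - lo n) + (2 * (real z / real L ^ n) + \<delta> * (K / real L ^ n))"
      by (simp add: W_def)
    also have "\<dots> \<le> \<theta> * (hi n - lo n) + \<theta> * (K / real L ^ n)"
    proof (intro add_mono)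
      show "(1 - \<delta>) * (hi n - lo n) \<le> \<theta> * (hi n - lo n)"
        using osc by (intro mult_right_mono) (auto simp: \<theta>_def)
      have "2 * real z + \<delta> * K \<le> 1 / 4 * K + 1 / 2 * K"
        using \<delta> by (intro add_mono mult_right_mono) (auto simp: K_def)
      also have "\<dots> = 3 / 4 * K" by simp
      also have "\<dots> \<le> \<theta> * K" by (intro mult_right_mono) (auto simp: \<theta>_def K_def)
      finally have "(2 * real z + \<delta> * K) / real L ^ n \<le> \<theta> * K / real L ^ n"
        using Lp[of n] by (intro divide_right_mono) auto
      then show "2 * (real z / real L ^ n) + \<delta> * (K / real L ^ n) \<le> \<theta> * (K / real L ^ n)"
        by (simp add: add_divide_distrib)
    qed
    finally show ?thesis by (simp add: W_def distrib_left)
  qed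
  have W_iter: "W (j * m) \<le> \<theta> ^ j * W 0" for j
  proof (induction j)
    case (Suc j)
    have "W (Suc j * m) \<le> \<theta> * W (j * m)" using W_step[of "j * m"] by (simp add: add.commute)
    also have "\<dots> \<le> \<theta> * (\<theta> ^ j * W 0)" using Suc \<theta> by (intro mult_left_mono)
    finally show ?case by simp
  qed simp
  have close: "\<exists>n c. \<forall>n'\<ge>n. \<forall>x. \<bar>a n' x - c\<bar> \<le> \<epsilon>" if "\<epsilon> > 0" for \<epsilon>
  proof -
    have "(\<lambda>j. \<theta> ^ j * W 0) \<longlonglongrightarrow> 0 * W 0" using \<theta> by (intro tendsto_intros LIMSEQ_power_zero) auto
    then have "eventually (\<lambda>j. \<theta> ^ j * W 0 < \<epsilon>) sequentially"
      using that by (intro order_tendstoD) auto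
    then obtain j where "\<theta> ^ j * W 0 < \<epsilon>" by (auto dest: eventually_happens)
    then have W: "W (j * m) < \<epsilon>" using W_iter[of j] by linarith
    define n where "n = j * m"
    have "2 * (real z / real L ^ n) \<le> K / real L ^ n"
      using Lp[of n] by (simp add: K_def field_simps)
    then have width: "(hi n + real z / real L ^ n) - (lo n - real z / real L ^ n) < \<epsilon>"
      using W by (simp add: W_def n_def)
    have "\<bar>a n' x - (lo n - real z / real L ^ n)\<bar> \<le> \<epsilon>" if "n' \<ge> n" for n' x
      using upper[of n "n' - n" x] lower[of n "n' - n" x] width that by simp
    then show ?thesis by blast
  qed
  have "Cauchy (\<lambda>n. a n x)" for x
  proof (rule metric_CauchyI)
    fix \<epsilon> :: real assume "\<epsilon> > 0"
    then obtain n c where nc: "\<And>n'. n' \<ge> n \<Longrightarrow> \<bar>a n' x - c\<bar> \<le> \<epsilon> / 3" using close[of "\<epsilon> / 3"] by auto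
    have "dist (a p x) (a q x) < \<epsilon>" if "p \<ge> n" "q \<ge> n" for p q
      using nc[OF that(1)] nc[OF that(2)] \<open>\<epsilon> > 0\<close> unfolding dist_real_def by linarith
    then show "\<exists>M. \<forall>p\<ge>M. \<forall>q\<ge>M. dist (a p x) (a q x) < \<epsilon>" by blast
  qed
  then have "\<exists>l. (\<lambda>n. a n x) \<longlonglongrightarrow> l" for x
    using Cauchy_convergent_iff convergent_def by blast
  then obtain l where l: "\<And>x. (\<lambda>n. a n x) \<longlonglongrightarrow> l x" by metis
  have "l x = l x'" for x x'
  proof (rule ccontr)
    assume "l x \<noteq> l x'"
    define D where "D = \<bar>l x - l x'\<bar>"
    have "D > 0" using \<open>l x \<noteq> l x'\<close> by (simp add: D_def)
    then have "D / 3 > 0" by simp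
    from close[OF this] obtain n c where nc: "\<forall>n'\<ge>n. \<forall>y. \<bar>a n' y - c\<bar> \<le> D / 3" by blast
    have lc: "\<bar>l y - c\<bar> \<le> D / 3" for y
    proof (rule tendsto_upperbound[OF tendsto_rabs[OF tendsto_diff[OF l tendsto_const]]])
      show "\<forall>\<^sub>F n' in sequentially. \<bar>a n' y - c\<bar> \<le> D / 3"
        using eventually_ge_at_top[of n] by eventually_elim (use nc in blast)
    qed simp
    have "D \<le> \<bar>l x - c\<bar> + \<bar>l x' - c\<bar>" unfolding D_def by linarith
    with lc[of x] lc[of x'] \<open>D > 0\<close> show False by linarith
  qed
  then have "\<forall>x. (\<lambda>n. a n x) \<longlonglongrightarrow> l undefined" using l by metis
  then show ?thesis by blast
qed

text \<open>
  Positions \<open>p + z\<close> beyond the end of the word yield an unspecified letter.  This is harmless, since at most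
  \<open>z\<close> terms, all between zero and one, are affected.
\<close>

definition pair_sum :: "'a \<Rightarrow> 'a \<Rightarrow> nat \<Rightarrow> 'a list \<Rightarrow> nat \<Rightarrow> real" where
  "pair_sum i j z u p = (if u ! p = i \<and> u ! (p + z) = j then 1 else 0)"

lemma pair_sum_range: "0 \<le> pair_sum i j z u p" "pair_sum i j z u p \<le> 1"
  by (auto simp: pair_sum_def)

lemma pair_sum_window:
  assumes "\<And>p. p < M \<Longrightarrow> u ! (s + p) = v ! p"
  shows "\<bar>(\<Sum>p=s..<s + M. pair_sum i j z u p) - (\<Sum>p<M. pair_sum i j z v p)\<bar> \<le> real z"
proof -
  have "(\<Sum>p=s..<s + M. pair_sum i j z u p) = (\<Sum>p<M. pair_sum i j z u (p + s))"
    using sum.shift_bounds_nat_ivl[of "pair_sum i j z u" 0 s M] by (simp add: atLeast0LessThan add.commute)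
  then have "\<bar>(\<Sum>p=s..<s + M. pair_sum i j z u p) - (\<Sum>p<M. pair_sum i j z v p)\<bar>
      = \<bar>\<Sum>p<M. pair_sum i j z u (p + s) - pair_sum i j z v p\<bar>" by (simp add: sum_subtractf)
  also have "\<dots> \<le> (\<Sum>p<M. \<bar>pair_sum i j z u (p + s) - pair_sum i j z v p\<bar>)" by (rule sum_abs)
  also have "\<dots> \<le> (\<Sum>p<M. if p \<in> {M - z..<M} then 1 else 0)"
  proof (intro sum_mono)
    fix p assume p: "p \<in> {..<M}"
    show "\<bar>pair_sum i j z u (p + s) - pair_sum i j z v p\<bar> \<le> (if p \<in> {M - z..<M} then 1 else 0)"
    proof (cases "p + z < M")
      case True
      then have "u ! (p + s) = v ! p" "u ! (p + s + z) = v ! (p + z)"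
        using assms[of p] assms[of "p + z"] by (simp_all add: add_ac)
      then show ?thesis by (simp add: pair_sum_def)
    next
      case False
      then have "p \<in> {M - z..<M}" using p by auto
      then show ?thesis
        using pair_sum_range[of i j z u "p + s"] pair_sum_range[of i j z v p] by (simp add: abs_le_iff)
    qed
  qed
  also have "\<dots> = real (card ({..<M} \<inter> {M - z..<M}))"
    unfolding sum.inter_restrict[OF finite_lessThan, symmetric] by simp
  also have "{..<M} \<inter> {M - z..<M} = {M - z..<M}" by auto
  also have "real (card {M - z..<M}) \<le> real z" by simp
  finally show ?thesis .
qed

lemma pair_sum_blocks:
  assumes len: "\<And>a. length (\<rho> a) = L" and "q0 \<le> q1" "q1 \<le> length v"
  shows "\<bar>(\<Sum>p=q0 * L ^ n..<q1 * L ^ n. pair_sum i j z ((substitute_word \<rho> ^^ n) v) p)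
      - (\<Sum>q=q0..<q1. \<Sum>p<L ^ n. pair_sum i j z ((substitute_word \<rho> ^^ n) [v ! q]) p)\<bar> \<le> real z * real (q1 - q0)"
  using assms(2,3)
proof (induction q1 rule: dec_induct)
  case (step q)
  let ?u = "(substitute_word \<rho> ^^ n) v"
  have "\<bar>(\<Sum>p=q * L ^ n..<q * L ^ n + L ^ n. pair_sum i j z ?u p)
      - (\<Sum>p<L ^ n. pair_sum i j z ((substitute_word \<rho> ^^ n) [v ! q]) p)\<bar> \<le> real z"
  proof (rule pair_sum_window)
    fix p assume p: "p < L ^ n"
    have "q * L ^ n + p < Suc q * L ^ n" using p by simp
    also have "\<dots> \<le> L ^ n * length v" using step.prems by (metis mult.commute mult_le_mono1)
    finally have "q * L ^ n + p < L ^ n * length v" .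
    then show "?u ! (q * L ^ n + p) = (substitute_word \<rho> ^^ n) [v ! q] ! p"
    proof -
      have "(q * L ^ n + p) div L ^ n = q" using p by (intro div_nat_eqI) auto
      then show ?thesis
        using nth_substitute_word_iterate[of \<rho> L "q * L ^ n + p" n v] len p
          \<open>q * L ^ n + p < L ^ n * length v\<close> by simp
    qed
  qed
  moreover have "(\<Sum>p=q0 * L ^ n..<Suc q * L ^ n. pair_sum i j z ?u p)
      = (\<Sum>p=q0 * L ^ n..<q * L ^ n. pair_sum i j z ?u p) + (\<Sum>p=q * L ^ n..<q * L ^ n + L ^ n. pair_sum i j z ?u p)"
    using step.hyps sum.atLeastLessThan_concat[of "q0 * L ^ n" "q * L ^ n" "q * L ^ n + L ^ n" "pair_sum i j z ?u"]
    by (simp add: add.commute)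
  moreover have "real z * real (Suc q - q0) = real z * real (q - q0) + real z"
    using step.hyps by (simp add: Suc_diff_le distrib_left)
  moreover have "(\<Sum>q=q0..<Suc q. \<Sum>p<L ^ n. pair_sum i j z ((substitute_word \<rho> ^^ n) [v ! q]) p)
      = (\<Sum>q=q0..<q. \<Sum>p<L ^ n. pair_sum i j z ((substitute_word \<rho> ^^ n) [v ! q]) p)
        + (\<Sum>p<L ^ n. pair_sum i j z ((substitute_word \<rho> ^^ n) [v ! q]) p)"
    using step.hyps by simp
  moreover have "q \<le> length v" using step.prems by simp
  note step.IH[OF this]
  ultimately show ?case by linarith
qed simp

text \<open>
  The frequencies in supertiles of level \<open>n\<close> converge to a limit that does not depend on their type.  A long
  legal word consists of such supertiles, up to its two ends and the pairs that straddle a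
  boundary.
\<close>

theorem uniform_pair_frequency_nat:
  fixes \<rho> :: "'a::finite substitution"
  assumes "constant_length L \<rho>" "primitive_substitution \<rho>"
  obtains A where "\<And>\<epsilon>. \<epsilon> > 0 \<Longrightarrow> \<exists>R0. \<forall>R\<ge>R0. \<forall>b. legal_word \<rho> b \<longrightarrow> length b = R \<longrightarrow>
     \<bar>(\<Sum>p<R. pair_sum i j z b p) / real R - A\<bar> \<le> \<epsilon>"
proof -
  have L: "L \<ge> 2" and len: "\<And>a. length (\<rho> a) = L" using assms(1) by (auto simp: constant_length_def)
  have Lpos: "L ^ n > 0" for n using L by simp
  obtain m where m: "m \<ge> 1" "\<And>a b. b \<in> set ((substitute_word \<rho> ^^ m) [a])"
    using primitive_substitution_letters[OF assms(2)] by blast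
  define f where "f n a = (\<Sum>p<L ^ n. pair_sum i j z ((substitute_word \<rho> ^^ n) [a]) p) / real L ^ n" for n a
  have "\<exists>A. \<forall>x. (\<lambda>n. f n x) \<longlonglongrightarrow> A"
  proof (rule averaging_limit[OF L])
    show "0 \<le> f n x" for n x
      by (auto simp: f_def pair_sum_range intro!: divide_nonneg_nonneg sum_nonneg)
    show "f n x \<le> 1" for n x
    proof -
      have "(\<Sum>p<L ^ n. pair_sum i j z ((substitute_word \<rho> ^^ n) [x]) p) \<le> (\<Sum>p<L ^ n. 1)"
        by (intro sum_mono pair_sum_range)
      then show ?thesis using L by (simp add: f_def)
    qed
    show "m \<ge> 1" by (rule m)
    show "\<exists>s<L ^ m. (substitute_word \<rho> ^^ m) [x] ! s = b" for x b
      using m(2)[of b x] length_substitute_word_iterate[of \<rho> L m "[x]"] len by (auto simp: in_set_conv_nth)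
    fix n k x
    let ?v = "(substitute_word \<rho> ^^ k) [x]"
    have lv: "length ?v = L ^ k" using length_substitute_word_iterate[of \<rho> L k "[x]"] len by simp
    have "(substitute_word \<rho> ^^ (n + k)) [x] = (substitute_word \<rho> ^^ n) ?v" by (simp add: funpow_add)
    then have eq: "f (n + k) x = (\<Sum>p<L ^ k * L ^ n. pair_sum i j z ((substitute_word \<rho> ^^ n) ?v) p) / (real L ^ k * real L ^ n)"
      by (simp add: f_def power_add mult.commute)
    have "\<bar>(\<Sum>p<L ^ k * L ^ n. pair_sum i j z ((substitute_word \<rho> ^^ n) ?v) p)
       - (\<Sum>q<L ^ k. \<Sum>p<L ^ n. pair_sum i j z ((substitute_word \<rho> ^^ n) [?v ! q]) p)\<bar> \<le> real z * real L ^ k"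
      using pair_sum_blocks[OF len, of 0 "L ^ k" ?v i j z n] lv by (simp add: atLeast0LessThan)
    moreover have "(\<Sum>q<L ^ k. \<Sum>p<L ^ n. pair_sum i j z ((substitute_word \<rho> ^^ n) [?v ! q]) p)
        = real L ^ n * (\<Sum>q<L ^ k. f n (?v ! q))"
      using L by (simp add: f_def sum_divide_distrib[symmetric])
    ultimately have "\<bar>f (n + k) x * (real L ^ k * real L ^ n) - real L ^ n * (\<Sum>q<L ^ k. f n (?v ! q))\<bar> \<le> real z * real L ^ k"
      using L by (simp add: eq)
    also have "f (n + k) x * (real L ^ k * real L ^ n) - real L ^ n * (\<Sum>q<L ^ k. f n (?v ! q))
       = (f (n + k) x - (\<Sum>q<L ^ k. f n (?v ! q)) / real L ^ k) * (real L ^ k * real L ^ n)"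
      using L by (simp add: field_simps)
    finally have "\<bar>f (n + k) x - (\<Sum>q<L ^ k. f n (?v ! q)) / real L ^ k\<bar> * (real L ^ k * real L ^ n) \<le> real z * real L ^ k"
      using L by (simp add: abs_mult)
    then show "\<bar>f (n + k) x - (\<Sum>s<L ^ k. f n ((substitute_word \<rho> ^^ k) [x] ! s)) / real L ^ k\<bar> \<le> real z / real L ^ n"
      using L by (simp add: field_simps)
  qed
  then obtain A where A: "\<And>x. (\<lambda>n. f n x) \<longlonglongrightarrow> A" by blast
  show thesis
  proof (rule that)
    fix \<epsilon> :: real assume "\<epsilon> > 0"
    have "eventually (\<lambda>n. \<forall>x\<in>UNIV. \<bar>f n x - A\<bar> < \<epsilon> / 3) sequentially"
    proof (intro eventually_ball_finite ballI)
      fix x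
      show "eventually (\<lambda>n. \<bar>f n x - A\<bar> < \<epsilon> / 3) sequentially"
        using tendstoD[OF A[of x], of "\<epsilon> / 3"] \<open>\<epsilon> > 0\<close> unfolding dist_real_def by simp
    qed simp
    moreover have "eventually (\<lambda>n. real z / real L ^ n < \<epsilon> / 3) sequentially"
    proof (rule order_tendstoD)
      show "(\<lambda>n. real z / real L ^ n) \<longlonglongrightarrow> 0"
        using L by (intro LIMSEQ_divide_realpow_zero) auto
    qed (use \<open>\<epsilon> > 0\<close> in simp)
    ultimately obtain n where n: "\<And>x. \<bar>f n x - A\<bar> < \<epsilon> / 3" "real z / real L ^ n < \<epsilon> / 3"
      using eventually_happens[OF eventually_conj] by fastforce
    define M where "M = L ^ n"
    have M: "real M > 0" using Lpos by (simp add: M_def)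
    define E where "E = 2 * \<bar>A\<bar> * real M + 2 * real M + 3 * real z + 2 * (\<epsilon> / 3) * real M"
    define R0 where "R0 = M + 1 + nat \<lceil>E / (\<epsilon> / 3)\<rceil>"
    have "\<bar>(\<Sum>p<R. pair_sum i j z b p) / real R - A\<bar> \<le> \<epsilon>"
      if R: "R \<ge> R0" and b: "legal_word \<rho> b" "length b = R" for R b
    proof -
      have "R > 0" "length b > L ^ n" using R b by (auto simp: R0_def M_def)
      obtain v s where v: "s + length b \<le> M * length v" "\<And>q. q < length b \<Longrightarrow> b ! q = (substitute_word \<rho> ^^ n) v ! (s + q)"
        using legal_word_desubstitute[of \<rho> L b n] len L b(1) \<open>length b > L ^ n\<close> unfolding M_def by metis
      obtain q0 q1 where q: "q1 \<le> length v" "q0 \<le> q1" "q0 * M \<le> s" "s + length b \<le> q1 * M"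
        "q1 * M - q0 * M \<le> length b + 2 * M"
        using covering_blocks[OF _ v(1)] Lpos M_def by metis
      let ?u = "(substitute_word \<rho> ^^ n) v"
      define T where "T = (\<Sum>p=q0 * M..<q1 * M. pair_sum i j z ?u p)"
      define S where "S = (\<Sum>p<R. pair_sum i j z b p)"
      define W where "W = (\<Sum>p=s..<s + R. pair_sum i j z ?u p)"
      define B where "B = (\<Sum>q=q0..<q1. \<Sum>p<M. pair_sum i j z ((substitute_word \<rho> ^^ n) [v ! q]) p)"
      define N where "N = real (q1 - q0)"
      have NM: "N * real M \<le> real R + 2 * real M"
      proof -
        have "real ((q1 - q0) * M) \<le> real (R + 2 * M)"
          using q(5) b(2) by (simp only: diff_mult_distrib of_nat_le_iff)
        then show ?thesis by (simp add: N_def)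
      qed
      have NM': "real R \<le> N * real M"
      proof -
        have "R \<le> (q1 - q0) * M" using q b(2) by (simp add: diff_mult_distrib)
        then have "real R \<le> real ((q1 - q0) * M)" by (simp only: of_nat_le_iff)
        then show ?thesis by (simp add: N_def)
      qed
      have 1: "\<bar>W - S\<bar> \<le> real z"
        unfolding W_def S_def by (rule pair_sum_window) (use v(2) b(2) in simp)
      have 2: "\<bar>T - B\<bar> \<le> real z * N"
        unfolding T_def B_def N_def M_def by (rule pair_sum_blocks[OF len q(2,1)])
      have 3: "\<bar>T - W\<bar> \<le> 2 * real M"
      proof -
        have sub: "{s..<s + R} \<subseteq> {q0 * M..<q1 * M}" using q b(2) by auto
        have "T - W = (\<Sum>p\<in>{q0 * M..<q1 * M} - {s..<s + R}. pair_sum i j z ?u p)"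
          unfolding T_def W_def by (subst sum_diff[OF _ sub]) auto
        moreover have "0 \<le> (\<Sum>p\<in>{q0 * M..<q1 * M} - {s..<s + R}. pair_sum i j z ?u p)"
          by (intro sum_nonneg pair_sum_range)
        moreover have "(\<Sum>p\<in>{q0 * M..<q1 * M} - {s..<s + R}. pair_sum i j z ?u p)
            \<le> (\<Sum>p\<in>{q0 * M..<q1 * M} - {s..<s + R}. 1)"
          by (intro sum_mono pair_sum_range)
        moreover have "card ({q0 * M..<q1 * M} - {s..<s + R}) \<le> 2 * M"
          using q(5) b(2) by (subst card_Diff_subset[OF _ sub]) auto
        ultimately show ?thesis by (simp flip: of_nat_mult)
      qed
      have 4: "\<bar>B - N * real M * A\<bar> \<le> \<epsilon> / 3 * (N * real M)"
      proof -
        have "B = (\<Sum>q=q0..<q1. real M * f n (v ! q))"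
          using M by (simp add: B_def f_def M_def)
        then have "B - N * real M * A = (\<Sum>q=q0..<q1. real M * (f n (v ! q) - A))"
          by (simp add: N_def right_diff_distrib sum_subtractf)
        then have "\<bar>B - N * real M * A\<bar> \<le> (\<Sum>q=q0..<q1. \<bar>real M * (f n (v ! q) - A)\<bar>)"
          by (simp only: sum_abs)
        also have "\<dots> \<le> (\<Sum>q=q0..<q1. real M * (\<epsilon> / 3))"
        proof (intro sum_mono)
          fix q
          have "\<bar>f n (v ! q) - A\<bar> \<le> \<epsilon> / 3" by (rule less_imp_le[OF n(1)])
          then show "\<bar>real M * (f n (v ! q) - A)\<bar> \<le> real M * (\<epsilon> / 3)"
            unfolding abs_mult abs_of_nat by (rule mult_left_mono) simp
        qed
        finally show ?thesis by (simp add: N_def mult_ac)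
      qed
      have 5: "\<bar>N * real M * A - real R * A\<bar> \<le> 2 * real M * \<bar>A\<bar>"
      proof -
        have "\<bar>N * real M * A - real R * A\<bar> = \<bar>N * real M - real R\<bar> * \<bar>A\<bar>"
          by (simp add: abs_mult[symmetric] left_diff_distrib)
        also have "\<dots> \<le> 2 * real M * \<bar>A\<bar>" using NM NM' by (intro mult_right_mono) auto
        finally show ?thesis .
      qed
      have 6: "real z * N \<le> \<epsilon> / 3 * real R + 2 * real z"
      proof -
        have "N \<le> real R / real M + 2" using NM M by (simp add: field_simps)
        then have "real z * N \<le> real z * (real R / real M + 2)" by (intro mult_left_mono) auto
        also have "\<dots> = real z / real M * real R + 2 * real z" using M by (simp add: field_simps)
        also have "\<dots> \<le> \<epsilon> / 3 * real R + 2 * real z"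
          using n(2) by (intro add_right_mono mult_right_mono) (auto simp: M_def)
        finally show ?thesis .
      qed
      have "\<epsilon> / 3 * (N * real M) \<le> \<epsilon> / 3 * (real R + 2 * real M)"
        using NM \<open>\<epsilon> > 0\<close> by (intro mult_left_mono) auto
      also have "\<dots> = \<epsilon> / 3 * real R + 2 * (\<epsilon> / 3) * real M" by (simp add: distrib_left)
      finally have 7: "\<epsilon> / 3 * (N * real M) \<le> \<epsilon> / 3 * real R + 2 * (\<epsilon> / 3) * real M" .
      have "2 * real M * \<bar>A\<bar> = 2 * \<bar>A\<bar> * real M" by simp
      then have "\<bar>S - real R * A\<bar> \<le> 2 * (\<epsilon> / 3 * real R) + E"
        using 1 2 3 4 5 6 7 unfolding E_def by linarith
      also have "E \<le> \<epsilon> / 3 * real R"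
      proof -
        have "E / (\<epsilon> / 3) \<le> real R0" unfolding R0_def by linarith
        also have "\<dots> \<le> real R" using R by simp
        finally show ?thesis using \<open>\<epsilon> > 0\<close> by (simp add: field_simps)
      qed
      finally have "\<bar>S - real R * A\<bar> \<le> \<epsilon> * real R" by simp
      moreover have "S / real R - A = (S - real R * A) / real R" using \<open>R > 0\<close> by (simp add: field_simps)
      ultimately show ?thesis using \<open>R > 0\<close> by (simp add: S_def abs_divide divide_le_eq)
    qed
    then show "\<exists>R0. \<forall>R\<ge>R0. \<forall>b. legal_word \<rho> b \<longrightarrow> length b = R \<longrightarrow>
     \<bar>(\<Sum>p<R. pair_sum i j z b p) / real R - A\<bar> \<le> \<epsilon>" by blast
  qed
qed

text \<open>
  Uniformity in the position \<open>s\<close> makes the density invariant under shifts, which is needed for negative distances, and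
  lets the windows \<open>[-R, R]\<close> be used.
\<close>

definition uniform_density :: "(int \<Rightarrow> bool) \<Rightarrow> real \<Rightarrow> bool" where
  "uniform_density p A \<longleftrightarrow> (\<forall>\<epsilon>>0. \<exists>R0. \<forall>R\<ge>R0. \<forall>s.
     \<bar>(\<Sum>q<R. if p (s + int q) then 1 else 0) / real R - A\<bar> \<le> \<epsilon>)"

lemma uniform_density_shift:
  assumes "uniform_density p A"
  shows "uniform_density (\<lambda>n. p (n + t)) A"
  unfolding uniform_density_def
proof (intro allI impI)
  fix \<epsilon> :: real assume "\<epsilon> > 0"
  then obtain R0 where R0: "\<And>R s. R \<ge> R0 \<Longrightarrow> \<bar>(\<Sum>q<R. if p (s + int q) then 1 else 0) / real R - A\<bar> \<le> \<epsilon>"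
    using assms unfolding uniform_density_def by blast
  have "\<bar>(\<Sum>q<R. if p (s + int q + t) then 1 else 0) / real R - A\<bar> \<le> \<epsilon>" if "R \<ge> R0" for R s
    using R0[OF that, of "s + t"] by (simp add: add_ac)
  then show "\<exists>R0. \<forall>R\<ge>R0. \<forall>s. \<bar>(\<Sum>q<R. if p (s + int q + t) then 1 else 0) / real R - A\<bar> \<le> \<epsilon>" by blast
qed

theorem uniform_pair_frequency:
  fixes \<rho> :: "'a::finite substitution"
  assumes "constant_length L \<rho>" "primitive_substitution \<rho>" "legal_sequence \<rho> w"
  shows "\<exists>A. uniform_density (\<lambda>n. w n = i \<and> w (n + z) = j) A"
proof -
  have nonneg: "\<exists>A. uniform_density (\<lambda>n. w n = i \<and> w (n + int z) = j) A" for i j z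
  proof -
    obtain A where A: "\<And>\<epsilon>. \<epsilon> > 0 \<Longrightarrow> \<exists>R0. \<forall>R\<ge>R0. \<forall>b. legal_word \<rho> b \<longrightarrow> length b = R \<longrightarrow>
     \<bar>(\<Sum>p<R. pair_sum i j z b p) / real R - A\<bar> \<le> \<epsilon>"
      using uniform_pair_frequency_nat[OF assms(1,2)] by blast
    have "uniform_density (\<lambda>n. w n = i \<and> w (n + int z) = j) A"
      unfolding uniform_density_def
    proof (intro allI impI)
      fix \<epsilon> :: real assume "\<epsilon> > 0"
      then obtain R1 where R1: "\<And>R b. R \<ge> R1 \<Longrightarrow> legal_word \<rho> b \<Longrightarrow> length b = R \<Longrightarrow>
          \<bar>(\<Sum>p<R. pair_sum i j z b p) / real R - A\<bar> \<le> \<epsilon> / 2"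
        using A[of "\<epsilon> / 2"] by auto
      define R0 where "R0 = R1 + 1 + nat \<lceil>real z / (\<epsilon> / 2)\<rceil>"
      have "\<bar>(\<Sum>q<R. if w (s + int q) = i \<and> w (s + int q + int z) = j then 1 else 0) / real R - A\<bar> \<le> \<epsilon>"
        if R: "R \<ge> R0" for R s
      proof -
        have "R > 0" using R by (simp add: R0_def)
        define u where "u = map w [s..s + int (R + z)]"
        define b where "b = map w [s..s + int R - 1]"
        have b: "legal_word \<rho> b" "length b = R" using assms(3) by (simp_all add: b_def legal_sequence_def)
        have u: "u ! q = w (s + int q)" if "q \<le> R + z" for q
          using that unfolding u_def by (subst nth_map) auto
        have bu: "u ! (0 + p) = b ! p" if "p < R" for p
          using that u[of p] by (simp add: b_def)
        define X where "X = (\<Sum>p<R. pair_sum i j z u p)"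
        define Y where "Y = (\<Sum>p<R. pair_sum i j z b p)"
        have XY: "\<bar>X - Y\<bar> \<le> real z"
          using pair_sum_window[of R u 0 b i j z, OF bu] by (simp add: X_def Y_def atLeast0LessThan)
        have Xeq: "X = (\<Sum>q<R. if w (s + int q) = i \<and> w (s + int q + int z) = j then 1 else 0)"
          unfolding X_def by (intro sum.cong refl) (simp add: pair_sum_def u add.assoc)
        have zR: "real z \<le> \<epsilon> / 2 * real R"
        proof -
          have "real z / (\<epsilon> / 2) \<le> real R0" unfolding R0_def by linarith
          also have "\<dots> \<le> real R" using R by simp
          finally show ?thesis using \<open>\<epsilon> > 0\<close> by (simp add: field_simps)
        qed
        have "\<bar>Y / real R - A\<bar> \<le> \<epsilon> / 2"
          unfolding Y_def by (rule R1) (use R b in \<open>auto simp: R0_def\<close>)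
        moreover have "\<bar>X / real R - Y / real R\<bar> \<le> \<epsilon> / 2"
          using XY zR \<open>R > 0\<close> by (simp add: diff_divide_distrib[symmetric] abs_divide divide_le_eq)
        ultimately have "\<bar>X / real R - A\<bar> \<le> \<epsilon>" by linarith
        then show ?thesis by (simp only: Xeq)
      qed
      then show "\<exists>R0. \<forall>R\<ge>R0. \<forall>s. \<bar>(\<Sum>q<R. if w (s + int q) = i \<and> w (s + int q + int z) = j then 1 else 0) / real R - A\<bar> \<le> \<epsilon>"
        by blast
    qed
    then show ?thesis by blast
  qed
  show ?thesis
  proof (cases "z \<ge> 0")
    case True
    then show ?thesis using nonneg[of i "nat z" j] by simp
  next
    case False
    obtain A where "uniform_density (\<lambda>n. w n = j \<and> w (n + int (nat (- z))) = i) A" using nonneg by blast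
    from uniform_density_shift[OF this, of z] False
    have "uniform_density (\<lambda>n. w n = i \<and> w (n + z) = j) A" by (simp add: conj_commute)
    then show ?thesis by blast
  qed
qed

section \<open>Gaussian test functions\<close>

lemma power_times_gaussian_bounded: "\<bar>x\<bar> ^ i * exp (- x\<^sup>2 / 2) \<le> (real i) ^ i * exp (1 / 2)" for x :: real
proof -
  have "\<bar>x\<bar> ^ i \<le> (real i) ^ i * exp \<bar>x\<bar>"
  proof (cases "i = 0")
    case False
    have "\<bar>x\<bar> / real i \<le> exp (\<bar>x\<bar> / real i)"
      using exp_ge_add_one_self[of "\<bar>x\<bar> / real i"] by linarith
    then have "(\<bar>x\<bar> / real i) ^ i \<le> exp (\<bar>x\<bar> / real i) ^ i" by (intro power_mono) auto
    also have "\<dots> = exp \<bar>x\<bar>" using False by (simp flip: exp_of_nat_mult)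
    finally show ?thesis using False by (simp add: power_divide divide_le_eq mult.commute)
  qed simp
  then have "\<bar>x\<bar> ^ i * exp (- x\<^sup>2 / 2) \<le> (real i) ^ i * exp \<bar>x\<bar> * exp (- x\<^sup>2 / 2)"
    by (intro mult_right_mono) auto
  also have "\<dots> = (real i) ^ i * exp (\<bar>x\<bar> - x\<^sup>2 / 2)" by (simp add: mult.assoc flip: exp_add)
  also have "\<dots> \<le> (real i) ^ i * exp (1 / 2)"
  proof -
    have "0 \<le> (\<bar>x\<bar> - 1)\<^sup>2" by simp
    then have "\<bar>x\<bar> - x\<^sup>2 / 2 \<le> 1 / 2" by (simp add: power2_diff)
    then show ?thesis by (intro mult_left_mono) auto
  qed
  finally show ?thesis .
qed

definition gaussian :: "real \<Rightarrow> real" where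
  "gaussian k = exp (- k\<^sup>2 / 2)"

text \<open>
  The derivatives of \<open>exp(a z - z\<^sup>2 / 2)\<close> are polynomial multiples of it; \<open>p n\<close> is the \<open>n\<close>-th of these
  polynomials.
\<close>

lemma schwartz_modulated_gaussian:
  "schwartz_function (\<lambda>k. ee (of_int m * k) * of_real (gaussian k))"
proof -
  define a :: complex where "a = 2 * pi * \<i> * of_int m"
  define E where "E z = exp (a * z - z\<^sup>2 / 2)" for z :: complex
  define p :: "nat \<Rightarrow> complex poly" where "p = rec_nat 1 (\<lambda>_ q. pderiv q + q * [:a, -1:])"
  have p0: "p 0 = 1" and pS: "p (Suc n) = pderiv (p n) + p n * [:a, -1:]" for n
    by (simp_all add: p_def)
  define D where "D n x = poly (p n) (of_real x) * E (of_real x)" for n and x :: real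
  have E: "E (of_real x) = ee (of_int m * x) * of_real (gaussian x)" for x
  proof -
    have "a * of_real x - (of_real x)\<^sup>2 / 2 = a * of_real x + complex_of_real (- x\<^sup>2 / 2)" by simp
    then have "E (of_real x) = exp (a * of_real x) * exp (of_real (- x\<^sup>2 / 2))"
      unfolding E_def by (simp only: exp_add)
    also have "exp (a * of_real x) = ee (of_int m * x)" by (simp add: ee_eq_exp a_def mult_ac)
    finally show ?thesis by (simp only: gaussian_def exp_of_real)
  qed
  have "(D n has_vector_derivative D (Suc n) x) (at x)" for n x
  proof -
    have "((\<lambda>z. poly (p n) z * E z) has_field_derivative
        poly (pderiv (p n)) (of_real x) * E (of_real x) + poly (p n) (of_real x) * (E (of_real x) * (a - of_real x)))
        (at (of_real x))"
      unfolding E_def by (auto intro!: derivative_eq_intros poly_DERIV simp: algebra_simps)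
    from has_vector_derivative_real_field[OF this]
    show ?thesis by (simp add: D_def[abs_def] pS algebra_simps)
  qed
  moreover have "bounded (range (\<lambda>x. (x ^ j) *\<^sub>R D n x))" for n j
  proof -
    define q where "q = monom 1 j * p n"
    define C where "C = (\<Sum>i\<le>degree q. cmod (coeff q i) * ((real i) ^ i * exp (1 / 2)))"
    have "norm ((x ^ j) *\<^sub>R D n x) \<le> C" for x
    proof -
      have "(x ^ j) *\<^sub>R D n x = poly q (of_real x) * E (of_real x)"
        by (simp add: D_def q_def poly_monom scaleR_conv_of_real)
      then have "norm ((x ^ j) *\<^sub>R D n x) = cmod (poly q (of_real x)) * exp (- x\<^sup>2 / 2)"
        by (simp add: E norm_mult gaussian_def)
      also have "\<dots> \<le> (\<Sum>i\<le>degree q. cmod (coeff q i * of_real x ^ i)) * exp (- x\<^sup>2 / 2)"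
        unfolding poly_altdef by (intro mult_right_mono norm_sum) auto
      also have "\<dots> = (\<Sum>i\<le>degree q. cmod (coeff q i) * (\<bar>x\<bar> ^ i * exp (- x\<^sup>2 / 2)))"
        by (simp add: sum_distrib_right norm_mult norm_power mult.assoc)
      also have "\<dots> \<le> C"
        unfolding C_def by (intro sum_mono mult_left_mono power_times_gaussian_bounded) auto
      finally show ?thesis .
    qed
    then show ?thesis by (auto simp: bounded_iff)
  qed
  moreover have "D 0 = (\<lambda>k. ee (of_int m * k) * of_real (gaussian k))"
    by (simp add: D_def p0 E fun_eq_iff)
  ultimately show ?thesis unfolding schwartz_function_def by blast
qed

lemma fourier_transform_gaussian:
  "fourier_transform (\<lambda>k. of_real (gaussian k)) y = of_real (sqrt (2 * pi) * exp (- (2 * pi * y)\<^sup>2 / 2))"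
proof -
  have "char std_normal_distribution (- (2 * pi * y))
      = (CLINT x|lborel. std_normal_density x *\<^sub>R iexp (- (2 * pi * y) * x))"
    unfolding char_def by (subst integral_density) auto
  also have "\<dots> = (CLINT x|lborel. of_real (1 / sqrt (2 * pi)) * (exp (- 2 * pi * \<i> * of_real (x * y)) * of_real (gaussian x)))"
    by (intro Bochner_Integration.integral_cong refl)
       (simp add: std_normal_density_def gaussian_def scaleR_conv_of_real mult_ac)
  also have "\<dots> = of_real (1 / sqrt (2 * pi)) * fourier_transform (\<lambda>k. of_real (gaussian k)) y"
    unfolding fourier_transform_def by (rule integral_mult_right_zero)
  finally have scaled: "of_real (1 / sqrt (2 * pi)) * fourier_transform (\<lambda>k. of_real (gaussian k)) y
      = of_real (exp (- (2 * pi * y)\<^sup>2 / 2))"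
    unfolding char_std_normal_distribution by simp
  have "complex_of_real (sqrt (2 * pi)) * of_real (1 / sqrt (2 * pi)) = of_real (sqrt (2 * pi) * (1 / sqrt (2 * pi)))"
    by (rule of_real_mult[symmetric])
  also have "\<dots> = 1" by simp
  finally have "fourier_transform (\<lambda>k. of_real (gaussian k)) y
      = (complex_of_real (sqrt (2 * pi)) * of_real (1 / sqrt (2 * pi))) * fourier_transform (\<lambda>k. of_real (gaussian k)) y"
    by (simp only: mult_1)
  also have "\<dots> = of_real (sqrt (2 * pi) * exp (- (2 * pi * y)\<^sup>2 / 2))"
    by (simp only: mult.assoc scaled of_real_mult)
  finally show ?thesis .
qed

lemma fourier_transform_modulate:
  "fourier_transform (\<lambda>k. ee (of_int m * k) * f k) y = fourier_transform f (y - of_int m)"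
proof -
  have "exp (- 2 * pi * \<i> * of_real (x * y)) * ee (of_int m * x) = exp (- 2 * pi * \<i> * of_real (x * (y - of_int m)))" for x
    by (simp add: ee_eq_exp algebra_simps flip: exp_add)
  then show ?thesis unfolding fourier_transform_def by (simp add: mult.assoc[symmetric])
qed

lemma summable_fourier_gaussian:
  "(\<lambda>z::int. norm (fourier_transform (\<lambda>k. of_real (gaussian k)) (of_int z))) summable_on UNIV"
proof (rule summable_on_comparison_test)
  define h where "h z = sqrt (2 * pi) * (1 / 2) ^ nat \<bar>z\<bar>" for z :: int
  have geo: "(\<lambda>n::nat. sqrt (2 * pi) * (1 / 2) ^ n) summable_on UNIV"
    by (rule norm_summable_imp_summable_on) (simp add: summable_mult norm_mult norm_power summable_geometric)
  have "h summable_on range int"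
    using geo by (subst summable_on_reindex) (auto simp: h_def comp_def)
  moreover have "h summable_on range (\<lambda>n. - int n)"
    using geo by (subst summable_on_reindex) (auto simp: h_def comp_def inj_def)
  ultimately have "h summable_on (range int \<union> range (\<lambda>n. - int n))" by (rule summable_on_union)
  also have "range int \<union> range (\<lambda>n. - int n) = UNIV"
  proof (intro equalityI subsetI)
    fix z :: int
    show "z \<in> range int \<union> range (\<lambda>n. - int n)" by (cases z rule: int_cases2) auto
  qed simp
  finally show "h summable_on UNIV" .
  fix z :: int
  have "nat \<bar>z\<bar> \<le> (nat \<bar>z\<bar>)\<^sup>2" by (cases "nat \<bar>z\<bar>") (simp_all add: power2_eq_square)
  then have "real (nat \<bar>z\<bar>) \<le> real ((nat \<bar>z\<bar>)\<^sup>2)" by (simp only: of_nat_le_iff)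
  also have "real ((nat \<bar>z\<bar>)\<^sup>2) = (real_of_int z)\<^sup>2" by simp
  also have "\<dots> \<le> (2 * pi * of_int z)\<^sup>2 / 2"
  proof -
    have "1 * (real_of_int z)\<^sup>2 \<le> (2 * pi\<^sup>2) * (real_of_int z)\<^sup>2"
      using pi_ge_two power_mono[of 2 pi 2] by (intro mult_right_mono) auto
    then show ?thesis by (simp add: power_mult_distrib)
  qed
  finally have "exp (- (2 * pi * of_int z)\<^sup>2 / 2) \<le> exp (- real (nat \<bar>z\<bar>))" by simp
  also have "exp (- real (nat \<bar>z\<bar>)) = exp (- 1) ^ nat \<bar>z\<bar>" by (simp flip: exp_of_nat_mult)
  also have "\<dots> \<le> (1 / 2) ^ nat \<bar>z\<bar>"
  proof (intro power_mono)
    have "exp 1 \<ge> (2::real)" using exp_ge_add_one_self[of 1] by simp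
    then show "exp (- 1) \<le> (1 / 2 :: real)" by (simp add: exp_minus field_simps)
  qed simp
  finally show "norm (fourier_transform (\<lambda>k. of_real (gaussian k)) (of_int z)) \<le> h z"
    unfolding fourier_transform_gaussian h_def norm_of_real by (simp add: abs_mult)
qed simp

section \<open>The autocorrelation of a tiling in the hull\<close>

text \<open>
  The integer points \<open>n\<close> with \<open>x + n \<in> [-R, R]\<close> form a window whose length differs from \<open>2 R\<close> by at most one.
\<close>

lemma tendsto_density:
  assumes p: "uniform_density p A"
  shows "((\<lambda>R. real (card ({x + of_int n |n. p n} \<inter> {- R..R})) / (2 * R)) \<longlongrightarrow> A) at_top"
proof -
  define s where "s R = \<lceil>- R - x\<rceil>" for R
  define N where "N R = nat (\<lfloor>R - x\<rfloor> - \<lceil>- R - x\<rceil> + 1)" for R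
  define c where "c R = (\<Sum>q<N R. if p (s R + int q) then 1 else (0::real))" for R
  have N: "2 * R - 1 \<le> real (N R)" "real (N R) \<le> 2 * R + 1" if "R \<ge> 1" for R
  proof -
    have "real (N R) = of_int (\<lfloor>R - x\<rfloor> - \<lceil>- R - x\<rceil> + 1)"
      using that unfolding N_def by (subst of_nat_nat) linarith+
    then show "2 * R - 1 \<le> real (N R)" "real (N R) \<le> 2 * R + 1" by linarith+
  qed
  have card: "real (card ({x + of_int n |n. p n} \<inter> {- R..R})) = c R" if "R \<ge> 1" for R
  proof -
    have "{x + of_int n |n. p n} \<inter> {- R..R} = (\<lambda>q. x + of_int (s R + int q)) ` ({..<N R} \<inter> {q. p (s R + int q)})"
    proof (intro equalityI subsetI)
      fix y assume "y \<in> {x + of_int n |n. p n} \<inter> {- R..R}"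
      then obtain n where n: "y = x + of_int n" "p n" "- R \<le> y" "y \<le> R" by auto
      then have "s R \<le> n" "n \<le> \<lfloor>R - x\<rfloor>" by (auto simp: s_def ceiling_le_iff le_floor_iff)
      then have "nat (n - s R) < N R" "s R + int (nat (n - s R)) = n" by (auto simp: N_def s_def)
      then show "y \<in> (\<lambda>q. x + of_int (s R + int q)) ` ({..<N R} \<inter> {q. p (s R + int q)})"
        using n by (intro image_eqI[of _ _ "nat (n - s R)"]) auto
    next
      fix y assume "y \<in> (\<lambda>q. x + of_int (s R + int q)) ` ({..<N R} \<inter> {q. p (s R + int q)})"
      then obtain q where q: "y = x + of_int (s R + int q)" "q < N R" "p (s R + int q)" by auto
      have "s R + int q \<le> \<lfloor>R - x\<rfloor>" using q(2) by (simp add: N_def s_def)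
      then have "real_of_int (s R + int q) \<le> R - x" by (simp only: le_floor_iff)
      moreover have "- R - x \<le> real_of_int (s R + int q)"
        unfolding s_def by (metis ceiling_le_iff le_add_same_cancel1 of_nat_0_le_iff)
      ultimately have "- R \<le> y" "y \<le> R" unfolding q(1) by linarith+
      then show "y \<in> {x + of_int n |n. p n} \<inter> {- R..R}" using q(1,3) by (simp only: Int_iff mem_Collect_eq atLeastAtMost_iff) blast
    qed
    then have "card ({x + of_int n |n. p n} \<inter> {- R..R}) = card ({..<N R} \<inter> {q. p (s R + int q)})"
      by (simp add: card_image inj_on_def)
    then show ?thesis by (simp add: c_def sum.If_cases)
  qed
  have N_top: "filterlim N sequentially at_top"
    unfolding filterlim_at_top
  proof
    fix Z :: nat
    show "\<forall>\<^sub>F R in at_top. Z \<le> N R"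
      using eventually_ge_at_top[of "real Z + 1"]
    proof eventually_elim
      case (elim R)
      then have "real Z \<le> real (N R)" using N(1)[of R] by simp
      then show ?case by simp
    qed
  qed
  have lim1: "((\<lambda>R. c R / real (N R)) \<longlongrightarrow> A) at_top"
  proof (rule tendstoI)
    fix \<epsilon> :: real assume "\<epsilon> > 0"
    then obtain R0 where R0: "\<And>M t. M \<ge> R0 \<Longrightarrow> \<bar>(\<Sum>q<M. if p (t + int q) then 1 else 0) / real M - A\<bar> \<le> \<epsilon> / 2"
      using p[unfolded uniform_density_def, rule_format, of "\<epsilon> / 2"] by auto
    have "\<forall>\<^sub>F R in at_top. R0 \<le> N R" using N_top unfolding filterlim_at_top by blast
    then show "\<forall>\<^sub>F R in at_top. dist (c R / real (N R)) A < \<epsilon>"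
    proof eventually_elim
      case (elim R)
      from R0[OF this, of "s R"] \<open>\<epsilon> > 0\<close> show ?case unfolding c_def dist_real_def by linarith
    qed
  qed
  have lim2: "((\<lambda>R. real (N R) / (2 * R)) \<longlongrightarrow> 1) at_top"
  proof (rule tendsto_sandwich)
    show "\<forall>\<^sub>F R in at_top. 1 - 1 / (2 * R) \<le> real (N R) / (2 * R)"
      using eventually_ge_at_top[of 1]
    proof eventually_elim
      case (elim R)
      have "(2 * R - 1) / (2 * R) \<le> real (N R) / (2 * R)"
        using elim by (intro divide_right_mono N) auto
      then show ?case using elim by (simp add: diff_divide_distrib)
    qed
    show "\<forall>\<^sub>F R in at_top. real (N R) / (2 * R) \<le> 1 + 1 / (2 * R)"
      using eventually_ge_at_top[of 1]
    proof eventually_elim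
      case (elim R)
      have "real (N R) / (2 * R) \<le> (2 * R + 1) / (2 * R)"
        using elim by (intro divide_right_mono N) auto
      then show ?case using elim by (simp add: add_divide_distrib)
    qed
    have "((\<lambda>R::real. 1 / (2 * R)) \<longlongrightarrow> 0) at_top"
      by (rule tendsto_divide_0[OF tendsto_const filterlim_at_top_imp_at_infinity])
         (auto intro: filterlim_tendsto_pos_mult_at_top filterlim_ident)
    then show "((\<lambda>R::real. 1 - 1 / (2 * R)) \<longlongrightarrow> 1) at_top" "((\<lambda>R::real. 1 + 1 / (2 * R)) \<longlongrightarrow> 1) at_top"
      using tendsto_diff[OF tendsto_const, of "\<lambda>R::real. 1 / (2 * R)" 0 at_top 1]
        tendsto_add[OF tendsto_const, of "\<lambda>R::real. 1 / (2 * R)" 0 at_top 1] by simp_all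
  qed
  have "((\<lambda>R. c R / real (N R) * (real (N R) / (2 * R))) \<longlongrightarrow> A * 1) at_top"
    by (intro tendsto_mult lim1 lim2)
  moreover have "\<forall>\<^sub>F R in at_top. c R / real (N R) * (real (N R) / (2 * R))
      = real (card ({x + of_int n |n. p n} \<inter> {- R..R})) / (2 * R)"
    using eventually_ge_at_top[of 1]
  proof eventually_elim
    case (elim R)
    then have "real (N R) > 0" using N(1)[of R] by linarith
    then show ?case using card[OF elim] by simp
  qed
  ultimately have "((\<lambda>R. real (card ({x + of_int n |n. p n} \<inter> {- R..R})) / (2 * R)) \<longlongrightarrow> A * 1) at_top"
    by (rule Lim_transform_eventually)
  then show ?thesis by simp
qed

lemma dens_eq: "uniform_density p A \<Longrightarrow> dens {x + of_int n |n. p n} = A"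
  unfolding dens_def by (intro tendsto_Lim tendsto_density) auto

lemma uniform_density_True: "uniform_density (\<lambda>_. True) 1"
  unfolding uniform_density_def
proof (intro allI impI)
  fix \<epsilon> :: real assume "\<epsilon> > 0"
  then show "\<exists>R0. \<forall>R\<ge>R0. \<forall>s::int. \<bar>(\<Sum>q<R. if True then 1 else 0) / real R - 1\<bar> \<le> \<epsilon>"
    by (intro exI[of _ 1]) auto
qed

lemma dens_tiling_of: "dens (\<Union>l. tiling_of x w l) = 1"
proof -
  have "(\<Union>l. tiling_of x w l) = {x + of_int n |n. True}" by (auto simp: tiling_of_def)
  then show ?thesis using dens_eq[OF uniform_density_True, of x] by simp
qed

lemma pair_correlation_tiling_of:
  assumes "uniform_density (\<lambda>n. w n = i \<and> w (n + z) = j) A"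
  shows "pair_correlation (tiling_of x w) i j (of_int z) = A"
proof -
  have "tiling_of x w i \<inter> (\<lambda>y. y - of_int z) ` tiling_of x w j = {x + of_int n |n. w n = i \<and> w (n + z) = j}"
  proof (intro equalityI subsetI)
    fix y assume "y \<in> tiling_of x w i \<inter> (\<lambda>y. y - of_int z) ` tiling_of x w j"
    then obtain n n' where n: "y = x + of_int n" "w n = i" "y = x + of_int n' - of_int z" "w n' = j"
      by (auto simp: tiling_of_def)
    then have "n' = n + z" by linarith
    with n show "y \<in> {x + of_int n |n. w n = i \<and> w (n + z) = j}" by auto
  next
    fix y assume "y \<in> {x + of_int n |n. w n = i \<and> w (n + z) = j}"
    then obtain n where n: "y = x + of_int n" "w n = i" "w (n + z) = j" by auto
    then have "x + of_int (n + z) \<in> tiling_of x w j" by (simp only: mem_tiling_of)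
    then show "y \<in> tiling_of x w i \<inter> (\<lambda>y. y - of_int z) ` tiling_of x w j"
      using n by (auto simp: mem_tiling_of image_iff intro!: bexI[of _ "x + of_int (n + z)"])
  qed
  then show ?thesis using dens_eq[OF assms, of x] by (simp add: pair_correlation_def dens_tiling_of)
qed

lemma pair_correlation_non_integer:
  assumes "y \<notin> \<int>"
  shows "pair_correlation (tiling_of x w) i j y = 0"
proof -
  have "tiling_of x w i \<inter> (\<lambda>t. t - y) ` tiling_of x w j = {}"
  proof (rule ccontr)
    assume "\<not> ?thesis"
    then obtain t where "t - y \<in> tiling_of x w i" "t \<in> tiling_of x w j" by auto
    then obtain n n' where "t - y = x + of_int n" "t = x + of_int n'" by (auto simp: tiling_of_def)
    then have "y = of_int (n' - n)" by simp
    with assms show False by (metis Ints_of_int)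
  qed
  then show ?thesis by (simp add: pair_correlation_def dens_def tendsto_Lim)
qed

lemma autocorrelation_eq_0: "y \<notin> \<int> \<Longrightarrow> autocorrelation (tiling_of x w) u y = 0"
  by (simp add: autocorrelation_def pair_correlation_non_integer)

lemma autocorrelation_average:
  fixes \<rho> :: "'a::finite substitution"
  assumes "constant_length L \<rho>" "primitive_substitution \<rho>" and w: "legal_sequence \<rho> w"
  shows "(\<lambda>R. (\<Sum>q<R. cnj (u $ w (int q)) * u $ w (int q + m)) / of_nat R)
     \<longlonglongrightarrow> autocorrelation (tiling_of x w) u (of_int m)"
proof -
  have "\<forall>i j. \<exists>A. uniform_density (\<lambda>n. w n = i \<and> w (n + m) = j) A"
    using uniform_pair_frequency[OF assms] by blast
  then have "\<exists>A. \<forall>i j. uniform_density (\<lambda>n. w n = i \<and> w (n + m) = j) (A i j)"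
    unfolding choice_iff .
  then obtain A where A: "\<And>i j. uniform_density (\<lambda>n. w n = i \<and> w (n + m) = j) (A i j)" by blast
  define c where "c i j R = (\<Sum>q<R. if w (int q) = i \<and> w (int q + m) = j then 1 else (0::real))" for i j R
  have lim: "(\<lambda>R. c i j R / real R) \<longlonglongrightarrow> A i j" for i j
  proof (rule LIMSEQ_I)
    fix \<epsilon> :: real assume "\<epsilon> > 0"
    then obtain R0 where "\<And>R s. R \<ge> R0 \<Longrightarrow>
        \<bar>(\<Sum>q<R. if w (s + int q) = i \<and> w (s + int q + m) = j then 1 else 0) / real R - A i j\<bar> \<le> \<epsilon> / 2"
      using A[of i j, unfolded uniform_density_def, rule_format, of "\<epsilon> / 2"] by auto
    from this[of _ 0] have near: "\<bar>c i j R / real R - A i j\<bar> \<le> \<epsilon> / 2" if "R \<ge> R0" for R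
      using that by (simp add: c_def)
    have "norm (c i j R / real R - A i j) < \<epsilon>" if "R \<ge> R0" for R
      using near[OF that] \<open>\<epsilon> > 0\<close> unfolding real_norm_def by linarith
    then show "\<exists>R0. \<forall>R\<ge>R0. norm (c i j R / real R - A i j) < \<epsilon>" by blast
  qed
  have "(\<Sum>q<R. cnj (u $ w (int q)) * u $ w (int q + m)) / of_nat R
      = (\<Sum>i\<in>UNIV. \<Sum>j\<in>UNIV. cnj (u $ i) * of_real (c i j R / real R) * u $ j)" for R
  proof -
    have "(\<Sum>i\<in>UNIV. \<Sum>j\<in>UNIV. if w (int q) = i \<and> w (int q + m) = j then cnj (u $ i) * u $ j else 0)
        = cnj (u $ w (int q)) * u $ w (int q + m)" for q
    proof -
      have "(\<Sum>i\<in>UNIV. \<Sum>j\<in>UNIV. if w (int q) = i \<and> w (int q + m) = j then cnj (u $ i) * u $ j else 0)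
          = (\<Sum>i\<in>UNIV. if w (int q) = i then cnj (u $ i) * u $ w (int q + m) else 0)"
        by (intro sum.cong refl) auto
      then show ?thesis by simp
    qed
    then have "(\<Sum>q<R. cnj (u $ w (int q)) * u $ w (int q + m))
       = (\<Sum>q<R. \<Sum>i\<in>UNIV. \<Sum>j\<in>UNIV. if w (int q) = i \<and> w (int q + m) = j then cnj (u $ i) * u $ j else 0)"
      by (simp only:)
    also have "\<dots> = (\<Sum>i\<in>UNIV. \<Sum>q<R. \<Sum>j\<in>UNIV. if w (int q) = i \<and> w (int q + m) = j then cnj (u $ i) * u $ j else 0)"
      by (rule sum.swap)
    also have "\<dots> = (\<Sum>i\<in>UNIV. \<Sum>j\<in>UNIV. \<Sum>q<R. if w (int q) = i \<and> w (int q + m) = j then cnj (u $ i) * u $ j else 0)"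
      by (rule sum.cong[OF refl], rule sum.swap)
    also have "\<dots> = (\<Sum>i\<in>UNIV. \<Sum>j\<in>UNIV. cnj (u $ i) * of_real (c i j R) * u $ j)"
    proof (rule sum.cong[OF refl], rule sum.cong[OF refl])
      fix i j
      have "cnj (u $ i) * of_real (c i j R) * u $ j
          = (\<Sum>q<R. cnj (u $ i) * of_real (if w (int q) = i \<and> w (int q + m) = j then 1 else (0::real)) * u $ j)"
        unfolding c_def of_real_sum sum_distrib_left sum_distrib_right ..
      also have "\<dots> = (\<Sum>q<R. if w (int q) = i \<and> w (int q + m) = j then cnj (u $ i) * u $ j else 0)"
        by (rule sum.cong[OF refl]) simp
      finally show "(\<Sum>q<R. if w (int q) = i \<and> w (int q + m) = j then cnj (u $ i) * u $ j else 0)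
          = cnj (u $ i) * of_real (c i j R) * u $ j" ..
    qed
    finally have "(\<Sum>q<R. cnj (u $ w (int q)) * u $ w (int q + m)) / of_nat R
       = (\<Sum>i\<in>UNIV. \<Sum>j\<in>UNIV. cnj (u $ i) * of_real (c i j R) * u $ j) / of_nat R"
      by (simp only:)
    also have "\<dots> = (\<Sum>i\<in>UNIV. \<Sum>j\<in>UNIV. cnj (u $ i) * of_real (c i j R / real R) * u $ j)"
      by (simp only: sum_divide_distrib of_real_divide of_real_of_nat_eq times_divide_eq_right times_divide_eq_left)
    finally show ?thesis .
  qed
  note average = this
  have "(\<lambda>R. \<Sum>i\<in>UNIV. \<Sum>j\<in>UNIV. cnj (u $ i) * of_real (c i j R / real R) * u $ j)
      \<longlonglongrightarrow> (\<Sum>i\<in>UNIV. \<Sum>j\<in>UNIV. cnj (u $ i) * of_real (A i j) * u $ j)"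
    by (intro tendsto_intros lim)
  moreover have "(\<Sum>i\<in>UNIV. \<Sum>j\<in>UNIV. cnj (u $ i) * of_real (A i j) * u $ j) = autocorrelation (tiling_of x w) u (of_int m)"
    unfolding autocorrelation_def dens_tiling_of pair_correlation_tiling_of[OF A] by simp
  ultimately show ?thesis by (simp only: average)
qed

text \<open>
  Only pairs with one member outside the window are missing from the average in the autocorrelation, and their number is
  bounded.
\<close>

lemma twisted_form_autocorrelation:
  fixes \<rho> :: "'a::finite substitution"
  assumes "constant_length L \<rho>" "primitive_substitution \<rho>" and w: "legal_sequence \<rho> w"
  shows "(\<lambda>R. twisted_form (\<lambda>k. ee (of_int m * k)) (\<lambda>q. cnj (u $ w (int q))) R / of_nat R)
     \<longlonglongrightarrow> autocorrelation (tiling_of x w) u (of_int m)"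
proof -
  define f where "f q = cnj (u $ w (int q)) * u $ w (int q + m)" for q
  define U where "U = (\<Sum>a\<in>UNIV. cmod (u $ a))"
  have U: "cmod (u $ a) \<le> U" for a unfolding U_def by (rule member_le_sum) auto
  have fU: "cmod (f q) \<le> U * U" for q
    unfolding f_def norm_mult complex_mod_cnj by (intro mult_mono U) (auto simp: U_def sum_nonneg)
  define g where "g q R = (\<Sum>q'<R. if m + int q = int q' then cnj (u $ w (int q)) * cnj (cnj (u $ w (int q'))) else 0)" for q R
  define cnt where "cnt q R = (\<Sum>q'<R. if m + int q = int q' then 1 else (0::real))" for q R
  have g: "g q R = of_real (cnt q R) * f q" and cnt: "cnt q R \<le> 1" "0 \<le> cnt q R" for q R
  proof -
    have *: "(\<Sum>q'<R. if m + int q = int q' then h q' else 0) = (if 0 \<le> m + int q \<and> m + int q < int R then h (nat (m + int q)) else 0)"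
      for h :: "nat \<Rightarrow> 'b::comm_monoid_add"
    proof (cases "0 \<le> m + int q \<and> m + int q < int R")
      case True
      then have "(m + int q = int q') = (q' = nat (m + int q))" "nat (m + int q) < R" for q' by auto
      then show ?thesis using True by simp
    qed (auto intro!: sum.neutral)
    show "g q R = of_real (cnt q R) * f q"
      unfolding g_def cnt_def * by (auto simp: f_def add.commute)
    show "cnt q R \<le> 1" "0 \<le> cnt q R" unfolding cnt_def * by auto
  qed
  have "(\<lambda>R. (\<Sum>q<R. f q) / of_nat R - (\<Sum>q<R. g q R) / of_nat R) \<longlonglongrightarrow> 0"
  proof (rule Lim_null_comparison)
    show "(\<lambda>R. 2 * \<bar>real_of_int m\<bar> * (U * U) / real R) \<longlonglongrightarrow> 0" by (rule lim_const_over_n)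
    show "\<forall>\<^sub>F R in sequentially. norm ((\<Sum>q<R. f q) / of_nat R - (\<Sum>q<R. g q R) / of_nat R)
        \<le> 2 * \<bar>real_of_int m\<bar> * (U * U) / real R"
    proof (intro always_eventually allI)
      fix R
      have "cmod ((\<Sum>q<R. f q) - (\<Sum>q<R. g q R)) = cmod (\<Sum>q<R. of_real (1 - cnt q R) * f q)"
        by (simp add: g sum_subtractf left_diff_distrib)
      also have "\<dots> \<le> (\<Sum>q<R. (1 - cnt q R) * (U * U))"
      proof (rule sum_norm_le)
        fix q
        have "cmod (of_real (1 - cnt q R) * f q) = (1 - cnt q R) * cmod (f q)"
          using cnt[of q R] by (simp add: norm_mult del: of_real_diff)
        also have "\<dots> \<le> (1 - cnt q R) * (U * U)" using cnt[of q R] by (intro mult_left_mono fU) simp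
        finally show "cmod (of_real (1 - cnt q R) * f q) \<le> (1 - cnt q R) * (U * U)" .
      qed
      also have "\<dots> = (real R - (\<Sum>q<R. cnt q R)) * (U * U)"
        by (simp add: sum_distrib_right[symmetric] sum_subtractf)
      also have "\<dots> \<le> 2 * \<bar>real_of_int m\<bar> * (U * U)"
        using pair_count_bounds[of m R] by (intro mult_right_mono) (auto simp: cnt_def)
      finally show "norm ((\<Sum>q<R. f q) / of_nat R - (\<Sum>q<R. g q R) / of_nat R)
        \<le> 2 * \<bar>real_of_int m\<bar> * (U * U) / real R"
        by (simp add: diff_divide_distrib[symmetric] norm_divide divide_right_mono)
    qed
  qed
  from tendsto_diff[OF autocorrelation_average[OF assms, of u m x] this]
  show ?thesis by (simp add: f_def g_def twisted_form_ee)
qed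

section \<open>Singularity of the diffraction measures\<close>

lemma norm_twisted_form_le:
  assumes D: "multiplier D"
  shows "cmod (twisted_form (\<lambda>k. of_real (D k) * ee (of_int z * k)) x R) \<le> energy D x {..<R}"
proof -
  have "cmod (twisted_form (\<lambda>k. of_real (D k) * ee (of_int z * k)) x R)
     \<le> (LINT k|unit_measure 0. cmod (of_real (D k) * ee (of_int z * k) *
        (\<Sum>q<R. x q * ee (real q * k)) * cnj (\<Sum>q<R. x q * ee (real q * k))))"
    unfolding twisted_form_def by (rule integral_norm_bound)
  also have "\<dots> = energy D x {..<R}"
    unfolding energy_def using multiplierD(2)[OF D]
    by (intro Bochner_Integration.integral_cong refl) (simp only: norm_mult complex_mod_cnj norm_ee norm_of_real power2_eq_square abs_of_nonneg mult_1_right mult.assoc)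
  finally show ?thesis .
qed

text \<open>
  For a character \<open>e(m k)\<close> this is the definition of the diffraction measure, applied to a modulated Gaussian,
  whose Fourier transform is a shifted one.  The general case follows by linearity.
\<close>

lemma diffraction_pairing:
  fixes \<rho> :: "'a::finite substitution"
  assumes \<rho>: "constant_length L \<rho>" "primitive_substitution \<rho>" and w: "legal_sequence \<rho> w"
    and \<sigma>: "is_diffraction_measure (tiling_of x w) u \<sigma>" and g: "trig_poly g"
  shows "integrable \<sigma> (\<lambda>k. g k * of_real (gaussian k)) \<and>
    (\<exists>\<eta>. (\<forall>z::int. (\<lambda>R. twisted_form (\<lambda>k. g k * ee (of_int z * k)) (\<lambda>q. cnj (u $ w (int q))) R / of_nat R) \<longlonglongrightarrow> \<eta> z) \<and>
      ((\<lambda>z. \<eta> z * fourier_transform (\<lambda>k. of_real (gaussian k)) (of_int z)) has_sum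
        (LINT k|\<sigma>. g k * of_real (gaussian k))) UNIV)"
  using g
proof induction
  case (trig_poly_ee m)
  define \<gamma> where "\<gamma> = autocorrelation (tiling_of x w) u"
  define F where "F = fourier_transform (\<lambda>k. of_real (gaussian k))"
  have "integrable \<sigma> (\<lambda>k. ee (of_int m * k) * of_real (gaussian k))"
    and sum: "((\<lambda>y. \<gamma> y * F (y - of_int m)) has_sum (LINT k|\<sigma>. ee (of_int m * k) * of_real (gaussian k))) UNIV"
    using \<sigma> schwartz_modulated_gaussian[of m]
    unfolding is_diffraction_measure_def is_fourier_transform_of_def \<gamma>_def[symmetric] F_def
    by (auto simp: fourier_transform_modulate)
  moreover have "((\<lambda>z. \<gamma> (of_int (m + z)) * F (of_int z)) has_sum (LINT k|\<sigma>. ee (of_int m * k) * of_real (gaussian k))) UNIV"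
  proof -
    have range: "\<int> = range (\<lambda>z::int. real_of_int (m + z))"
    proof (intro equalityI subsetI)
      fix y :: real assume "y \<in> \<int>"
      then obtain n where "y = of_int n" by (auto elim: Ints_cases)
      then show "y \<in> range (\<lambda>z::int. real_of_int (m + z))" by (intro image_eqI[of _ _ "n - m"]) auto
    qed auto
    have "((\<lambda>y. \<gamma> y * F (y - of_int m)) has_sum (LINT k|\<sigma>. ee (of_int m * k) * of_real (gaussian k))) \<int>"
      using sum by (rule has_sum_cong_neutral[THEN iffD1, rotated -1]) (auto simp: \<gamma>_def autocorrelation_eq_0)
    then have "(((\<lambda>y. \<gamma> y * F (y - of_int m)) \<circ> (\<lambda>z::int. real_of_int (m + z))) has_sum (LINT k|\<sigma>. ee (of_int m * k) * of_real (gaussian k))) UNIV"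
      unfolding range by (subst (asm) has_sum_reindex) (auto simp: inj_on_def)
    then show ?thesis by (simp add: comp_def)
  qed
  moreover have "(\<lambda>k. ee (of_int m * k) * ee (of_int z * k)) = (\<lambda>k. ee (of_int (m + z) * k))" for z
    by (simp add: ee_add distrib_right)
  ultimately show ?case
    using twisted_form_autocorrelation[OF \<rho> w, of _ u x] unfolding \<gamma>_def F_def
    by (intro conjI exI[of _ "\<lambda>z. autocorrelation (tiling_of x w) u (of_int (m + z))"] allI) (simp_all only:)
next
  case (trig_poly_add g h)
  define X where "X = (\<lambda>q. cnj (u $ w (int q)))"
  from trig_poly_add.IH obtain \<eta> \<eta>' where
    int: "integrable \<sigma> (\<lambda>k. g k * of_real (gaussian k))" "integrable \<sigma> (\<lambda>k. h k * of_real (gaussian k))" and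
    lim: "\<And>z::int. (\<lambda>R. twisted_form (\<lambda>k. g k * ee (of_int z * k)) X R / of_nat R) \<longlonglongrightarrow> \<eta> z"
      "\<And>z::int. (\<lambda>R. twisted_form (\<lambda>k. h k * ee (of_int z * k)) X R / of_nat R) \<longlonglongrightarrow> \<eta>' z" and
    sum: "((\<lambda>z. \<eta> z * fourier_transform (\<lambda>k. of_real (gaussian k)) (of_int z)) has_sum
        (LINT k|\<sigma>. g k * of_real (gaussian k))) UNIV"
      "((\<lambda>z. \<eta>' z * fourier_transform (\<lambda>k. of_real (gaussian k)) (of_int z)) has_sum
        (LINT k|\<sigma>. h k * of_real (gaussian k))) UNIV"
    unfolding X_def by blast
  have "twisted_form (\<lambda>k. (g k + h k) * ee (of_int z * k)) X R
      = twisted_form (\<lambda>k. g k * ee (of_int z * k)) X R + twisted_form (\<lambda>k. h k * ee (of_int z * k)) X R" for z R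
    unfolding distrib_right
    by (intro twisted_form_add trig_poly_mult trig_poly_add.hyps trig_poly.trig_poly_ee)
  then have "(\<lambda>R. twisted_form (\<lambda>k. (g k + h k) * ee (of_int z * k)) X R / of_nat R) \<longlonglongrightarrow> \<eta> z + \<eta>' z" for z
    using tendsto_add[OF lim(1)[of z] lim(2)[of z]] by (simp add: add_divide_distrib)
  moreover have "((\<lambda>z. (\<eta> z + \<eta>' z) * fourier_transform (\<lambda>k. of_real (gaussian k)) (of_int z)) has_sum
        (LINT k|\<sigma>. (g k + h k) * of_real (gaussian k))) UNIV"
    using has_sum_add[OF sum] int by (simp add: distrib_right)
  ultimately show ?case
    using int unfolding X_def by (intro conjI exI[of _ "\<lambda>z. \<eta> z + \<eta>' z"]) (auto simp: distrib_right)
next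
  case (trig_poly_scale g c)
  define X where "X = (\<lambda>q. cnj (u $ w (int q)))"
  from trig_poly_scale.IH obtain \<eta> where
    int: "integrable \<sigma> (\<lambda>k. g k * of_real (gaussian k))" and
    lim: "\<And>z::int. (\<lambda>R. twisted_form (\<lambda>k. g k * ee (of_int z * k)) X R / of_nat R) \<longlonglongrightarrow> \<eta> z" and
    sum: "((\<lambda>z. \<eta> z * fourier_transform (\<lambda>k. of_real (gaussian k)) (of_int z)) has_sum
        (LINT k|\<sigma>. g k * of_real (gaussian k))) UNIV"
    unfolding X_def by blast
  have "(\<lambda>R. twisted_form (\<lambda>k. (c * g k) * ee (of_int z * k)) X R / of_nat R) \<longlonglongrightarrow> c * \<eta> z" for z
    using tendsto_mult_left[OF lim[of z], of c] by (simp add: mult.assoc twisted_form_scale)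
  moreover have "((\<lambda>z. (c * \<eta> z) * fourier_transform (\<lambda>k. of_real (gaussian k)) (of_int z)) has_sum
        (LINT k|\<sigma>. (c * g k) * of_real (gaussian k))) UNIV"
    using has_sum_cmult_right[OF sum, of c] by (simp add: mult.assoc)
  moreover have "integrable \<sigma> (\<lambda>k. (c * g k) * of_real (gaussian k))"
    using int by (simp add: mult.assoc)
  ultimately show ?case unfolding X_def by (intro conjI exI[of _ "\<lambda>z. c * \<eta> z"] allI)
qed

context abelian_columns
begin

text \<open>
  The coefficients \<open>\<eta>\<close> are limits of energies per length with a modulated multiplier, and modulation by a
  character does not increase the modulus beyond the energy itself.
\<close>

lemma integral_damp_gaussian_le:
  assumes \<rho>: "constant_length L \<rho>" "primitive_substitution \<rho>" and w: "legal_sequence \<rho> w"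
    and \<sigma>: "is_diffraction_measure (tiling_of x w) u \<sigma>" and D: "multiplier D"
    and bound: "\<And>R. energy D (\<lambda>q. cnj (u $ w (int q))) {..<R} \<le> \<beta> * real R + \<epsilon>"
  shows "integrable \<sigma> (\<lambda>k. D k * gaussian k)"
    "(LINT k|\<sigma>. D k * gaussian k) \<le> \<beta> * (\<Sum>\<^sub>\<infinity>z::int. norm (fourier_transform (\<lambda>k. of_real (gaussian k)) (of_int z)))"
proof -
  define F where "F z = fourier_transform (\<lambda>k. of_real (gaussian k)) (of_int z)" for z :: int
  obtain \<eta> where int: "integrable \<sigma> (\<lambda>k. complex_of_real (D k) * of_real (gaussian k))" and
    lim: "\<And>z::int. (\<lambda>R. twisted_form (\<lambda>k. of_real (D k) * ee (of_int z * k)) (\<lambda>q. cnj (u $ w (int q))) R / of_nat R) \<longlonglongrightarrow> \<eta> z" and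
    sum: "((\<lambda>z. \<eta> z * F z) has_sum (LINT k|\<sigma>. of_real (D k) * of_real (gaussian k))) UNIV"
    using diffraction_pairing[OF \<rho> w \<sigma> multiplierD(1)[OF D]] unfolding F_def by blast
  from integrable_Re[OF int] show "integrable \<sigma> (\<lambda>k. D k * gaussian k)" by simp
  have \<eta>: "cmod (\<eta> z) \<le> \<beta>" for z
  proof (rule tendsto_le[OF _ _ tendsto_norm[OF lim[of z]]])
    have "(\<lambda>R. \<beta> + \<epsilon> / real R) \<longlonglongrightarrow> \<beta> + 0" by (intro tendsto_intros lim_const_over_n)
    then show "(\<lambda>R. \<beta> + \<epsilon> / real R) \<longlonglongrightarrow> \<beta>" by simp
    show "\<forall>\<^sub>F R in sequentially. cmod (twisted_form (\<lambda>k. of_real (D k) * ee (of_int z * k)) (\<lambda>q. cnj (u $ w (int q))) R / of_nat R)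
        \<le> \<beta> + \<epsilon> / real R"
      using eventually_gt_at_top[of 0]
    proof eventually_elim
      case (elim R)
      have "cmod (twisted_form (\<lambda>k. of_real (D k) * ee (of_int z * k)) (\<lambda>q. cnj (u $ w (int q))) R) \<le> \<beta> * real R + \<epsilon>"
        using norm_twisted_form_le[OF D] bound order_trans by blast
      then have "cmod (twisted_form (\<lambda>k. of_real (D k) * ee (of_int z * k)) (\<lambda>q. cnj (u $ w (int q))) R) / real R
          \<le> (\<beta> * real R + \<epsilon>) / real R" by (intro divide_right_mono) auto
      also have "\<dots> = \<beta> + \<epsilon> / real R" using elim by (simp add: field_simps)
      finally show ?case by (simp add: norm_divide)
    qed
  qed simp
  have Fs: "(\<lambda>z. norm (F z)) summable_on UNIV" unfolding F_def by (rule summable_fourier_gaussian)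
  have "cmod (LINT k|\<sigma>. of_real (D k) * of_real (gaussian k)) \<le> \<beta> * (\<Sum>\<^sub>\<infinity>z. norm (F z))"
  proof (rule norm_infsum_le[OF sum, where g = "\<lambda>z. \<beta> * norm (F z)"])
    show "((\<lambda>z. \<beta> * norm (F z)) has_sum \<beta> * (\<Sum>\<^sub>\<infinity>z. norm (F z))) UNIV"
      by (intro has_sum_cmult_right has_sum_infsum Fs)
    show "norm (\<eta> z * F z) \<le> \<beta> * norm (F z)" for z
      unfolding norm_mult by (intro mult_right_mono \<eta>) auto
  qed
  moreover have "(LINT k|\<sigma>. complex_of_real (D k) * of_real (gaussian k)) = of_real (LINT k|\<sigma>. D k * gaussian k)"
    by (simp flip: of_real_mult)
  ultimately show "(LINT k|\<sigma>. D k * gaussian k) \<le> \<beta> * (\<Sum>\<^sub>\<infinity>z::int. norm (fourier_transform (\<lambda>k. of_real (gaussian k)) (of_int z)))"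
    unfolding F_def by (simp add: abs_le_iff)
qed

text \<open>
  The measure may be infinite, so the criterion is applied with a Gaussian weight, whose Fourier transform is summable
  over the integers.
\<close>

theorem diffraction_measure_singular:
  assumes \<rho>: "constant_length L \<rho>" "primitive_substitution \<rho>" and \<Lambda>: "legal_tiling \<rho> \<Lambda>"
    and \<sigma>: "is_diffraction_measure \<Lambda> u \<sigma>"
  shows "singular_measure \<sigma>"
proof (rule singular_measure_criterion[where \<psi> = gaussian])
  show "sets \<sigma> = sets borel"
    using \<sigma> by (simp add: is_diffraction_measure_def is_fourier_transform_of_def)
  show "gaussian \<in> borel_measurable borel" unfolding gaussian_def[abs_def] by measurable
  show "0 < gaussian k" for k by (simp add: gaussian_def)
  fix \<delta> :: real assume "\<delta> > 0"
  obtain x w where xw: "\<Lambda> = tiling_of x w" "legal_sequence \<rho> w" using \<Lambda> by (auto simp: legal_tiling_def)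
  obtain C E where CE: "C \<ge> 0" "\<And>i. E i \<ge> 0"
    "\<And>i b u K. i > 0 \<Longrightarrow> legal_word \<rho> b \<Longrightarrow> (\<And>a. cmod (u a) \<le> K) \<Longrightarrow>
       energy (damp i) (\<lambda>q. u (b ! q)) {..<length b} \<le> K\<^sup>2 * (C / real i * real (length b) + E i)"
    using energy_legal_word_le by blast
  define K where "K = (\<Sum>a\<in>UNIV. cmod (u $ a))"
  have K: "cmod (cnj (u $ a)) \<le> K" for a unfolding K_def complex_mod_cnj by (rule member_le_sum) auto
  have bound: "energy (damp i) (\<lambda>q. cnj (u $ w (int q))) {..<R} \<le> (K\<^sup>2 * (C / real i)) * real R + K\<^sup>2 * E i" if "i > 0" for i R
  proof -
    define b where "b = map w [0..int R - 1]"
    have b: "legal_word \<rho> b" "length b = R" using xw(2) by (simp_all add: b_def legal_sequence_def)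
    have "b ! q = w (int q)" if "q < R" for q using that by (simp add: b_def)
    then have "energy (damp i) (\<lambda>q. cnj (u $ w (int q))) {..<R} = energy (damp i) (\<lambda>q. cnj (u $ (b ! q))) {..<length b}"
      by (simp add: energy_def b(2))
    also have "\<dots> \<le> K\<^sup>2 * (C / real i * real (length b) + E i)" by (rule CE(3)[OF that b(1) K])
    finally show ?thesis by (simp add: b(2) algebra_simps)
  qed
  define T where "T = (\<Sum>\<^sub>\<infinity>z::int. norm (fourier_transform (\<lambda>k. of_real (gaussian k)) (of_int z)))"
  obtain i0 where i0: "K\<^sup>2 * C * T / \<delta> < real i0" using reals_Archimedean2 by blast
  define g where "g i = damp (i + i0 + 1)" for i
  have "(\<integral>\<^sup>+k. ennreal (g i k * gaussian k) \<partial>\<sigma>) \<le> ennreal \<delta>" for i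
  proof -
    have ii: "i + i0 + 1 > 0" by simp
    note * = integral_damp_gaussian_le[OF \<rho> xw(2) \<sigma>[unfolded xw(1)] multiplier_damp bound[OF ii]]
    have "(LINT k|\<sigma>. g i k * gaussian k) \<le> K\<^sup>2 * (C / real (i + i0 + 1)) * T"
      unfolding g_def T_def by (rule *(2))
    also have "\<dots> \<le> \<delta>"
    proof -
      have "K\<^sup>2 * C * T < \<delta> * real i0" using i0 \<open>\<delta> > 0\<close> by (simp add: field_simps)
      also have "\<dots> \<le> \<delta> * real (i + i0 + 1)" using \<open>\<delta> > 0\<close> by (intro mult_left_mono) auto
      finally show ?thesis by (simp add: divide_le_eq)
    qed
    finally have "(LINT k|\<sigma>. g i k * gaussian k) \<le> \<delta>" .
    moreover have "(\<integral>\<^sup>+k. ennreal (g i k * gaussian k) \<partial>\<sigma>) = ennreal (LINT k|\<sigma>. g i k * gaussian k)"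
      unfolding g_def using multiplierD(2)[OF multiplier_damp]
      by (intro nn_integral_eq_integral *(1)) (auto simp: gaussian_def)
    ultimately show ?thesis by (simp add: ennreal_leI)
  qed
  moreover have "AE k in lborel. (\<lambda>i. g i k) \<longlonglongrightarrow> 1"
    using AE_damp_tendsto_1
  proof eventually_elim
    case (elim k)
    from LIMSEQ_ignore_initial_segment[OF elim, of "i0 + 1"] show ?case by (simp add: g_def add.assoc)
  qed
  moreover have "g i \<in> borel_measurable borel" for i
    unfolding g_def by (rule measurable_damp)
  ultimately show "\<exists>g :: nat \<Rightarrow> real \<Rightarrow> real. (\<forall>i. g i \<in> borel_measurable borel) \<and> (\<forall>i k. 0 \<le> g i k)
       \<and> (AE k in lborel. (\<lambda>i. g i k) \<longlonglongrightarrow> 1) \<and> (\<forall>i. (\<integral>\<^sup>+k. ennreal (g i k * gaussian k) \<partial>\<sigma>) \<le> ennreal \<delta>)"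
    using multiplierD(2)[OF multiplier_damp] by (intro exI[of _ g]) (auto simp: g_def)
qed

end

section \<open>From the displacement algebra to commuting columns\<close>

lemma trig_sum_eq_0_imp_coefficients:
  assumes "\<And>k. (\<Sum>r<L. c r * ee (real r * k)) = 0"
  shows "\<forall>r<L. c r = 0"
proof -
  have "(\<Sum>r<L. (cmod (c r))\<^sup>2) = 0"
    using parseval[of "{..<L}" 0 c] by (simp add: assms)
  then show ?thesis by (subst (asm) sum_nonneg_eq_0_iff) auto
qed

text \<open>
  The matrix \<open>B(k)\<close> is a Fourier sum whose coefficients are the permutation matrices of the columns.
  Comparing the coefficients of \<open>e(p k + q k')\<close> in \<open>B(k) B(k') = B(k') B(k)\<close> shows that these matrices commute.
\<close>

lemma IDA_abelian_imp_columns_commute: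
  fixes \<rho> :: "'a::finite substitution"
  assumes len: "\<And>a. length (\<rho> a) = L" and ab: "abelian_algebra (IDA \<rho>)"
    and "r < L" "s < L"
  shows "column \<rho> r (column \<rho> s a) = column \<rho> s (column \<rho> r a)"
proof -
  define i where "i = column \<rho> r (column \<rho> s a)"
  define \<delta> where "\<delta> p q = (if \<rho> (\<rho> a ! q) ! p = i then 1 else 0 :: complex)" for p q
  note entry = fourier_matrix_entry[OF len]
  have prod: "(fourier_matrix \<rho> k ** fourier_matrix \<rho> k') $ i $ a
      = (\<Sum>p<L. \<Sum>q<L. \<delta> p q * ee (real p * k) * ee (real q * k'))" for k k'
  proof -
    have "(fourier_matrix \<rho> k ** fourier_matrix \<rho> k') $ i $ a
        = (\<Sum>c\<in>UNIV. \<Sum>p<L. \<Sum>q<L. (if \<rho> c ! p = i then ee (real p * k) else 0) * (if \<rho> a ! q = c then ee (real q * k') else 0))"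
      by (simp only: matrix_matrix_mult_def vec_lambda_beta entry sum_product)
    also have "\<dots> = (\<Sum>p<L. \<Sum>c\<in>UNIV. \<Sum>q<L. (if \<rho> c ! p = i then ee (real p * k) else 0) * (if \<rho> a ! q = c then ee (real q * k') else 0))"
      by (rule sum.swap)
    also have "\<dots> = (\<Sum>p<L. \<Sum>q<L. \<Sum>c\<in>UNIV. (if \<rho> c ! p = i then ee (real p * k) else 0) * (if \<rho> a ! q = c then ee (real q * k') else 0))"
      by (rule sum.cong[OF refl], rule sum.swap)
    also have "\<dots> = (\<Sum>p<L. \<Sum>q<L. \<delta> p q * ee (real p * k) * ee (real q * k'))"
    proof (rule sum.cong[OF refl], rule sum.cong[OF refl])
      fix p q
      have "(\<Sum>c\<in>UNIV. (if \<rho> c ! p = i then ee (real p * k) else 0) * (if \<rho> a ! q = c then ee (real q * k') else 0))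
          = (\<Sum>c\<in>UNIV. if \<rho> a ! q = c then (if \<rho> c ! p = i then ee (real p * k) else 0) * ee (real q * k') else 0)"
        by (rule sum.cong[OF refl]) simp
      then show "(\<Sum>c\<in>UNIV. (if \<rho> c ! p = i then ee (real p * k) else 0) * (if \<rho> a ! q = c then ee (real q * k') else 0))
          = \<delta> p q * ee (real p * k) * ee (real q * k')" by (simp add: \<delta>_def)
    qed
    finally show ?thesis .
  qed
  have "fourier_matrix \<rho> k \<in> IDA \<rho>" for k unfolding IDA_def by (rule hull_inc) simp
  then have comm: "fourier_matrix \<rho> k ** fourier_matrix \<rho> k' = fourier_matrix \<rho> k' ** fourier_matrix \<rho> k" for k k'
    using ab unfolding abelian_algebra_def by blast
  have "(\<Sum>p<L. (\<Sum>q<L. (\<delta> p q - \<delta> q p) * ee (real q * k')) * ee (real p * k)) = 0" for k k'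
  proof -
    have "(\<Sum>p<L. \<Sum>q<L. \<delta> p q * ee (real p * k) * ee (real q * k'))
        = (\<Sum>p<L. \<Sum>q<L. \<delta> p q * ee (real p * k') * ee (real q * k))"
      unfolding prod[symmetric] by (simp only: comm[of k k'])
    also have "\<dots> = (\<Sum>q<L. \<Sum>p<L. \<delta> p q * ee (real p * k') * ee (real q * k))"
      by (rule sum.swap)
    also have "\<dots> = (\<Sum>p<L. \<Sum>q<L. \<delta> q p * ee (real p * k) * ee (real q * k'))"
      by (rule sum.cong[OF refl], rule sum.cong[OF refl]) (simp only: mult_ac)
    finally have eq: "(\<Sum>p<L. \<Sum>q<L. \<delta> p q * ee (real p * k) * ee (real q * k'))
        = (\<Sum>p<L. \<Sum>q<L. \<delta> q p * ee (real p * k) * ee (real q * k'))" .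
    have "(\<Sum>q<L. (\<delta> p q - \<delta> q p) * ee (real q * k')) * ee (real p * k)
        = (\<Sum>q<L. \<delta> p q * ee (real p * k) * ee (real q * k')) - (\<Sum>q<L. \<delta> q p * ee (real p * k) * ee (real q * k'))" for p
      unfolding sum_distrib_right sum_subtractf[symmetric]
      by (rule sum.cong[OF refl]) (simp add: algebra_simps)
    then show ?thesis by (simp only: sum_subtractf eq diff_self)
  qed
  \<comment> \<open>Distinct characters are orthogonal, so both layers of coefficients vanish.\<close>
  then have "\<forall>p<L. (\<Sum>q<L. (\<delta> p q - \<delta> q p) * ee (real q * k')) = 0" for k'
    by (rule trig_sum_eq_0_imp_coefficients)
  then have "(\<Sum>q<L. (\<delta> r q - \<delta> q r) * ee (real q * k')) = 0" for k'
    using \<open>r < L\<close> by simp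
  then have "\<forall>q<L. \<delta> r q - \<delta> q r = 0"
    by (rule trig_sum_eq_0_imp_coefficients)
  then have "\<delta> r s = \<delta> s r" using \<open>s < L\<close> by simp
  then show ?thesis by (simp add: \<delta>_def i_def column_def split: if_splits)
qed

lemma abelian_columns_exists:
  fixes \<rho> :: "'a::finite substitution"
  assumes "constant_length L \<rho>" "bijective_substitution L \<rho>" "abelian_algebra (IDA \<rho>)"
  obtains d \<phi> \<kappa> ev where "abelian_columns \<rho> L d \<phi> \<kappa> ev"
proof -
  have L: "L \<ge> 2" and len: "\<And>a. length (\<rho> a) = L" using assms(1) by (auto simp: constant_length_def)
  obtain d :: nat and \<phi> :: "nat \<Rightarrow> 'a \<Rightarrow> complex" and \<kappa> :: "nat \<Rightarrow> 'a" where \<phi>: "\<And>i. i < d \<Longrightarrow> joint_eigenfunction (column \<rho>) L (\<phi> i)"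
    and \<kappa>: "\<And>u b. u b = (\<Sum>i<d. u (\<kappa> i) * \<phi> i b)"
  proof (rule joint_eigenbasis[of L "column \<rho>"])
    fix d :: nat and \<phi> :: "nat \<Rightarrow> 'a \<Rightarrow> complex" and \<kappa> :: "nat \<Rightarrow> 'a"
    assume *: "\<And>i. i < d \<Longrightarrow> joint_eigenfunction (column \<rho>) L (\<phi> i)"
      and **: "\<And>u b. u b = (\<Sum>i<d. u (\<kappa> i) * \<phi> i b)"
    show thesis by (rule that[of d \<phi> \<kappa>, OF * **])
  next
    show "bij (column \<rho> r)" if "r < L" for r
      using assms(2) that by (simp add: bijective_substitution_def)
    show "column \<rho> r (column \<rho> s a) = column \<rho> s (column \<rho> r a)" if "r < L" "s < L" for r s a
      by (rule IDA_abelian_imp_columns_commute[OF len assms(3) that])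
  qed
  have "\<forall>i r. \<exists>z. i < d \<longrightarrow> r < L \<longrightarrow> cmod z = 1 \<and> (\<forall>a. \<phi> i (\<rho> a ! r) = z * \<phi> i a)"
    using \<phi> unfolding joint_eigenfunction_def column_def by blast
  then obtain ev where "\<forall>i r. i < d \<longrightarrow> r < L \<longrightarrow> cmod (ev i r) = 1 \<and> (\<forall>a. \<phi> i (\<rho> a ! r) = ev i r * \<phi> i a)"
    unfolding choice_iff by blast
  then have "abelian_columns \<rho> L d \<phi> \<kappa> ev"
    using L len by unfold_locales (blast | rule \<kappa>)+
  then show thesis by (rule that)
qed

theorem theorem4p1:
  fixes \<rho> :: "'a::finite \<Rightarrow> 'a list" and L :: nat and Y :: "('a \<Rightarrow> real set) set"
  assumes "constant_length L \<rho>"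
    and "primitive_substitution \<rho>"
    and "bijective_substitution L \<rho>"
    and "is_hull L \<rho> Y"
    and "aperiodic_hull Y"
    and "abelian_algebra (IDA \<rho>)"
  shows "(AE k in lborel. \<forall>\<theta>\<in>lyapunov_exponents L \<rho> k. \<theta> > 0) \<and>
    (\<forall>\<Lambda>\<in>Y. \<forall>u \<sigma>. is_diffraction_measure \<Lambda> u \<sigma> \<longrightarrow> singular_measure \<sigma>) \<and>
    (\<forall>\<mu>. invariant_probability Y \<mu> \<longrightarrow>
       (\<forall>f \<sigma>. square_integrable \<mu> f \<longrightarrow> is_spectral_measure \<mu> f \<sigma> \<longrightarrow> singular_measure \<sigma>))"
proof -
  obtain d \<phi> \<kappa> ev where "abelian_columns \<rho> L d \<phi> \<kappa> ev"
    using abelian_columns_exists[OF assms(1,3,6)] .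
  then interpret abelian_columns \<rho> L d \<phi> \<kappa> ev .
  show ?thesis
  proof (intro conjI ballI allI impI)
    show "AE k in lborel. \<forall>\<theta>\<in>lyapunov_exponents L \<rho> k. \<theta> > 0"
      by (rule lyapunov_exponents_positive)
  next
    fix \<Lambda> u \<sigma> assume "\<Lambda> \<in> Y" "is_diffraction_measure \<Lambda> u \<sigma>"
    then show "singular_measure \<sigma>"
      using diffraction_measure_singular[OF assms(1,2) hull_legal_tiling[OF assms(4)]] by blast
  next
    fix \<mu> f \<sigma>
    assume "invariant_probability Y \<mu>" and f: "square_integrable \<mu> f" "is_spectral_measure \<mu> f \<sigma>"
    then interpret abelian_system \<rho> L d \<phi> \<kappa> ev Y \<mu>
      using hull_legal_tiling[OF assms(4)] by unfold_locales
    show "singular_measure \<sigma>" by (rule spectral_measure_singular[OF f])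
  qed
qed

end
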